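(* Let $\Gamma\subseteq\Delta\subseteq\mathcal{T}$ be discrete countable LCA groups such that $\mathcal{T}/\Gamma$ is finite. Let $(\mathcal{X},\mu)$ be a $\sigma$-finite measure space, and let $\sigma$ be a quasi-$\mathcal{T}$-invariant action of $\mathcal{T}$ on $\mathcal{X}$ with the tiling property; $\Gamma$ and $\Delta$ act on $\mathcal{X}$ by restriction of $\sigma$. Let $\ell\in\mathbb{N}$ and $\Psi=\{\psi_1,\dots,\psi_m\}\subseteq L^2(\mathcal{X})$. Then there exists $W^*\in\mathcal{C}_\ell^\Delta$, i.e. a finitely generated $(\Gamma,\sigma)$-invariant space of length at most $\ell$ that is also $(\Delta,\sigma)$-invariant, such that $$\sum_{j=1}^m\|\psi_j-P_{W^*}\psi_j\|^2\le\sum_{j=1}^m\|\psi_j-P_W\psi_j\|^2\qquad\text{for all } W\in\mathcal{C}_\ell^\Delta .$$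
   Context: Groups are written additively. Let $G$ be a discrete countable LCA group. A measurable action $\sigma:G\times\mathcal{X}\to\mathcal{X}$, $\sigma_g(x)=\sigma(g,x)$, satisfies: each $\sigma_g$ is $\mu$-measurable, $\sigma_g\circ\sigma_{g'}=\sigma_{g+g'}$, and $\sigma_e=\mathrm{id}$. It is quasi-$G$-invariant if there is a measurable function $J_\sigma:G\times\mathcal{X}\to\mathbb{R}^+$ (the Jacobian) with $d\mu(\sigma_g(x))=J_\sigma(g,x)\,d\mu(x)$. It induces the unitary representation $\Pi$ of $G$ on $L^2(\mathcal{X})$, $\Pi_g f(x)=J_\sigma(-g,x)^{1/2}f(\sigma_{-g}(x))$. It has the tiling property if there is a measurable set $C_G\subseteq\mathcal{X}$ with $\mu(\mathcal{X}\setminus\bigcup_{g\in G}\sigma_g(C_G))=0$ and $\mu(\sigma_g(C_G)\cap\sigma_{g'}(C_G))=0$ for $g\ne g'$. For a subgroup $H\subseteq\mathcal{T}$, a closed subspace $V\subseteq L^2(\mathcal{X})$ is $(H,\sigma)$-invariant if $\Pi_h f\in V$ for all $f\in V$, $h\in H$. A $(\Gamma,\sigma)$-invariant space $V$ is finitely generated if $V=\overline{\mathrm{span}}\{\Pi_\gamma\varphi:\gamma\in\Gamma,\varphi\in\mathcal{A}\}$ for some finite set $\mathcal{A}\subseteq L^2(\mathcal{X})$; its length $\ell(V)$ is the minimum number of functions needed to generate it in this way (using $\Gamma$). $\mathcal{C}_\ell$ is the class of all finitely generated $(\Gamma,\sigma)$-invariant spaces $V\subseteq L^2(\mathcal{X})$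 with $\ell(V)\le\ell$, and $\mathcal{C}_\ell^\Delta=\{V\in\mathcal{C}_\ell: V\text{ is also }(\Delta,\sigma)\text{-invariant}\}$. $P_W$ denotes the orthogonal projection of $L^2(\mathcal{X})$ onto $W$. *)

theory Defs
  imports
    "HOL-Analysis.Analysis"
    "HOL-Algebra.Algebra"
    "HOL-Library.Function_Algebras"
begin

section \<open>The Hilbert space of square-integrable functions\<close>

text \<open>
  Elements of \<open>L\<^sup>2(X, \<mu>)\<close> are represented by complex-valued functions rather than by their
  almost-everywhere classes, so \<open>l2_norm\<close> is a seminorm whose kernel consists of the null functions.
  A set equal to its \<open>l2_closure\<close> is saturated under almost-everywhere equality; closed subspaces
  here therefore correspond bijectively to the closed subspaces of the quotient.
\<close>

definition L2 :: "'x measure \<Rightarrow> ('x \<Rightarrow> complex) set" where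
  "L2 M = {f \<in> borel_measurable M. integrable M (\<lambda>x. (cmod (f x))\<^sup>2)}"

definition l2_inner :: "'x measure \<Rightarrow> ('x \<Rightarrow> complex) \<Rightarrow> ('x \<Rightarrow> complex) \<Rightarrow> complex" where
  "l2_inner M f g = (LINT x|M. f x * cnj (g x))"

definition l2_norm :: "'x measure \<Rightarrow> ('x \<Rightarrow> complex) \<Rightarrow> real" where
  "l2_norm M f = sqrt (LINT x|M. (cmod (f x))\<^sup>2)"

definition l2_closure :: "'x measure \<Rightarrow> ('x \<Rightarrow> complex) set \<Rightarrow> ('x \<Rightarrow> complex) set" where
  "l2_closure M S = {f \<in> L2 M. \<forall>e>0. \<exists>g\<in>S. l2_norm M (f - g) < e}"

definition cfun_scale :: "complex \<Rightarrow> ('x \<Rightarrow> complex) \<Rightarrow> 'x \<Rightarrow> complex" where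
  "cfun_scale c f = (\<lambda>x. c * f x)"

global_interpretation cfun: vector_space cfun_scale
  by unfold_locales (auto simp: cfun_scale_def fun_eq_iff algebra_simps)

definition l2_closed_subspace :: "'x measure \<Rightarrow> ('x \<Rightarrow> complex) set \<Rightarrow> bool" where
  "l2_closed_subspace M V \<longleftrightarrow> V \<subseteq> L2 M \<and> cfun.subspace V \<and> l2_closure M V = V"

text \<open>
  Orthogonal projection onto a closed subspace \<open>W\<close>: the element \<open>g\<close> of \<open>W\<close> with \<open>f - g\<close> orthogonal
  to \<open>W\<close>. It is unique up to almost-everywhere equality, so the choice operator only picks a
  representative.
\<close>

definition l2_proj :: "'x measure \<Rightarrow> ('x \<Rightarrow> complex) set \<Rightarrow> ('x \<Rightarrow> complex) \<Rightarrow> 'x \<Rightarrow> complex" where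
  "l2_proj M W f = (SOME g. g \<in> W \<and> (\<forall>h\<in>W. l2_inner M (f - g) h = 0))"


section \<open>Quasi-invariant actions\<close>

text \<open>
  The (additively thought of) abelian groups are HOL-Algebra groups: \<open>\<otimes>\<close> is the group addition,
  \<open>inv g\<close> is \<open>-g\<close>. They are discrete, so their topology carries no data and their measurable
  structure is the full power set. Only values on \<open>space M\<close> matter.
\<close>

definition measurable_action ::
  "('g, 'm) monoid_scheme \<Rightarrow> 'x measure \<Rightarrow> ('g \<Rightarrow> 'x \<Rightarrow> 'x) \<Rightarrow> bool" where
  "measurable_action T M \<sigma> \<longleftrightarrow>
     (\<forall>g\<in>carrier T. \<sigma> g \<in> M \<rightarrow>\<^sub>M M) \<and>
     (\<forall>g\<in>carrier T. \<forall>h\<in>carrier T. \<forall>x\<in>space M. \<sigma> g (\<sigma> h x) = \<sigma> (g \<otimes>\<^bsub>T\<^esub> h) x) \<and>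
     (\<forall>x\<in>space M. \<sigma> \<one>\<^bsub>T\<^esub> x = x)"

text \<open>
  The relation \<open>d\<mu>(\<sigma>\<^sub>g(x)) = J(g, x) d\<mu>(x)\<close> means \<open>\<mu>(\<sigma>\<^sub>g(E)) = \<integral>\<^sub>E J(g, x) d\<mu>(x)\<close> for all
  measurable \<open>E\<close>.
\<close>

definition is_jacobian ::
  "('g, 'm) monoid_scheme \<Rightarrow> 'x measure \<Rightarrow> ('g \<Rightarrow> 'x \<Rightarrow> 'x) \<Rightarrow> ('g \<Rightarrow> 'x \<Rightarrow> real) \<Rightarrow> bool" where
  "is_jacobian T M \<sigma> J \<longleftrightarrow>
     (\<lambda>(g, x). J g x) \<in> borel_measurable (count_space (carrier T) \<Otimes>\<^sub>M M) \<and>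
     (\<forall>g\<in>carrier T. \<forall>x\<in>space M. 0 < J g x) \<and>
     (\<forall>g\<in>carrier T. \<forall>E\<in>sets M. emeasure M (\<sigma> g ` E) = (\<integral>\<^sup>+x\<in>E. ennreal (J g x) \<partial>M))"

definition tiling_property ::
  "('g, 'm) monoid_scheme \<Rightarrow> 'x measure \<Rightarrow> ('g \<Rightarrow> 'x \<Rightarrow> 'x) \<Rightarrow> bool" where
  "tiling_property T M \<sigma> \<longleftrightarrow>
     (\<exists>C\<in>sets M. emeasure M (space M - (\<Union>g\<in>carrier T. \<sigma> g ` C)) = 0 \<and>
        (\<forall>g\<in>carrier T. \<forall>h\<in>carrier T. g \<noteq> h \<longrightarrow> emeasure M (\<sigma> g ` C \<inter> \<sigma> h ` C) = 0))"

definition rep ::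
  "('g, 'm) monoid_scheme \<Rightarrow> ('g \<Rightarrow> 'x \<Rightarrow> 'x) \<Rightarrow> ('g \<Rightarrow> 'x \<Rightarrow> real) \<Rightarrow> 'g \<Rightarrow> ('x \<Rightarrow> complex) \<Rightarrow> 'x \<Rightarrow> complex"
  where
  "rep T \<sigma> J g f = (\<lambda>x. complex_of_real (sqrt (J (inv\<^bsub>T\<^esub> g) x)) * f (\<sigma> (inv\<^bsub>T\<^esub> g) x))"


section \<open>Invariant spaces\<close>

text \<open>In this section \<open>H\<close> is a subgroup of \<open>T\<close>, acting by restriction of \<open>\<sigma>\<close>.\<close>

definition invariant_space ::
  "('g, 'm) monoid_scheme \<Rightarrow> 'x measure \<Rightarrow> ('g \<Rightarrow> 'x \<Rightarrow> 'x) \<Rightarrow> ('g \<Rightarrow> 'x \<Rightarrow> real) \<Rightarrow> 'g set \<Rightarrow>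
    ('x \<Rightarrow> complex) set \<Rightarrow> bool" where
  "invariant_space T M \<sigma> J H V \<longleftrightarrow>
     l2_closed_subspace M V \<and> (\<forall>h\<in>H. \<forall>f\<in>V. rep T \<sigma> J h f \<in> V)"

definition generated_space ::
  "('g, 'm) monoid_scheme \<Rightarrow> 'x measure \<Rightarrow> ('g \<Rightarrow> 'x \<Rightarrow> 'x) \<Rightarrow> ('g \<Rightarrow> 'x \<Rightarrow> real) \<Rightarrow> 'g set \<Rightarrow>
    ('x \<Rightarrow> complex) set \<Rightarrow> ('x \<Rightarrow> complex) set" where
  "generated_space T M \<sigma> J H A = l2_closure M (cfun.span {rep T \<sigma> J h \<phi> | h \<phi>. h \<in> H \<and> \<phi> \<in> A})"

definition finitely_generated ::
  "('g, 'm) monoid_scheme \<Rightarrow> 'x measure \<Rightarrow> ('g \<Rightarrow> 'x \<Rightarrow> 'x) \<Rightarrow> ('g \<Rightarrow> 'x \<Rightarrow> real) \<Rightarrow> 'g set \<Rightarrow>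
    ('x \<Rightarrow> complex) set \<Rightarrow> bool" where
  "finitely_generated T M \<sigma> J H V \<longleftrightarrow>
     (\<exists>A. finite A \<and> A \<subseteq> L2 M \<and> V = generated_space T M \<sigma> J H A)"

text \<open>Meaningful only for finitely generated \<open>V\<close>.\<close>

definition space_length ::
  "('g, 'm) monoid_scheme \<Rightarrow> 'x measure \<Rightarrow> ('g \<Rightarrow> 'x \<Rightarrow> 'x) \<Rightarrow> ('g \<Rightarrow> 'x \<Rightarrow> real) \<Rightarrow> 'g set \<Rightarrow>
    ('x \<Rightarrow> complex) set \<Rightarrow> nat" where
  "space_length T M \<sigma> J H V =
     (LEAST n. \<exists>A. finite A \<and> card A = n \<and> A \<subseteq> L2 M \<and> V = generated_space T M \<sigma> J H A)"

definition class_C ::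
  "('g, 'm) monoid_scheme \<Rightarrow> 'x measure \<Rightarrow> ('g \<Rightarrow> 'x \<Rightarrow> 'x) \<Rightarrow> ('g \<Rightarrow> 'x \<Rightarrow> real) \<Rightarrow> 'g set \<Rightarrow>
    nat \<Rightarrow> ('x \<Rightarrow> complex) set set" where
  "class_C T M \<sigma> J \<Gamma> l =
     {V. invariant_space T M \<sigma> J \<Gamma> V \<and> finitely_generated T M \<sigma> J \<Gamma> V \<and> space_length T M \<sigma> J \<Gamma> V \<le> l}"

definition class_C_extra ::
  "('g, 'm) monoid_scheme \<Rightarrow> 'x measure \<Rightarrow> ('g \<Rightarrow> 'x \<Rightarrow> 'x) \<Rightarrow> ('g \<Rightarrow> 'x \<Rightarrow> real) \<Rightarrow> 'g set \<Rightarrow>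
    'g set \<Rightarrow> nat \<Rightarrow> ('x \<Rightarrow> complex) set set" where
  "class_C_extra T M \<sigma> J \<Gamma> \<Delta> l = {V \<in> class_C T M \<sigma> J \<Gamma> l. invariant_space T M \<sigma> J \<Delta> V}"

end

(*
  Since Gamma-tiles cover X, the Zak transform zak f (w, x) = sum over a in Gamma of
  xi_a(w) (Pi_{-a} f)(x), for x in a Gamma-tile C, is an isometry of L^2(X) into L^2(Omega x C)
  that turns Pi_a into multiplication by xi_a. Here Omega, in the role of the dual group of Gamma
  with its Haar measure, is any probability space carrying unimodular functions xi_a that are
  multiplicative in a, have mean 0 for a other than the identity, and generate the sigma-algebra.
  All spaces are then studied through the bracket [f, g](w) = <zak f (w, .), zak g (w, .)>,
  whose Fourier coefficients are <Pi_a f, g>.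

  Projecting a competitor W to the space S generated by the Pi_d psi_j, d in Delta, keeps its
  length and its invariance and does not increase the error, so one may assume that W lies in S.
  As Delta/Gamma is finite, S is finitely generated over Gamma, and Gram-Schmidt with respect to
  the bracket yields generators e_1, ..., e_N of S with [e_i, e_k] = 0 for distinct i and k and
  [e_i, e_i] in {0, 1}. In these coordinates W becomes, at almost every w, a tuple of at most l
  orthonormal or zero vectors of C^N whose span is invariant under finitely many matrices, and
  the error is a constant minus the integral of the captured energy. The admissible tuples form a
  compact set, so the energy has a maximiser that depends measurably on w, and it defines W*.
*)

theory Submission
  imports Defs "HOL-Probability.Probability"
begin

section \<open>The Hilbert space\<close>

text \<open>The admissible spaces form neither a convex family nor one with an evident compactness,
  so a minimising sequence need not suggest a limit. Finite index repairs this: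
  \<open>\<Delta>\<close> is controlled by a finite set \<open>R\<close> of coset representatives,
  each fibre sits in one fixed C^N, and invariance becomes finitely many equations, polynomial in
  the entries of a frame and their conjugates. Of the dual group only two properties matter:
  orthonormality of the characters, which makes the Zak transform isometric, and the generated
  sigma-algebra, which lets Fourier coefficients determine integrable functions. A random
  homomorphism from \<open>\<Gamma>\<close> to the circle has both and can be built one generator at
  a time. The group law of the representation holds only almost everywhere, and so do the bracket
  identities. Multiplication by a function of w is described by its effect on brackets and comes
  from the Riesz theorem, which avoids describing the range of the Zak transform. Measurability of
  the maximiser is forced by maximising its coordinates lexicographically as well.\<close>

lemma borel_measurable_cnj [measurable (raw)]:
  "f \<in> borel_measurable M \<Longrightarrow> (\<lambda>x. cnj (f x)) \<in> borel_measurable M"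
  by (rule measurable_compose[OF _ borel_measurable_continuous_onI[OF continuous_on_cnj[OF continuous_on_id]]])

lemma L2_D:
  assumes "f \<in> L2 M"
  shows "f \<in> borel_measurable M" "integrable M (\<lambda>x. (cmod (f x))\<^sup>2)"
  using assms by (auto simp: L2_def)

lemma L2_mult_integrable:
  assumes "f \<in> L2 M" "g \<in> L2 M"
  shows "integrable M (\<lambda>x. f x * cnj (g x))"
proof (rule Bochner_Integration.integrable_bound)
  note [measurable] = L2_D(1)[OF assms(1)] L2_D(1)[OF assms(2)]
  show "integrable M (\<lambda>x. (cmod (f x))\<^sup>2 + (cmod (g x))\<^sup>2)"
    by (intro Bochner_Integration.integrable_add L2_D(2) assms)
  show "(\<lambda>x. f x * cnj (g x)) \<in> borel_measurable M" by measurable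
  have "cmod a * cmod b \<le> (cmod a)\<^sup>2 + (cmod b)\<^sup>2" for a b
    using sum_squares_bound[of "cmod a" "cmod b"] mult_nonneg_nonneg[of "cmod a" "cmod b"]
    by (simp del: mult_nonneg_nonneg)
  then show "AE x in M. norm (f x * cnj (g x)) \<le> norm ((cmod (f x))\<^sup>2 + (cmod (g x))\<^sup>2)"
    by (auto simp: norm_mult)
qed

lemma L2_add:
  assumes "f \<in> L2 M" "g \<in> L2 M"
  shows "f + g \<in> L2 M"
proof -
  note [measurable] = L2_D(1)[OF assms(1)] L2_D(1)[OF assms(2)]
  have "integrable M (\<lambda>x. (cmod ((f + g) x))\<^sup>2)"
  proof (rule Bochner_Integration.integrable_bound)
    show "integrable M (\<lambda>x. 2 * (cmod (f x))\<^sup>2 + 2 * (cmod (g x))\<^sup>2)"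
      by (intro Bochner_Integration.integrable_add integrable_mult_right L2_D(2) assms)
    show "(\<lambda>x. (cmod ((f + g) x))\<^sup>2) \<in> borel_measurable M" by (simp add: plus_fun_def)
    have "(cmod (a + b))\<^sup>2 \<le> 2 * (cmod a)\<^sup>2 + 2 * (cmod b)\<^sup>2" for a b
    proof -
      have "(cmod (a + b))\<^sup>2 \<le> (cmod a + cmod b)\<^sup>2"
        by (intro power_mono norm_triangle_ineq) auto
      also have "\<dots> \<le> 2 * (cmod a)\<^sup>2 + 2 * (cmod b)\<^sup>2"
        using sum_squares_bound[of "cmod a" "cmod b"] by (simp add: power2_sum)
      finally show ?thesis .
    qed
    then show "AE x in M. norm ((cmod ((f + g) x))\<^sup>2) \<le> norm (2 * (cmod (f x))\<^sup>2 + 2 * (cmod (g x))\<^sup>2)"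
      by auto
  qed
  then show ?thesis by (simp add: L2_def plus_fun_def)
qed

lemma L2_scale: "f \<in> L2 M \<Longrightarrow> cfun_scale c f \<in> L2 M"
  by (auto simp: L2_def cfun_scale_def norm_mult power_mult_distrib)

lemma L2_uminus: "f \<in> L2 M \<Longrightarrow> - f \<in> L2 M"
  by (auto simp: L2_def fun_Compl_def)

lemma L2_diff: "f \<in> L2 M \<Longrightarrow> g \<in> L2 M \<Longrightarrow> f - g \<in> L2 M"
  using L2_add[of f M "- g"] L2_uminus[of g M] by simp

lemma L2_zero: "0 \<in> L2 M"
  by (auto simp: L2_def zero_fun_def)

lemma L2_sum: "(\<And>i. i \<in> I \<Longrightarrow> f i \<in> L2 M) \<Longrightarrow> (\<Sum>i\<in>I. f i) \<in> L2 M"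
  by (induction I rule: infinite_finite_induct) (auto simp: L2_zero L2_add)

lemma L2_subspace: "cfun.subspace (L2 M)"
  by (auto simp: cfun.subspace_def L2_zero L2_add L2_scale)

lemmas L2_intros = L2_add L2_scale L2_uminus L2_diff L2_zero L2_sum

lemma l2_inner_add_left:
  assumes "f \<in> L2 M" "g \<in> L2 M" "h \<in> L2 M"
  shows "l2_inner M (f + g) h = l2_inner M f h + l2_inner M g h"
  using assms by (simp add: l2_inner_def plus_fun_def algebra_simps L2_mult_integrable)

lemma l2_inner_diff_left:
  assumes "f \<in> L2 M" "g \<in> L2 M" "h \<in> L2 M"
  shows "l2_inner M (f - g) h = l2_inner M f h - l2_inner M g h"
  using assms by (simp add: l2_inner_def fun_diff_def algebra_simps L2_mult_integrable)

lemma l2_inner_scale_left: "l2_inner M (cfun_scale c f) h = c * l2_inner M f h"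
  by (simp add: l2_inner_def cfun_scale_def mult.assoc)

lemma l2_inner_cnj: "cnj (l2_inner M f g) = l2_inner M g f"
  by (simp add: l2_inner_def mult.commute flip: Bochner_Integration.integral_cnj)

lemma l2_inner_add_right:
  assumes "f \<in> L2 M" "g \<in> L2 M" "h \<in> L2 M"
  shows "l2_inner M h (f + g) = l2_inner M h f + l2_inner M h g"
  using l2_inner_add_left[OF assms] by (metis complex_cnj_add l2_inner_cnj)

lemma l2_inner_diff_right:
  assumes "f \<in> L2 M" "g \<in> L2 M" "h \<in> L2 M"
  shows "l2_inner M h (f - g) = l2_inner M h f - l2_inner M h g"
  using l2_inner_diff_left[OF assms] by (metis complex_cnj_diff l2_inner_cnj)

lemma l2_inner_scale_right: "l2_inner M h (cfun_scale c f) = cnj c * l2_inner M h f"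
  using l2_inner_scale_left[of M c f h] by (metis complex_cnj_mult l2_inner_cnj)

lemma l2_inner_zero_left: "l2_inner M 0 h = 0" and l2_inner_zero_right: "l2_inner M h 0 = 0"
  by (simp_all add: l2_inner_def zero_fun_def)

lemma l2_inner_sum_left:
  assumes "\<And>i. i \<in> I \<Longrightarrow> f i \<in> L2 M" "h \<in> L2 M"
  shows "l2_inner M (\<Sum>i\<in>I. f i) h = (\<Sum>i\<in>I. l2_inner M (f i) h)"
  using assms
  by (induction I rule: infinite_finite_induct) (auto simp: l2_inner_zero_left l2_inner_add_left L2_sum)

lemma l2_inner_sum_right:
  assumes "\<And>i. i \<in> I \<Longrightarrow> f i \<in> L2 M" "h \<in> L2 M"
  shows "l2_inner M h (\<Sum>i\<in>I. f i) = (\<Sum>i\<in>I. l2_inner M h (f i))"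
  using assms
  by (induction I rule: infinite_finite_induct) (auto simp: l2_inner_zero_right l2_inner_add_right L2_sum)

lemma l2_norm_nonneg [simp]: "0 \<le> l2_norm M f"
  by (simp add: l2_norm_def)

lemma l2_norm_sq: "(l2_norm M f)\<^sup>2 = (LINT x|M. (cmod (f x))\<^sup>2)"
  by (simp add: l2_norm_def)

lemma l2_inner_self: "l2_inner M f f = of_real ((l2_norm M f)\<^sup>2)"
proof -
  have "f x * cnj (f x) = complex_of_real ((cmod (f x))\<^sup>2)" for x
    using complex_norm_square[of "f x"] by simp
  then have "l2_inner M f f = (LINT x|M. complex_of_real ((cmod (f x))\<^sup>2))"
    unfolding l2_inner_def by presburger
  then show ?thesis by (simp only: l2_norm_sq integral_complex_of_real)
qed

lemma l2_norm_sq_Re: "(l2_norm M f)\<^sup>2 = Re (l2_inner M f f)"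
  by (simp add: l2_inner_self)

lemma l2_inner_cong_AE:
  assumes "AE x in M. f x = f' x" "AE x in M. g x = g' x"
    "f \<in> L2 M" "f' \<in> L2 M" "g \<in> L2 M" "g' \<in> L2 M"
  shows "l2_inner M f g = l2_inner M f' g'"
  unfolding l2_inner_def
proof (rule integral_cong_AE)
  show "(\<lambda>x. f x * cnj (g x)) \<in> borel_measurable M" "(\<lambda>x. f' x * cnj (g' x)) \<in> borel_measurable M"
    using assms by (auto intro!: borel_measurable_integrable L2_mult_integrable)
  show "AE x in M. f x * cnj (g x) = f' x * cnj (g' x)"
    using assms(1,2) by eventually_elim simp
qed

lemma l2_norm_eq_0:
  assumes "f \<in> L2 M"
  shows "l2_norm M f = 0 \<longleftrightarrow> (AE x in M. f x = 0)"
  using integral_nonneg_eq_0_iff_AE[OF L2_D(2)[OF assms]] by (auto simp: l2_norm_def)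

lemma l2_norm_diff_eq_0:
  assumes "f \<in> L2 M" "g \<in> L2 M"
  shows "l2_norm M (f - g) = 0 \<longleftrightarrow> (AE x in M. f x = g x)"
  using l2_norm_eq_0[OF L2_diff[OF assms]] by simp

lemma l2_norm_sq_add:
  assumes "f \<in> L2 M" "g \<in> L2 M"
  shows "(l2_norm M (f + g))\<^sup>2 = (l2_norm M f)\<^sup>2 + 2 * Re (l2_inner M f g) + (l2_norm M g)\<^sup>2"
proof -
  have "Re (l2_inner M g f) = Re (l2_inner M f g)"
    using cnj.simps(1)[of "l2_inner M f g"] by (simp add: l2_inner_cnj)
  with assms show ?thesis
    by (simp add: l2_norm_sq_Re l2_inner_add_left l2_inner_add_right L2_add)
qed

lemma l2_norm_sq_diff:
  assumes "f \<in> L2 M" "g \<in> L2 M"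
  shows "(l2_norm M (f - g))\<^sup>2 = (l2_norm M f)\<^sup>2 - 2 * Re (l2_inner M f g) + (l2_norm M g)\<^sup>2"
proof -
  have "Re (l2_inner M g f) = Re (l2_inner M f g)"
    using cnj.simps(1)[of "l2_inner M f g"] by (simp add: l2_inner_cnj)
  with assms show ?thesis
    by (simp add: l2_norm_sq_Re l2_inner_diff_left l2_inner_diff_right L2_diff)
qed

lemma l2_norm_scale: "l2_norm M (cfun_scale c f) = cmod c * l2_norm M f"
  by (simp add: l2_norm_def cfun_scale_def norm_mult power_mult_distrib real_sqrt_mult)

lemma l2_norm_minus: "l2_norm M (- f) = l2_norm M f"
  by (simp add: l2_norm_def)

lemma l2_norm_minus_commute: "l2_norm M (f - g) = l2_norm M (g - f)"
  by (metis l2_norm_minus minus_diff_eq)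

text \<open>The integral of \<open>(t * cmod (f x) - cmod (g x))^2\<close> is a quadratic in
  \<open>t\<close> that is never negative; testing it at one well chosen \<open>t\<close> gives the
  bound.\<close>

lemma l2_cauchy_schwarz:
  assumes "f \<in> L2 M" "g \<in> L2 M"
  shows "cmod (l2_inner M f g) \<le> l2_norm M f * l2_norm M g"
proof -
  note [measurable] = L2_D(1)[OF assms(1)] L2_D(1)[OF assms(2)]
  have "cmod (l2_inner M f g) \<le> (LINT x|M. cmod (f x) * cmod (g x))"
    unfolding l2_inner_def by (rule order.trans[OF integral_norm_bound]) (simp add: norm_mult)
  also have "\<dots> \<le> l2_norm M f * l2_norm M g"
  proof -
    let ?c = "LINT x|M. cmod (f x) * cmod (g x)"
    have int: "integrable M (\<lambda>x. cmod (f x) * cmod (g x))"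
      using integrable_norm[OF L2_mult_integrable[OF assms]] by (simp add: norm_mult)
    have quad: "0 \<le> (l2_norm M f)\<^sup>2 * t\<^sup>2 - 2 * t * ?c + (l2_norm M g)\<^sup>2" for t
    proof -
      have "0 \<le> (LINT x|M. (t * cmod (f x) - cmod (g x))\<^sup>2)" by simp
      also have "\<dots> = (LINT x|M. t\<^sup>2 * (cmod (f x))\<^sup>2 - 2 * t * (cmod (f x) * cmod (g x)) + (cmod (g x))\<^sup>2)"
        by (simp add: power2_diff power_mult_distrib algebra_simps)
      also have "\<dots> = t\<^sup>2 * (l2_norm M f)\<^sup>2 - 2 * t * ?c + (l2_norm M g)\<^sup>2"
        unfolding l2_norm_sq using int assms[THEN L2_D(2)] by simp
      finally show ?thesis by (simp add: mult.commute)
    qed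
    have c0: "0 \<le> ?c" by simp
    have "?c\<^sup>2 \<le> (l2_norm M f)\<^sup>2 * (l2_norm M g)\<^sup>2"
    proof (cases "l2_norm M f = 0")
      case True
      have "?c = 0"
      proof (rule ccontr)
        assume "?c \<noteq> 0"
        \<comment> \<open>With leading coefficient 0 the quadratic is affine in \<open>t\<close>; at
          this \<open>t\<close> its value is \<open>- (l2_norm M g)^2 - 2\<close>, a
          contradiction.\<close>
        then show False
          using quad[of "((l2_norm M g)\<^sup>2 + 1) / ?c"] True zero_le_power2[of "l2_norm M g"]
          by (simp del: zero_le_power2)
      qed
      then show ?thesis by simp
    next
      case False
      define a where "a = (l2_norm M f)\<^sup>2"
      have a: "0 < a" using False by (simp add: a_def)
      \<comment> \<open>The quadratic is smallest at \<open>t = ?c / a\<close>.\<close>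
      have "0 \<le> a * (?c / a)\<^sup>2 - 2 * (?c / a) * ?c + (l2_norm M g)\<^sup>2"
        using quad[of "?c / a"] by (simp add: a_def)
      also have "\<dots> = ((l2_norm M g)\<^sup>2 * a - ?c\<^sup>2) / a" using a by (simp add: power2_eq_square field_simps)
      finally show ?thesis using a by (simp add: zero_le_divide_iff a_def mult.commute)
    qed
    then show ?thesis
      by (metis l2_norm_nonneg mult_nonneg_nonneg power2_le_imp_le power_mult_distrib)
  qed
  finally show ?thesis .
qed

lemma l2_norm_triangle:
  assumes "f \<in> L2 M" "g \<in> L2 M"
  shows "l2_norm M (f + g) \<le> l2_norm M f + l2_norm M g"
proof (rule power2_le_imp_le)
  have "Re (l2_inner M f g) \<le> l2_norm M f * l2_norm M g"
    using l2_cauchy_schwarz[OF assms] complex_Re_le_cmod order.trans by blast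
  then show "(l2_norm M (f + g))\<^sup>2 \<le> (l2_norm M f + l2_norm M g)\<^sup>2"
    by (simp add: l2_norm_sq_add[OF assms] power2_sum)
qed simp

lemma l2_norm_triangle_diff:
  assumes "f \<in> L2 M" "g \<in> L2 M" "h \<in> L2 M"
  shows "l2_norm M (f - h) \<le> l2_norm M (f - g) + l2_norm M (g - h)"
  using l2_norm_triangle[OF L2_diff[OF assms(1,2)] L2_diff[OF assms(2,3)]] by simp

text \<open>Multiplying by a strictly positive square-integrable weight turns an \<open>L\<^sup>2\<close>-Cauchy sequence
  into an \<open>L\<^sup>1\<close>-Cauchy one, which yields an almost everywhere convergent subsequence.\<close>

lemma l2_complete:
  assumes "sigma_finite_measure M" and f: "\<And>n. f n \<in> L2 M"
    and cau: "\<And>e. 0 < e \<Longrightarrow> \<exists>N. \<forall>i\<ge>N. \<forall>j\<ge>N. l2_norm M (f i - f j) < e"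
  obtains h where "h \<in> L2 M" "(\<lambda>n. l2_norm M (f n - h)) \<longlonglongrightarrow> 0"
proof -
  interpret sigma_finite_measure M by fact
  note [measurable] = L2_D(1)[OF f]
  obtain w0 where w0 [measurable]: "w0 \<in> borel_measurable M"
    and w0i: "integral\<^sup>N M w0 \<noteq> \<infinity>" and w0p: "\<forall>x\<in>space M. 0 < w0 x \<and> w0 x < \<infinity>"
    using Ex_finite_integrable_function by blast
  \<comment> \<open>Sigma-finiteness provides the finite, strictly positive, integrable
    \<open>w0\<close>; its square root is therefore square-integrable.\<close>
  define w where "w x = complex_of_real (sqrt (enn2real (w0 x)))" for x
  have w [measurable]: "w \<in> borel_measurable M" unfolding w_def by measurable
  have wp: "w x \<noteq> 0" if "x \<in> space M" for x
    using w0p that by (auto simp: w_def enn2real_eq_0_iff)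
  have wL: "w \<in> L2 M"
  proof -
    have "integrable M (\<lambda>x. enn2real (w0 x))"
    proof (rule integrableI_nonneg)
      have "(\<integral>\<^sup>+x. ennreal (enn2real (w0 x)) \<partial>M) = integral\<^sup>N M w0"
        by (intro nn_integral_cong) (use w0p in \<open>auto simp: less_top\<close>)
      then show "(\<integral>\<^sup>+x. ennreal (enn2real (w0 x)) \<partial>M) < \<infinity>" using w0i by (simp add: less_top)
    qed auto
    then show ?thesis by (simp add: L2_def w_def)
  qed
  let ?s = "\<lambda>n x. f n x * cnj (w x)"
  have "\<exists>N. \<forall>i\<ge>N. \<forall>j\<ge>N. LINT x|M. norm (?s i x - ?s j x) < e" if e: "0 < e" for e
  proof -
    have "0 < e / (l2_norm M w + 1)" using e l2_norm_nonneg[of M w] by (simp add: add_nonneg_pos)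
    then obtain N where N: "\<forall>i\<ge>N. \<forall>j\<ge>N. l2_norm M (f i - f j) < e / (l2_norm M w + 1)"
      using cau by blast
    have "(LINT x|M. norm (?s i x - ?s j x)) < e" if "i \<ge> N" "j \<ge> N" for i j
    proof -
      let ?d = "\<lambda>x. complex_of_real (cmod ((f i - f j) x))" and ?v = "\<lambda>x. complex_of_real (cmod (w x))"
      have d: "?d \<in> L2 M" "?v \<in> L2 M"
        using L2_diff[OF f f, of i j] wL by (auto simp: L2_def)
      have "(LINT x|M. norm (?s i x - ?s j x)) = (LINT x|M. cmod ((f i - f j) x) * cmod (w x))"
        by (intro Bochner_Integration.integral_cong refl)
          (simp add: norm_mult flip: left_diff_distrib)
      also have "\<dots> = Re (l2_inner M ?d ?v)"
        by (simp add: l2_inner_def flip: of_real_mult)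
      also have "\<dots> \<le> l2_norm M ?d * l2_norm M ?v"
        using l2_cauchy_schwarz[OF d] complex_Re_le_cmod order.trans by blast
      also have "\<dots> = l2_norm M (f i - f j) * l2_norm M w" by (simp add: l2_norm_def)
      also have "\<dots> \<le> l2_norm M (f i - f j) * (l2_norm M w + 1)"
        by (intro mult_left_mono) auto
      also have "\<dots> < e" using N that l2_norm_nonneg[of M w]
        by (metis add_nonneg_pos pos_less_divide_eq zero_less_one)
      finally show ?thesis .
    qed
    then show ?thesis by blast
  qed
  then obtain r where r: "strict_mono r" and rc: "AE x in M. Cauchy (\<lambda>i. ?s (r i) x)"
    using cauchy_L1_AE_cauchy_subseq[of M ?s] L2_mult_integrable[OF f wL] by blast
  define h where "h x = lim (\<lambda>i. f (r i) x)" for x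
  have h [measurable]: "h \<in> borel_measurable M" unfolding h_def by measurable
  have hl: "AE x in M. (\<lambda>i. f (r i) x) \<longlonglongrightarrow> h x"
    using rc AE_space
  proof eventually_elim
    case (elim x)
    then obtain y where "(\<lambda>i. ?s (r i) x) \<longlonglongrightarrow> y"
      using Cauchy_convergent_iff convergent_def by blast
    then have "(\<lambda>i. ?s (r i) x / cnj (w x)) \<longlonglongrightarrow> y / cnj (w x)"
      using wp[OF elim(2)] by (intro tendsto_intros) auto
    then have "(\<lambda>i. f (r i) x) \<longlonglongrightarrow> y / cnj (w x)"
      using wp[OF elim(2)] by simp
    then show ?case by (simp add: h_def limI)
  qed
  \<comment> \<open>Fatou along the subsequence turns the Cauchy estimate into a bound for
    \<open>f n - h\<close>; nonnegative integrals allow this before \<open>h\<close> is known to lie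
    in \<open>L2 M\<close>.\<close>
  have key: "\<exists>N. \<forall>n\<ge>N. (\<integral>\<^sup>+x. ennreal ((cmod (f n x - h x))\<^sup>2) \<partial>M) \<le> ennreal (e\<^sup>2)" if "0 < e" for e
  proof -
    obtain N where N: "\<forall>i\<ge>N. \<forall>j\<ge>N. l2_norm M (f i - f j) < e" using cau \<open>0 < e\<close> by blast
    have "(\<integral>\<^sup>+x. ennreal ((cmod (f n x - h x))\<^sup>2) \<partial>M) \<le> ennreal (e\<^sup>2)" if n: "n \<ge> N" for n
    proof -
      have "(\<integral>\<^sup>+x. ennreal ((cmod (f n x - h x))\<^sup>2) \<partial>M)
          \<le> (\<integral>\<^sup>+x. liminf (\<lambda>k. ennreal ((cmod (f n x - f (r k) x))\<^sup>2)) \<partial>M)"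
      proof (rule nn_integral_mono_AE, use hl in eventually_elim)
        case (elim x)
        have "(\<lambda>k. ennreal ((cmod (f n x - f (r k) x))\<^sup>2)) \<longlonglongrightarrow> ennreal ((cmod (f n x - h x))\<^sup>2)"
          by (intro tendsto_intros elim)
        from lim_imp_Liminf[OF _ this] show ?case by simp
      qed
      also have "\<dots> \<le> liminf (\<lambda>k. \<integral>\<^sup>+x. ennreal ((cmod (f n x - f (r k) x))\<^sup>2) \<partial>M)"
        by (rule nn_integral_liminf) measurable
      also have "\<dots> \<le> liminf (\<lambda>k. ennreal (e\<^sup>2))"
      proof (rule Liminf_mono, rule eventually_sequentiallyI)
        fix k assume "N \<le> k"
        then have rk: "N \<le> r k" using seq_suble[OF r, of k] by linarith
        have "(\<integral>\<^sup>+x. ennreal ((cmod (f n x - f (r k) x))\<^sup>2) \<partial>M) = ennreal ((l2_norm M (f n - f (r k)))\<^sup>2)"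
          unfolding l2_norm_sq using L2_D(2)[OF L2_diff[OF f f]] by (simp add: nn_integral_eq_integral)
        also have "\<dots> \<le> ennreal (e\<^sup>2)"
          using N n rk by (intro ennreal_leI power_mono) (auto intro: less_imp_le)
        finally show "(\<integral>\<^sup>+x. ennreal ((cmod (f n x - f (r k) x))\<^sup>2) \<partial>M) \<le> ennreal (e\<^sup>2)" .
      qed
      also have "\<dots> = ennreal (e\<^sup>2)" by (rule Liminf_const) simp
      finally show ?thesis .
    qed
    then show ?thesis by blast
  qed
  have diffL: "f n - h \<in> L2 M" if "(\<integral>\<^sup>+x. ennreal ((cmod (f n x - h x))\<^sup>2) \<partial>M) \<le> ennreal (e\<^sup>2)" for n e
    using that by (auto simp: L2_def fun_diff_def intro!: integrableI_nonneg order.strict_trans1[OF that])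
  obtain n0 where "f n0 - h \<in> L2 M" using key[of 1] diffL by (meson order.refl zero_less_one)
  then have hL: "h \<in> L2 M" using L2_diff[OF f] by (metis diff_diff_eq2 add_diff_cancel_left')
  moreover have "(\<lambda>n. l2_norm M (f n - h)) \<longlonglongrightarrow> 0"
  proof (rule LIMSEQ_I)
    fix e :: real assume e: "0 < e"
    obtain N where N: "\<forall>n\<ge>N. (\<integral>\<^sup>+x. ennreal ((cmod (f n x - h x))\<^sup>2) \<partial>M) \<le> ennreal ((e/2)\<^sup>2)"
      using key[of "e/2"] e by auto
    have "l2_norm M (f n - h) \<le> e / 2" if "n \<ge> N" for n
    proof (rule power2_le_imp_le)
      have "ennreal ((l2_norm M (f n - h))\<^sup>2) = (\<integral>\<^sup>+x. ennreal ((cmod (f n x - h x))\<^sup>2) \<partial>M)"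
        unfolding l2_norm_sq using L2_D(2)[OF L2_diff[OF f hL]] by (simp add: nn_integral_eq_integral)
      also have "\<dots> \<le> ennreal ((e/2)\<^sup>2)" using N that by blast
      finally show "(l2_norm M (f n - h))\<^sup>2 \<le> (e/2)\<^sup>2" by (simp add: ennreal_le_iff)
    qed (use e in simp)
    then show "\<exists>N. \<forall>n\<ge>N. norm (l2_norm M (f n - h) - 0) < e"
      using e by (intro exI[of _ N]) force
  qed
  ultimately show ?thesis by (rule that)
qed


section \<open>Closed subspaces, orthogonal projection and the Riesz representation theorem\<close>

lemma l2_closure_subset: "S \<subseteq> L2 M \<Longrightarrow> S \<subseteq> l2_closure M S"
  by (force simp: l2_closure_def l2_norm_def)

lemma l2_closure_mono: "S \<subseteq> S' \<Longrightarrow> l2_closure M S \<subseteq> l2_closure M S'"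
  unfolding l2_closure_def by blast

lemma l2_closure_approx:
  assumes "f \<in> l2_closure M S" "0 < e"
  obtains g where "g \<in> S" "l2_norm M (f - g) < e"
  using assms unfolding l2_closure_def by blast

lemma l2_closed_subspaceD:
  assumes "l2_closed_subspace M V"
  shows "V \<subseteq> L2 M" "cfun.subspace V" "l2_closure M V = V"
  using assms by (auto simp: l2_closed_subspace_def)

lemma cfun_subspace_ops:
  assumes "cfun.subspace V"
  shows "0 \<in> V" "f \<in> V \<Longrightarrow> g \<in> V \<Longrightarrow> f + g \<in> V" "f \<in> V \<Longrightarrow> g \<in> V \<Longrightarrow> f - g \<in> V"
    "f \<in> V \<Longrightarrow> cfun_scale c f \<in> V" "(\<And>i. i \<in> I \<Longrightarrow> h i \<in> V) \<Longrightarrow> (\<Sum>i\<in>I. h i) \<in> V"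
  using assms
  by (auto simp: cfun.subspace_0 cfun.subspace_add cfun.subspace_diff cfun.subspace_scale cfun.subspace_sum)

lemma l2_closed_subspaceI:
  assumes "V \<subseteq> L2 M" "cfun.subspace V"
    and "\<And>f. f \<in> L2 M \<Longrightarrow> (\<And>e. 0 < e \<Longrightarrow> \<exists>g\<in>V. l2_norm M (f - g) < e) \<Longrightarrow> f \<in> V"
  shows "l2_closed_subspace M V"
  using assms l2_closure_subset[of V M] by (auto simp: l2_closed_subspace_def l2_closure_def)

lemma l2_closed_subspace_approx:
  assumes "l2_closed_subspace M V" "f \<in> L2 M" "\<And>e. 0 < e \<Longrightarrow> \<exists>g\<in>V. l2_norm M (f - g) < e"
  shows "f \<in> V"
  using assms l2_closed_subspaceD(3)[OF assms(1)] by (auto simp: l2_closure_def)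

lemma l2_closed_subspace_closure:
  assumes S: "S \<subseteq> L2 M" "cfun.subspace S"
  shows "l2_closed_subspace M (l2_closure M S)"
proof (rule l2_closed_subspaceI)
  show sub: "l2_closure M S \<subseteq> L2 M" by (auto simp: l2_closure_def)
  show "cfun.subspace (l2_closure M S)"
    unfolding cfun.subspace_def
  proof (intro conjI ballI allI)
    show "0 \<in> l2_closure M S"
      using l2_closure_subset[OF S(1)] cfun_subspace_ops(1)[OF S(2)] by blast
  next
    fix f g assume fg: "f \<in> l2_closure M S" "g \<in> l2_closure M S"
    then have L: "f \<in> L2 M" "g \<in> L2 M" by (auto simp: l2_closure_def)
    have "\<exists>k\<in>S. l2_norm M (f + g - k) < e" if "0 < e" for e
    proof -
      obtain f' where f': "f' \<in> S" "l2_norm M (f - f') < e / 2"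
        by (rule l2_closure_approx[OF fg(1) half_gt_zero[OF \<open>0 < e\<close>]])
      obtain g' where g': "g' \<in> S" "l2_norm M (g - g') < e / 2"
        by (rule l2_closure_approx[OF fg(2) half_gt_zero[OF \<open>0 < e\<close>]])
      have "l2_norm M ((f - f') + (g - g')) \<le> l2_norm M (f - f') + l2_norm M (g - g')"
        using f' g' S L by (intro l2_norm_triangle L2_diff) auto
      then have "l2_norm M (f + g - (f' + g')) < e"
        using f' g' by (simp add: algebra_simps)
      then show ?thesis using cfun_subspace_ops(2)[OF S(2) f'(1) g'(1)] by blast
    qed
    with L show "f + g \<in> l2_closure M S" by (simp add: l2_closure_def L2_add)
  next
    fix c f assume f: "f \<in> l2_closure M S"
    then have L: "f \<in> L2 M" by (auto simp: l2_closure_def)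
    have "\<exists>k\<in>S. l2_norm M (cfun_scale c f - k) < e" if "0 < e" for e
    proof -
      have "0 < e / (cmod c + 1)" using that by (simp add: add_nonneg_pos)
      then obtain f' where f': "f' \<in> S" "l2_norm M (f - f') < e / (cmod c + 1)"
        using f by (auto simp: l2_closure_def)
      have "l2_norm M (cfun_scale c f - cfun_scale c f') = cmod c * l2_norm M (f - f')"
        by (simp add: l2_norm_scale flip: cfun.scale_right_diff_distrib)
      also have "\<dots> \<le> (cmod c + 1) * l2_norm M (f - f')" by (intro mult_right_mono) auto
      also have "\<dots> < e" using f'(2)
        by (simp add: add_nonneg_pos pos_less_divide_eq mult.commute)
      finally show ?thesis using cfun_subspace_ops(4)[OF S(2) f'(1)] by blast
    qed
    with L show "cfun_scale c f \<in> l2_closure M S" by (simp add: l2_closure_def L2_scale)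
  qed
next
  fix f assume f: "f \<in> L2 M" "\<And>e. 0 < e \<Longrightarrow> \<exists>g\<in>l2_closure M S. l2_norm M (f - g) < e"
  have "\<exists>k\<in>S. l2_norm M (f - k) < e" if "0 < e" for e
  proof -
    obtain g where g: "g \<in> l2_closure M S" "l2_norm M (f - g) < e / 2"
      using f(2)[OF half_gt_zero[OF \<open>0 < e\<close>]] by blast
    obtain k where k: "k \<in> S" "l2_norm M (g - k) < e / 2"
      by (rule l2_closure_approx[OF g(1) half_gt_zero[OF \<open>0 < e\<close>]])
    have "l2_norm M (f - k) \<le> l2_norm M (f - g) + l2_norm M (g - k)"
      using f g k S by (intro l2_norm_triangle_diff) (auto simp: l2_closure_def)
    then show ?thesis using g k by force
  qed
  with f(1) show "f \<in> l2_closure M S" by (auto simp: l2_closure_def)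
qed

lemma l2_closed_subspace_span_closure:
  assumes "A \<subseteq> L2 M"
  shows "l2_closed_subspace M (l2_closure M (cfun.span A))" "A \<subseteq> l2_closure M (cfun.span A)"
proof -
  have "cfun.span A \<subseteq> L2 M" by (rule cfun.span_minimal[OF assms L2_subspace])
  then show "l2_closed_subspace M (l2_closure M (cfun.span A))" "A \<subseteq> l2_closure M (cfun.span A)"
    using l2_closed_subspace_closure[OF _ cfun.subspace_span] l2_closure_subset[of "cfun.span A" M]
      cfun.span_superset[of A] by auto
qed

lemma l2_closure_span_minimal:
  assumes "A \<subseteq> V" "l2_closed_subspace M V"
  shows "l2_closure M (cfun.span A) \<subseteq> V"
proof -
  have "cfun.span A \<subseteq> V" using assms cfun.span_minimal l2_closed_subspaceD(2) by blast
  then show ?thesis using l2_closed_subspaceD(3)[OF assms(2)] l2_closure_mono by metis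
qed

text \<open>A function at distance 0 from \<open>V\<close> is in its closure. This is how identities
  that hold only almost everywhere yield membership throughout the proof.\<close>

lemma l2_closed_subspace_AE:
  assumes "l2_closed_subspace M V" "f \<in> V" "g \<in> L2 M" "AE x in M. g x = f x"
  shows "g \<in> V"
proof (rule l2_closed_subspace_approx[OF assms(1,3)])
  have "l2_norm M (g - f) = 0"
    using assms l2_closed_subspaceD(1)[OF assms(1)] by (subst l2_norm_diff_eq_0) auto
  then show "\<exists>k\<in>V. l2_norm M (g - k) < e" if "0 < e" for e
    using assms(2) \<open>0 < e\<close> by (intro bexI[of _ f]) simp_all
qed

text \<open>By Cauchy-Schwarz the inner product with \<open>q\<close> is continuous, so its kernel
  is closed.\<close>

lemma l2_closed_subspace_ortho:
  assumes "q \<in> L2 M"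
  shows "l2_closed_subspace M {h \<in> L2 M. l2_inner M q h = 0}"
proof (rule l2_closed_subspaceI)
  show "cfun.subspace {h \<in> L2 M. l2_inner M q h = 0}"
    using assms by (auto simp: cfun.subspace_def L2_intros l2_inner_add_right l2_inner_scale_right l2_inner_zero_right)
  fix f assume f: "f \<in> L2 M" "\<And>e. 0 < e \<Longrightarrow> \<exists>g\<in>{h \<in> L2 M. l2_inner M q h = 0}. l2_norm M (f - g) < e"
  have "cmod (l2_inner M q f) \<le> e" if "0 < e" for e
  proof -
    have "0 < e / (l2_norm M q + 1)" using that l2_norm_nonneg[of M q] by (simp add: add_nonneg_pos)
    then obtain g where g: "g \<in> L2 M" "l2_inner M q g = 0" "l2_norm M (f - g) < e / (l2_norm M q + 1)"
      using f(2) by blast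
    have "cmod (l2_inner M q f) = cmod (l2_inner M q (f - g))"
      using g f assms by (simp add: l2_inner_diff_right)
    also have "\<dots> \<le> l2_norm M q * l2_norm M (f - g)" using f g assms by (intro l2_cauchy_schwarz L2_diff)
    also have "\<dots> \<le> (l2_norm M q + 1) * l2_norm M (f - g)" by (intro mult_right_mono) auto
    also have "\<dots> \<le> e" using g(3) l2_norm_nonneg[of M q]
      by (simp add: add_nonneg_pos pos_less_divide_eq mult.commute less_imp_le)
    finally show ?thesis .
  qed
  then have "l2_inner M q f = 0" by (metis field_le_epsilon add_0 norm_le_zero_iff)
  with f show "f \<in> {h \<in> L2 M. l2_inner M q h = 0}" by simp
qed auto

text \<open>A sequence in \<open>V\<close> minimising the distance to \<open>f\<close> is Cauchy by
  the parallelogram law; at the limit, varying in the direction \<open>h\<close> gives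
  orthogonality.\<close>

lemma l2_projection_exists:
  assumes M: "sigma_finite_measure M" and V: "l2_closed_subspace M V" and f: "f \<in> L2 M"
  shows "\<exists>g\<in>V. \<forall>h\<in>V. l2_inner M (f - g) h = 0"
proof -
  note VL = l2_closed_subspaceD(1)[OF V] and ops = cfun_subspace_ops[OF l2_closed_subspaceD(2)[OF V]]
  define D where "D = (\<lambda>g. (l2_norm M (f - g))\<^sup>2) ` V"
  define d where "d = Inf D"
  have ne: "D \<noteq> {}" using ops(1) by (auto simp: D_def)
  have bdd: "bdd_below D" by (auto simp: D_def intro!: bdd_belowI[of _ 0])
  have d0: "0 \<le> d" unfolding d_def by (rule cInf_greatest[OF ne]) (auto simp: D_def)
  have dle: "d \<le> (l2_norm M (f - g))\<^sup>2" if "g \<in> V" for g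
    unfolding d_def using bdd that by (intro cInf_lower) (auto simp: D_def)
  have "\<exists>g\<in>V. (l2_norm M (f - g))\<^sup>2 < d + inverse (real (Suc n))" for n
  proof -
    have "Inf D < d + inverse (real (Suc n))" by (simp add: d_def)
    then show ?thesis using ne bdd by (auto simp: cInf_less_iff D_def)
  qed
  then obtain g where g: "\<And>n. g n \<in> V" "\<And>n. (l2_norm M (f - g n))\<^sup>2 < d + inverse (real (Suc n))"
    by metis
  have gL: "g n \<in> L2 M" for n using g(1) VL by blast
  have par: "(l2_norm M (g i - g j))\<^sup>2 \<le> 2 * inverse (real (Suc i)) + 2 * inverse (real (Suc j))" for i j
  proof -
    let ?a = "f - g i" and ?b = "f - g j"
    have L: "?a \<in> L2 M" "?b \<in> L2 M" using f gL by (auto intro: L2_diff)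
    \<comment> \<open>The midpoint of \<open>g i\<close> and \<open>g j\<close> lies in
      \<open>V\<close>, hence its squared distance to \<open>f\<close> is at least
      \<open>d\<close>.\<close>
    have "?a + ?b = cfun_scale 2 (f - cfun_scale (1/2) (g i + g j))"
      by (auto simp: cfun_scale_def fun_eq_iff algebra_simps)
    then have "(l2_norm M (?a + ?b))\<^sup>2 = 4 * (l2_norm M (f - cfun_scale (1/2) (g i + g j)))\<^sup>2"
      by (simp add: l2_norm_scale power_mult_distrib)
    also have "\<dots> \<ge> 4 * d" using dle[OF ops(4)[OF ops(2)[OF g(1) g(1)]]] by simp
    finally have "4 * d \<le> (l2_norm M (?a + ?b))\<^sup>2" .
    moreover have "(l2_norm M (?a + ?b))\<^sup>2 + (l2_norm M (?a - ?b))\<^sup>2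
        = 2 * (l2_norm M ?a)\<^sup>2 + 2 * (l2_norm M ?b)\<^sup>2"
      using l2_norm_sq_add[OF L] l2_norm_sq_diff[OF L] by simp
    moreover have "l2_norm M (?a - ?b) = l2_norm M (g i - g j)"
      using l2_norm_minus_commute[of M "g i" "g j"] by simp
    ultimately show ?thesis using g(2)[of i] g(2)[of j] by simp
  qed
  have "\<exists>N. \<forall>i\<ge>N. \<forall>j\<ge>N. l2_norm M (g i - g j) < e" if "0 < e" for e
  proof -
    obtain N where N: "inverse (real (Suc N)) < e\<^sup>2 / 4"
      using reals_Archimedean[of "e\<^sup>2 / 4"] \<open>0 < e\<close> by auto
    have "l2_norm M (g i - g j) < e" if "i \<ge> N" "j \<ge> N" for i j
    proof (rule power2_less_imp_less)
      have "inverse (real (Suc i)) \<le> inverse (real (Suc N))" "inverse (real (Suc j)) \<le> inverse (real (Suc N))"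
        using that by (auto intro!: le_imp_inverse_le)
      then show "(l2_norm M (g i - g j))\<^sup>2 < e\<^sup>2" using par[of i j] N by linarith
    qed (use \<open>0 < e\<close> in simp)
    then show ?thesis by blast
  qed
  then obtain p where p: "p \<in> L2 M" "(\<lambda>n. l2_norm M (g n - p)) \<longlonglongrightarrow> 0"
    by (rule l2_complete[OF M gL])
  have pV: "p \<in> V"
  proof (rule l2_closed_subspace_approx[OF V p(1)])
    fix e :: real assume "0 < e"
    then obtain n where "l2_norm M (g n - p) < e"
      using order_tendstoD(2)[OF p(2)] eventually_happens[of _ sequentially] trivial_limit_sequentially \<open>0 < e\<close> by blast
    then show "\<exists>g\<in>V. l2_norm M (p - g) < e" using g(1) l2_norm_minus_commute by metis
  qed
  have "(l2_norm M (f - p))\<^sup>2 \<le> d"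
  proof (rule LIMSEQ_le_const)
    have "(\<lambda>n. sqrt (d + inverse (real (Suc n))) + l2_norm M (g n - p)) \<longlonglongrightarrow> sqrt (d + 0) + 0"
      by (intro tendsto_intros LIMSEQ_inverse_real_of_nat p(2))
    then show "(\<lambda>n. (sqrt (d + inverse (real (Suc n))) + l2_norm M (g n - p))\<^sup>2) \<longlonglongrightarrow> d"
      using tendsto_power[of _ "sqrt d" sequentially 2] d0 by simp
    have "(l2_norm M (f - p))\<^sup>2 \<le> (sqrt (d + inverse (real (Suc n))) + l2_norm M (g n - p))\<^sup>2" for n
    proof (rule power_mono)
      have "l2_norm M (f - g n) \<le> sqrt (d + inverse (real (Suc n)))"
        using g(2)[of n] by (intro real_le_rsqrt) simp
      then show "l2_norm M (f - p) \<le> sqrt (d + inverse (real (Suc n))) + l2_norm M (g n - p)"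
        using l2_norm_triangle_diff[OF f gL[of n] p(1)] by linarith
    qed simp
    then show "\<exists>N. \<forall>n\<ge>N. (l2_norm M (f - p))\<^sup>2 \<le> (sqrt (d + inverse (real (Suc n))) + l2_norm M (g n - p))\<^sup>2"
      by blast
  qed
  then have min: "(l2_norm M (f - p))\<^sup>2 \<le> (l2_norm M (f - k))\<^sup>2" if "k \<in> V" for k
    using dle[OF that] by linarith
  have "l2_inner M (f - p) h = 0" if h: "h \<in> V" for h
  proof (cases "l2_norm M h = 0")
    case True
    then show ?thesis
      using l2_cauchy_schwarz[OF L2_diff[OF f p(1)], of h] h VL by auto
  next
    case False
    \<comment> \<open>\<open>c\<close> is the coefficient of the projection of \<open>f - p\<close>
      onto \<open>h\<close>; moving \<open>p\<close> by this multiple would lower the squared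
      distance by exactly \<open>(cmod c)^2 * (l2_norm M h)^2\<close>.\<close>
    define c where "c = l2_inner M (f - p) h / of_real ((l2_norm M h)\<^sup>2)"
    have hL: "h \<in> L2 M" using h VL by blast
    have "(l2_norm M (f - p))\<^sup>2 \<le> (l2_norm M (f - p - cfun_scale c h))\<^sup>2"
      using min[OF ops(2)[OF pV ops(4)[OF h]], of c] by (simp add: diff_diff_eq)
    also have "\<dots> = (l2_norm M (f - p))\<^sup>2 - 2 * Re (cnj c * l2_inner M (f - p) h) + (cmod c)\<^sup>2 * (l2_norm M h)\<^sup>2"
      using f p(1) hL
      by (simp add: l2_norm_sq_diff L2_intros l2_inner_scale_right l2_norm_scale power_mult_distrib)
    also have "Re (cnj c * l2_inner M (f - p) h) = (cmod c)\<^sup>2 * (l2_norm M h)\<^sup>2"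
    proof -
      have "l2_inner M (f - p) h = c * of_real ((l2_norm M h)\<^sup>2)" using False by (simp add: c_def)
      then have "cnj c * l2_inner M (f - p) h = of_real ((cmod c)\<^sup>2 * (l2_norm M h)\<^sup>2)"
        using complex_norm_square[of c] by (simp add: mult_ac)
      then show ?thesis by simp
    qed
    finally have "(cmod c)\<^sup>2 * (l2_norm M h)\<^sup>2 \<le> 0" by simp
    then have "c = 0" using False
      by (metis mult_eq_0_iff norm_eq_zero order_antisym power_eq_0_iff zero_le_mult_iff zero_le_power2)
    then show ?thesis using False by (simp add: c_def)
  qed
  with pV show ?thesis by blast
qed

lemma l2_proj:
  assumes "sigma_finite_measure M" "l2_closed_subspace M V" "f \<in> L2 M"
  shows "l2_proj M V f \<in> V" "h \<in> V \<Longrightarrow> l2_inner M (f - l2_proj M V f) h = 0"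
proof -
  have "l2_proj M V f \<in> V \<and> (\<forall>h\<in>V. l2_inner M (f - l2_proj M V f) h = 0)"
    unfolding l2_proj_def
    using l2_projection_exists[OF assms] someI_ex[of "\<lambda>g. g \<in> V \<and> (\<forall>h\<in>V. l2_inner M (f - g) h = 0)"]
    by blast
  then show "l2_proj M V f \<in> V" "h \<in> V \<Longrightarrow> l2_inner M (f - l2_proj M V f) h = 0" by auto
qed

text \<open>Pythagoras: \<open>p - w\<close> lies in \<open>V\<close>, to which \<open>f - p\<close>
  is orthogonal.\<close>

lemma l2_ortho_norm_le:
  assumes V: "l2_closed_subspace M V" and f: "f \<in> L2 M" and p: "p \<in> V"
    and ortho: "\<And>h. h \<in> V \<Longrightarrow> l2_inner M (f - p) h = 0" and w: "w \<in> V"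
  shows "(l2_norm M (f - w))\<^sup>2 = (l2_norm M (f - p))\<^sup>2 + (l2_norm M (p - w))\<^sup>2"
proof -
  have L: "p \<in> L2 M" "w \<in> L2 M" using p w l2_closed_subspaceD(1)[OF V] by auto
  have "p - w \<in> V" using cfun_subspace_ops(3)[OF l2_closed_subspaceD(2)[OF V] p w] .
  then show ?thesis
    using l2_norm_sq_add[OF L2_diff[OF f L(1)] L2_diff[OF L]] ortho by simp
qed

text \<open>The kernel of \<open>L\<close> is closed and has codimension one, so a vector
  \<open>u\<close> orthogonal to it determines \<open>L\<close> up to a scalar. \<open>L\<close> is
  conjugate-linear because \<open>g\<close> stands in the second argument of
  \<open>l2_inner\<close>.\<close>

lemma l2_riesz:
  assumes M: "sigma_finite_measure M"
    and add: "\<And>f g. f \<in> L2 M \<Longrightarrow> g \<in> L2 M \<Longrightarrow> L (f + g) = L f + L g"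
    and scale: "\<And>c f. f \<in> L2 M \<Longrightarrow> L (cfun_scale c f) = cnj c * L f"
    and bound: "\<And>f. f \<in> L2 M \<Longrightarrow> cmod (L f) \<le> B * l2_norm M f"
  obtains h where "h \<in> L2 M" "\<And>g. g \<in> L2 M \<Longrightarrow> l2_inner M h g = L g"
proof (cases "\<forall>g\<in>L2 M. L g = 0")
  case True
  then show ?thesis using that[OF L2_zero] by (simp add: l2_inner_zero_left)
next
  case False
  then obtain g0 where g0: "g0 \<in> L2 M" "L g0 \<noteq> 0" by blast
  have Ldiff: "L (f - g) = L f - L g" if "f \<in> L2 M" "g \<in> L2 M" for f g
    using add[OF L2_diff[OF that] that(2)] by simp
  let ?N = "{g \<in> L2 M. L g = 0}"
  have N: "l2_closed_subspace M ?N"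
  proof (rule l2_closed_subspaceI)
    have "L 0 = 0" using scale[OF L2_zero, of 0] by simp
    then show "cfun.subspace ?N" by (auto simp: cfun.subspace_def L2_intros add scale)
    fix f assume f: "f \<in> L2 M" "\<And>e. 0 < e \<Longrightarrow> \<exists>g\<in>?N. l2_norm M (f - g) < e"
    have "cmod (L f) \<le> 0 + e" if "0 < e" for e
    proof -
      have "0 < e / (\<bar>B\<bar> + 1)" using that by (simp add: add_nonneg_pos)
      then obtain g where g: "g \<in> L2 M" "L g = 0" "l2_norm M (f - g) < e / (\<bar>B\<bar> + 1)" using f(2) by blast
      have "cmod (L f) = cmod (L (f - g))" using g f by (simp add: Ldiff)
      also have "\<dots> \<le> B * l2_norm M (f - g)" using f g by (intro bound L2_diff)
      also have "\<dots> \<le> (\<bar>B\<bar> + 1) * l2_norm M (f - g)" by (intro mult_right_mono) auto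
      also have "\<dots> \<le> e" using g(3) by (simp add: add_nonneg_pos pos_less_divide_eq mult.commute less_imp_le)
      finally show ?thesis by simp
    qed
    then have "L f = 0" by (metis field_le_epsilon norm_le_zero_iff)
    with f show "f \<in> ?N" by simp
  qed auto
  obtain p where p: "p \<in> ?N" "\<And>h. h \<in> ?N \<Longrightarrow> l2_inner M (g0 - p) h = 0"
    using l2_projection_exists[OF M N g0(1)] by blast
  define u where "u = g0 - p"
  have u: "u \<in> L2 M" "L u \<noteq> 0" using g0 p by (auto simp: u_def L2_diff Ldiff)
  have nu: "l2_norm M u \<noteq> 0" using bound[OF u(1)] u(2) by auto
  \<comment> \<open>The scalar is chosen to make the inner product of \<open>?h\<close> with
    \<open>u\<close> equal to \<open>L u\<close>.\<close>
  let ?h = "cfun_scale (L u / of_real ((l2_norm M u)\<^sup>2)) u"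
  have "l2_inner M ?h g = L g" if g: "g \<in> L2 M" for g
  proof -
    \<comment> \<open>By conjugate-linearity this \<open>c\<close> puts
      \<open>g - cfun_scale c u\<close> into the kernel.\<close>
    define c where "c = cnj (L g / L u)"
    have "g - cfun_scale c u \<in> ?N"
      using g u by (simp add: c_def L2_intros Ldiff scale)
    then have "l2_inner M u (g - cfun_scale c u) = 0" using p(2) unfolding u_def by blast
    then have "l2_inner M u g = cnj c * of_real ((l2_norm M u)\<^sup>2)"
      using g u by (simp add: l2_inner_diff_right L2_intros l2_inner_scale_right l2_inner_self)
    then show ?thesis using u nu by (simp add: l2_inner_scale_left c_def)
  qed
  then show ?thesis using that[OF L2_scale[OF u(1)]] by blast
qed

section \<open>Random characters of a countable abelian group\<close>

locale countable_comm_group = comm_group G for G (structure) +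
  assumes countable_carrier: "countable (carrier G)"
begin

definition gen :: "nat \<Rightarrow> 'a" where
  "gen = from_nat_into (carrier G)"

text \<open>The subgroup generated by the first \<open>n\<close> members of the enumeration. A
  character is extended along this increasing chain, which exhausts the group.\<close>

primrec level :: "nat \<Rightarrow> 'a set" where
  "level 0 = {\<one>}"
| "level (Suc n) = {h \<otimes> gen n [^] i | h (i :: int). h \<in> level n}"

text \<open>The order of \<open>gen n\<close> modulo \<open>level n\<close>. The value 0 for
  infinite order lets the criterion "the period divides the exponent" cover both cases.\<close>

definition period :: "nat \<Rightarrow> nat" where
  "period n = (if \<exists>k>0. gen n [^] (k::nat) \<in> level n then LEAST k. 0 < k \<and> gen n [^] k \<in> level n else 0)"

text \<open>For nonzero period an element has many such decompositions. An arbitrary one is fixed,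
  and \<open>chi_step_of_hom\<close> shows that the resulting value does not depend on it.\<close>

definition decomp :: "nat \<Rightarrow> 'a \<Rightarrow> 'a \<times> int" where
  "decomp n x = (SOME (h, i). h \<in> level n \<and> x = h \<otimes> gen n [^] i)"

text \<open>The character is extended one generator at a time through a real-valued angle, which is
  additive only modulo 1. Dividing by the period \<open>k\<close> after adding one of \<open>0, \<dots>, k - 1\<close> runs through
  the \<open>k\<close>-th roots of the value already fixed at the \<open>k\<close>-th power of the generator; choosing the root
  uniformly at random makes the mean vanish.\<close>

definition gen_angle :: "nat \<Rightarrow> ('a \<Rightarrow> real) \<Rightarrow> real \<Rightarrow> real" where
  "gen_angle n a t = (if period n = 0 then t else (a (gen n [^] period n) + t) / period n)"

primrec angle :: "nat \<Rightarrow> (nat \<Rightarrow> real) \<Rightarrow> 'a \<Rightarrow> real" where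
  "angle 0 u x = 0"
| "angle (Suc n) u x =
     angle n u (fst (decomp n x)) + of_int (snd (decomp n x)) * gen_angle n (angle n u) (u n)"

definition chi :: "nat \<Rightarrow> (nat \<Rightarrow> real) \<Rightarrow> 'a \<Rightarrow> complex" where
  "chi n u x = cis (2 * pi * angle n u x)"

definition coord_measure :: "nat \<Rightarrow> real measure" where
  "coord_measure n = (if period n = 0 then uniform_measure lborel {0..1}
     else distr (measure_pmf (pmf_of_set {..<period n})) borel real)"

text \<open>Where the period is positive the coordinate is the label of a root, so it has to be an
  integer for the extended character to be multiplicative. This holds almost surely.\<close>

definition coord_space :: "(nat \<Rightarrow> real) set" where
  "coord_space = {u. \<forall>n. period n \<noteq> 0 \<longrightarrow> u n \<in> \<int>}"

section \<open>The chain of subgroups and multiplicativity of the character\<close>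

lemma gen_closed [simp]: "gen n \<in> carrier G"
  unfolding gen_def by (rule from_nat_into) auto

lemma level_subgroup: "subgroup (level n) G"
proof (induction n)
  case (Suc n)
  then interpret H: subgroup "level n" G .
  note sub = H.subset[THEN subsetD]
  show ?case
  proof (rule subgroupI)
    show "level (Suc n) \<subseteq> carrier G" using sub by auto
    have "\<one> \<otimes> gen n [^] (0::int) \<in> level (Suc n)" unfolding level.simps using H.one_closed by blast
    then show "level (Suc n) \<noteq> {}" by blast
  next
    fix a assume "a \<in> level (Suc n)"
    then obtain h i where h: "h \<in> level n" "a = h \<otimes> gen n [^] (i::int)" by auto
    then have "inv a = inv h \<otimes> gen n [^] (- i)"
      using sub by (simp add: inv_mult int_pow_neg)
    then show "inv a \<in> level (Suc n)" using h(1) by auto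
  next
    fix a b assume "a \<in> level (Suc n)" "b \<in> level (Suc n)"
    then obtain h i k j where h: "h \<in> level n" "a = h \<otimes> gen n [^] (i::int)"
      "k \<in> level n" "b = k \<otimes> gen n [^] (j::int)" by auto
    then have "a \<otimes> b = (h \<otimes> k) \<otimes> gen n [^] (i + j)"
      using sub by (simp add: int_pow_mult m_ac)
    then show "a \<otimes> b \<in> level (Suc n)" using h by auto
  qed
qed (simp add: triv_subgroup)

lemma level_carrier: "x \<in> level n \<Longrightarrow> x \<in> carrier G"
  using level_subgroup[of n] subgroup.subset by blast

lemma level_pow: "x \<in> level n \<Longrightarrow> x [^] (i::int) \<in> level n"
  by (rule group.subgroup_int_pow_closed[OF is_group level_subgroup])

lemma level_Suc: "x \<in> level n \<Longrightarrow> x \<in> level (Suc n)"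
  using level_carrier[of x n] by (auto intro!: exI[of _ x] exI[of _ "0::int"])

lemma level_mono: "m \<le> n \<Longrightarrow> level m \<subseteq> level n"
  by (induction rule: dec_induct) (use level_Suc in blast)+

lemma ex_level: "x \<in> carrier G \<Longrightarrow> \<exists>n. x \<in> level n"
proof -
  assume "x \<in> carrier G"
  then obtain n where "gen n = x"
    unfolding gen_def using from_nat_into_surj[OF countable_carrier] by blast
  then have "x = \<one> \<otimes> gen n [^] (1::int)" by auto
  then have "x \<in> level (Suc n)"
    unfolding level.simps using subgroup.one_closed[OF level_subgroup[of n]] by blast
  then show ?thesis by blast
qed

text \<open>The exponents with power in \<open>level n\<close> form a subgroup of the integers;
  division with remainder shows that its least positive element generates it.\<close>

lemma gen_pow_level_iff: "gen n [^] (i::int) \<in> level n \<longleftrightarrow> int (period n) dvd i"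
proof -
  interpret H: subgroup "level n" G by (rule level_subgroup)
  have nat: "\<exists>k>0. gen n [^] (k::nat) \<in> level n" if i: "gen n [^] (i::int) \<in> level n" "i \<noteq> 0" for i
  proof -
    have "gen n [^] \<bar>i\<bar> \<in> level n"
      using i H.m_inv_closed[OF i(1)] by (cases "i \<ge> 0") (auto simp: int_pow_neg)
    then have "gen n [^] nat \<bar>i\<bar> \<in> level n" by (simp flip: int_pow_int)
    then show ?thesis using i(2) by (intro exI[of _ "nat \<bar>i\<bar>"]) auto
  qed
  show ?thesis
  proof (cases "\<exists>k>0. gen n [^] (k::nat) \<in> level n")
    case False
    then have "period n = 0" unfolding period_def by (rule if_not_P)
    moreover have "gen n [^] (0::int) \<in> level n" by simp
    ultimately show ?thesis using nat False by (metis dvd_0_left_iff of_nat_0)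
  next
    case True
    define k where "k = period n"
    have k_def': "k = (LEAST k. 0 < k \<and> gen n [^] k \<in> level n)" using True by (simp add: k_def period_def)
    have k: "0 < k" "gen n [^] k \<in> level n"
      using LeastI_ex[OF True] by (auto simp: k_def')
    have mult: "gen n [^] (int k * q) \<in> level n" for q
      using level_pow[OF k(2), of q] by (simp add: int_pow_pow flip: int_pow_int)
    have "int k dvd i" if i: "gen n [^] i \<in> level n"
    proof -
      have "gen n [^] (i mod int k) = gen n [^] i \<otimes> inv (gen n [^] (int k * (i div int k)))"
        by (simp add: int_pow_diff flip: minus_mult_div_eq_mod)
      then have "gen n [^] (i mod int k) \<in> level n" using i mult by (simp add: H.m_closed H.m_inv_closed)
      then have "gen n [^] nat (i mod int k) \<in> level n" using k(1) by (simp flip: int_pow_int)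
      moreover have "nat (i mod int k) < k" using k(1) by (simp add: nat_less_iff)
      ultimately have "nat (i mod int k) = 0"
        using not_less_Least[of "nat (i mod int k)" "\<lambda>k. 0 < k \<and> gen n [^] k \<in> level n"]
        unfolding k_def'[symmetric] by auto
      then have "i mod int k = 0" using k(1) pos_mod_sign[of "int k" i] by linarith
      then show ?thesis by (simp add: dvd_eq_mod_eq_0)
    qed
    then show ?thesis using mult by (auto simp: k_def elim!: dvdE)
  qed
qed

lemma decomp:
  assumes "x \<in> level (Suc n)"
  shows "fst (decomp n x) \<in> level n" "x = fst (decomp n x) \<otimes> gen n [^] snd (decomp n x)"
proof -
  have "case decomp n x of (h, i) \<Rightarrow> h \<in> level n \<and> x = h \<otimes> gen n [^] i"
    unfolding decomp_def by (rule someI_ex) (use assms in auto)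
  then show "fst (decomp n x) \<in> level n" "x = fst (decomp n x) \<otimes> gen n [^] snd (decomp n x)"
    by (auto simp: split_beta)
qed

lemma cis_int: "cis (2 * pi * of_int k) = 1"
  by (simp add: cis.ctr complex_eq_iff cos_int_2pin sin_int_2pin)

text \<open>The exponent is kept inside the angle, since \<open>gen_angle\<close> divides that same
  real number, and not merely the value on the circle, by the period.\<close>

lemma chi_pow_of_hom:
  assumes "\<And>x y. x \<in> level n \<Longrightarrow> y \<in> level n \<Longrightarrow> chi n u (x \<otimes> y) = chi n u x * chi n u y"
    and x: "x \<in> level n"
  shows "chi n u (x [^] (q::int)) = cis (2 * pi * (of_int q * angle n u x))"
proof -
  interpret H: subgroup "level n" G by (rule level_subgroup)
  have nz: "chi n u y \<noteq> 0" for y by (simp add: chi_def)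
  have one: "chi n u \<one> = 1"
    using assms(1)[of \<one> \<one>] nz[of \<one>] by simp
  have nat: "chi n u (x [^] (k::nat)) = cis (2 * pi * (real k * angle n u x))" for k
  proof (induction k)
    case (Suc k)
    have "x [^] k \<in> level n" using level_pow[OF x, of "int k"] by (simp add: int_pow_int)
    then show ?case using Suc x assms(1)[of "x [^] k" x]
      by (simp add: chi_def cis_mult algebra_simps)
  qed (simp add: one)
  show ?thesis
  proof (cases "q \<ge> 0")
    case True
    then show ?thesis using nat[of "nat q"] by (simp flip: int_pow_int)
  next
    case False
    define k where "k = nat (- q)"
    have q: "q = - int k" using False by (simp add: k_def)
    have xk: "x [^] k \<in> level n" using level_pow[OF x, of "int k"] by (simp add: int_pow_int)
    then have "chi n u (inv (x [^] k)) * chi n u (x [^] k) = 1"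
      using assms(1)[of "inv (x [^] k)" "x [^] k"] level_carrier[OF x] H.m_inv_closed one by simp
    then have "chi n u (inv (x [^] k)) = inverse (cis (2 * pi * (real k * angle n u x)))"
      unfolding nat using inverse_unique by (metis mult.commute)
    then show ?thesis using level_carrier[OF x] by (simp add: q int_pow_neg_int)
  qed
qed

context
  fixes u :: "nat \<Rightarrow> real"
  assumes u: "u \<in> coord_space"
begin

text \<open>Two decompositions of one element differ by a power of \<open>gen n\<close> in
  \<open>level n\<close>, so by a multiple of the period; on such powers the new angle agrees with
  the old one modulo 1. Multiplicativity on \<open>level n\<close> is a premise because this lemma
  drives the induction that proves it.\<close>

lemma chi_step_of_hom:
  assumes hom: "\<And>x y. x \<in> level n \<Longrightarrow> y \<in> level n \<Longrightarrow> chi n u (x \<otimes> y) = chi n u x * chi n u y"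
    and h: "h \<in> level n"
  shows "chi (Suc n) u (h \<otimes> gen n [^] (i::int))
    = chi n u h * cis (2 * pi * (of_int i * gen_angle n (angle n u) (u n)))"
proof -
  interpret H: subgroup "level n" G by (rule level_subgroup)
  let ?x = "h \<otimes> gen n [^] i" and ?t = "gen_angle n (angle n u) (u n)"
  have "?x \<in> level (Suc n)" using h by auto
  then obtain h' j where d: "decomp n ?x = (h', j)" and h': "h' \<in> level n" "?x = h' \<otimes> gen n [^] j"
    using decomp by (metis prod.collapse)
  have c: "h \<in> carrier G" "h' \<in> carrier G" using h h' level_carrier by auto
  have "h' = h \<otimes> gen n [^] i \<otimes> inv (gen n [^] j)"
    using c h'(2) by (simp add: m_assoc)
  then have e: "h' = h \<otimes> gen n [^] (i - j)" using c by (simp add: int_pow_diff m_assoc)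
  then have "gen n [^] (i - j) = inv h \<otimes> h'" using c by (simp add: inv_solve_left)
  then have mem: "gen n [^] (i - j) \<in> level n" using h h' by simp
  then obtain q where q: "i - j = int (period n) * q" unfolding gen_pow_level_iff by (elim dvdE)
  have key: "chi n u (gen n [^] (i - j)) = cis (2 * pi * (of_int (i - j) * ?t))"
  proof (cases "period n = 0")
    case True
    then have "i - j = 0" using q by simp
    then show ?thesis using chi_pow_of_hom[OF hom, of \<one> 0] by simp
  next
    case False
    let ?g = "gen n [^] period n"
    have g: "?g \<in> level n" using gen_pow_level_iff[of n "int (period n)"] by (simp add: int_pow_int)
    obtain z where z: "u n = of_int z" using u False by (auto simp: coord_space_def elim: Ints_cases)
    have "gen n [^] (i - j) = ?g [^] q" by (simp add: q int_pow_pow flip: int_pow_int)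
    then have "chi n u (gen n [^] (i - j)) = cis (2 * pi * (of_int q * angle n u ?g))"
      using chi_pow_of_hom[OF hom g] by simp
    \<comment> \<open>The label \<open>z\<close> enters through a factor equal to 1:
      \<open>period n\<close> times \<open>gen_angle\<close> is the old angle plus the integer
      \<open>z\<close>.\<close>
    also have "\<dots> = cis (2 * pi * (of_int q * angle n u ?g)) * cis (2 * pi * of_int (q * z))"
      by (simp only: cis_int mult_1_right)
    also have "\<dots> = cis (2 * pi * (of_int q * angle n u ?g + of_int q * of_int z))"
      by (simp only: cis_mult ring_distribs of_int_mult)
    also have "of_int q * angle n u ?g + of_int q * of_int z = of_int (i - j) * ?t"
      using False by (simp add: q gen_angle_def z field_simps)
    finally show ?thesis .
  qed
  have "chi (Suc n) u ?x = chi n u h' * cis (2 * pi * (of_int j * ?t))"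
    by (simp add: chi_def d cis_mult algebra_simps)
  also have "chi n u h' = chi n u h * cis (2 * pi * (of_int (i - j) * ?t))"
    using hom[OF h mem] key by (simp add: e)
  finally show ?thesis by (simp add: cis_mult algebra_simps)
qed

lemma chi_hom: "x \<in> level n \<Longrightarrow> y \<in> level n \<Longrightarrow> chi n u (x \<otimes> y) = chi n u x * chi n u y"
proof (induction n arbitrary: x y)
  case (Suc n)
  then obtain h i k j where h: "h \<in> level n" "x = h \<otimes> gen n [^] (i::int)"
    "k \<in> level n" "y = k \<otimes> gen n [^] (j::int)" by auto
  have c: "h \<in> carrier G" "k \<in> carrier G" using h level_carrier by auto
  have hk: "h \<otimes> k \<in> level n" using h subgroup.m_closed[OF level_subgroup] by blast
  have e: "x \<otimes> y = (h \<otimes> k) \<otimes> gen n [^] (i + j)"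
    using h c by (simp add: int_pow_mult m_ac)
  have step: "chi (Suc n) u (h \<otimes> gen n [^] i)
      = chi n u h * cis (2 * pi * (of_int i * gen_angle n (angle n u) (u n)))"
    if "h \<in> level n" for h and i :: int
    by (rule chi_step_of_hom[OF _ that]) (rule Suc.IH)
  let ?t = "gen_angle n (angle n u) (u n)"
  have "chi (Suc n) u (x \<otimes> y) = chi n u h * chi n u k * cis (2 * pi * (of_int (i + j) * ?t))"
    unfolding e step[OF hk] Suc.IH[OF h(1,3)] by (rule refl)
  also have "cis (2 * pi * (of_int (i + j) * ?t)) = cis (2 * pi * (of_int i * ?t)) * cis (2 * pi * (of_int j * ?t))"
    by (simp add: cis_mult algebra_simps)
  finally show ?case
    unfolding h(2,4) step[OF h(1)] step[OF h(3)] by (simp only: mult_ac)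
qed (simp add: chi_def)

lemma chi_step:
  "h \<in> level n \<Longrightarrow> chi (Suc n) u (h \<otimes> gen n [^] (i::int))
    = chi n u h * cis (2 * pi * (of_int i * gen_angle n (angle n u) (u n)))"
  by (rule chi_step_of_hom[OF chi_hom])

lemma chi_mono: "m \<le> n \<Longrightarrow> x \<in> level m \<Longrightarrow> chi n u x = chi m u x"
proof (induction rule: dec_induct)
  case (step n)
  then have "x \<in> level n" using level_mono by blast
  then show ?case using chi_step[of x n 0] step level_carrier by simp
qed simp

end

text \<open>The least level is just a canonical choice: on \<open>coord_space\<close> any later
  level gives the same value, by \<open>chi_mono\<close>.\<close>

definition character :: "'a \<Rightarrow> (nat \<Rightarrow> real) \<Rightarrow> complex" where
  "character x u = chi (LEAST n. x \<in> level n) u x"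

lemma character_eq_chi: "u \<in> coord_space \<Longrightarrow> x \<in> level n \<Longrightarrow> character x u = chi n u x"
  unfolding character_def by (rule chi_mono[symmetric]) (auto intro: LeastI Least_le)

lemma character_mult:
  assumes "u \<in> coord_space" "x \<in> carrier G" "y \<in> carrier G"
  shows "character (x \<otimes> y) u = character x u * character y u"
proof -
  obtain m n where "x \<in> level m" "y \<in> level n" using ex_level assms by blast
  then have l: "x \<in> level (max m n)" "y \<in> level (max m n)"
    using level_mono[of m "max m n"] level_mono[of n "max m n"] by auto
  then have "x \<otimes> y \<in> level (max m n)" using subgroup.m_closed[OF level_subgroup] by blast
  then show ?thesis using l assms(1) by (simp add: character_eq_chi chi_hom)
qed

lemma norm_character: "cmod (character x u) = 1"
  by (simp add: character_def chi_def)

section \<open>The product probability space and vanishing of the means\<close>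

lemma sets_coord_measure [simp, measurable_cong]: "sets (coord_measure n) = sets borel"
  by (simp add: coord_measure_def)

lemma space_coord_measure [simp]: "space (coord_measure n) = UNIV"
  by (simp add: coord_measure_def)

lemma prob_space_coord_measure: "prob_space (coord_measure n)"
proof (cases "period n = 0")
  case True
  then show ?thesis by (auto simp: coord_measure_def intro!: prob_space_uniform_measure)
next
  case False
  then show ?thesis
    by (auto simp: coord_measure_def intro!: prob_space.prob_space_distr prob_space_measure_pmf)
qed

lemma measurable_angle: "(\<lambda>u. angle n u x) \<in> borel_measurable (PiM UNIV coord_measure)"
proof (induction n arbitrary: x)
  case (Suc n)
  note [measurable] = Suc
  have [measurable]: "(\<lambda>u. u n) \<in> borel_measurable (PiM UNIV coord_measure)"
    using measurable_component_singleton[of n UNIV coord_measure] by (simp cong: measurable_cong_sets)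
  show ?case unfolding angle.simps gen_angle_def by measurable
qed simp

lemma measurable_character: "character x \<in> borel_measurable (PiM UNIV coord_measure)"
proof -
  have "(\<lambda>u. cis (2 * pi * angle n u x)) \<in> borel_measurable (PiM UNIV coord_measure)" for n
    by (rule measurable_compose[OF _ borel_measurable_continuous_onI[OF continuous_on_cis[OF continuous_on_id]]])
      (use measurable_angle in measurable)
  then show ?thesis unfolding character_def[abs_def] chi_def .
qed

lemma angle_cong: "(\<And>i. i < n \<Longrightarrow> u i = u' i) \<Longrightarrow> angle n u = angle n u'"
proof (induction n)
  case (Suc n)
  then have "angle n u = angle n u'" "u n = u' n" by auto
  then have "angle (Suc n) u x = angle (Suc n) u' x" for x by (simp only: angle.simps)
  then show ?case by blast
qed (auto simp: fun_eq_iff)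

text \<open>For period 0 an exponential is integrated over a nonzero number of full turns; otherwise
  the average is a geometric sum over all powers of a nontrivial root of unity.\<close>

lemma integral_cis_coord_measure:
  assumes i: "\<not> int (period n) dvd i"
  shows "(LINT t|coord_measure n. cis (2 * pi * (of_int i * gen_angle n a t))) = 0"
proof (cases "period n = 0")
  case True
  then have i0: "i \<noteq> 0" using i by simp
  have "coord_measure n = density lborel (\<lambda>t. ennreal (indicator {0..1} t))"
    using True by (auto simp: coord_measure_def uniform_measure_def indicator_def intro!: density_cong AE_I2)
  then have "(LINT t|coord_measure n. cis (2 * pi * (of_int i * gen_angle n a t)))
      = (LINT t|lborel. indicator {0..1} t *\<^sub>R cis (2 * pi * (of_int i * t)))"
    using True
    by (subst integral_density[symmetric, of "\<lambda>t. cis (2 * pi * (of_int i * t))" lborel "indicator {0..1}"])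
      (auto simp: gen_angle_def intro!: borel_measurable_continuous_onI continuous_intros)
  also have "\<dots> = cis (2 * pi * of_int i * 1) / (\<i> * (2 * pi * of_int i))
      - cis (2 * pi * of_int i * 0) / (\<i> * (2 * pi * of_int i))"
  proof (rule integral_FTC_atLeastAtMost)
    fix x :: real assume "0 \<le> x" "x \<le> 1"
    have "((\<lambda>t. exp (\<i> * (2 * pi * of_int i) * t) / (\<i> * (2 * pi * of_int i))) has_field_derivative
        exp (\<i> * (2 * pi * of_int i) * of_real x)) (at (of_real x))"
      using i0 by (auto intro!: derivative_eq_intros)
    from has_vector_derivative_real_field[OF this] show
      "((\<lambda>t. cis (2 * pi * of_int i * t) / (\<i> * (2 * pi * of_int i))) has_vector_derivative
        cis (2 * pi * (of_int i * x))) (at x within {0..1})"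
      by (simp add: cis_conv_exp mult_ac)
  qed (auto intro!: continuous_intros)
  also have "\<dots> = 0" using cis_int[of i] by simp
  finally show ?thesis .
next
  case False
  define k where "k = period n"
  \<comment> \<open>Raising the label by 1 multiplies the value by \<open>z\<close>; since
    \<open>k\<close> does not divide \<open>i\<close>, this root of unity differs from 1.\<close>
  define z where "z = cis (2 * pi * of_int i / k)"
  have k: "0 < k" using False by (simp add: k_def)
  have "z ^ k = cis (2 * pi * of_int i)" using k by (simp add: z_def Complex.DeMoivre)
  then have zk: "z ^ k = 1" by (simp add: cis_int)
  have z1: "z \<noteq> 1"
  proof
    assume "z = 1"
    then have "cos (2 * pi * of_int i / k) = 1" by (simp add: z_def complex_eq_iff)
    then obtain m :: int where "2 * pi * of_int i / k = of_int m * 2 * pi" using cos_one_2pi_int by auto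
    then have "real_of_int i = of_int (m * int k)" using k by (simp add: field_simps)
    then have "i = m * int k" by linarith
    then show False using i by (simp add: k_def)
  qed
  have "(LINT t|coord_measure n. cis (2 * pi * (of_int i * gen_angle n a t)))
      = (LINT j|measure_pmf (pmf_of_set {..<k}). cis (2 * pi * (of_int i * gen_angle n a (real j))))"
    using False
    by (simp add: coord_measure_def k_def, subst integral_distr)
      (auto simp: gen_angle_def intro!: borel_measurable_continuous_onI continuous_intros)
  also have "\<dots> = (\<Sum>j<k. cis (2 * pi * (of_int i * gen_angle n a (real j)))) / k"
    using k by (subst integral_measure_pmf[of "{..<k}"]) (auto simp: lessThan_empty_iff scaleR_conv_of_real sum_divide_distrib)
  also have "(\<Sum>j<k. cis (2 * pi * (of_int i * gen_angle n a (real j))))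
      = (\<Sum>j<k. cis (2 * pi * (of_int i * a (gen n [^] k) / k)) * z ^ j)"
    using k by (intro sum.cong refl)
      (simp add: z_def Complex.DeMoivre cis_mult gen_angle_def add_divide_distrib flip: k_def, simp add: field_simps)
  also have "\<dots> = 0"
    using z1 zk by (simp add: sum_gp_strict flip: sum_distrib_left)
  finally show ?thesis by simp
qed

lemma prob_space_PiM_coord_measure: "prob_space (PiM UNIV coord_measure)"
  by (rule prob_space_PiM) (rule prob_space_coord_measure)

lemma AE_coord_space: "AE u in PiM UNIV coord_measure. u \<in> coord_space"
proof -
  have "AE u in PiM UNIV coord_measure. period n \<noteq> 0 \<longrightarrow> u n \<in> \<int>" for n
  proof (cases "period n = 0")
    case False
    have "AE t in coord_measure n. t \<in> \<int>"
      using borel_closed[OF closed_Ints]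
      unfolding coord_measure_def if_not_P[OF False] by (subst AE_distr_iff) auto
    then have "AE u in PiM UNIV coord_measure. u n \<in> \<int>"
      using prob_space_coord_measure by (intro AE_PiM_component) auto
    then show ?thesis by auto
  qed auto
  then show ?thesis by (simp add: coord_space_def AE_all_countable)
qed

lemma sets_coord_space: "coord_space \<in> sets (PiM UNIV coord_measure)"
proof -
  have "coord_space = {u \<in> space (PiM UNIV coord_measure). \<forall>n. period n \<noteq> 0 \<longrightarrow> u n \<in> \<int>}"
    by (auto simp: coord_space_def space_PiM)
  moreover have "{u \<in> space (PiM UNIV coord_measure). u n \<in> \<int>} \<in> sets (PiM UNIV coord_measure)" for n
  proof -
    have "(\<lambda>u. u n) \<in> measurable (PiM UNIV coord_measure) borel"
      using measurable_component_singleton[of n UNIV coord_measure] by (simp cong: measurable_cong_sets)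
    moreover have "{t \<in> space borel. t \<in> (\<int> :: real set)} \<in> sets borel"
      using borel_closed[OF closed_Ints] by simp
    ultimately show ?thesis by (rule measurable_sets_Collect)
  qed
  ultimately show ?thesis by (auto intro!: sets.sets_Collect)
qed

text \<open>At the first level containing \<open>x\<close>, its last exponent is not a multiple of
  the period, since otherwise \<open>x\<close> would lie one level lower. Integrating over that last
  coordinate first, with the others fixed, already gives 0.\<close>

lemma integral_character_eq_0:
  assumes x: "x \<in> carrier G" "x \<noteq> \<one>"
  shows "(LINT u|PiM UNIV coord_measure. character x u) = 0"
proof -
  let ?P = "PiM UNIV coord_measure"
  define m where "m = (LEAST n. x \<in> level n)"
  have m: "x \<in> level m" unfolding m_def using ex_level[OF x(1)] by (auto intro: LeastI)
  have "m \<noteq> 0" using m x(2) by (cases m) auto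
  then obtain n where n: "m = Suc n" by (cases m) auto
  have nl: "x \<notin> level n" using not_less_Least[of n "\<lambda>n. x \<in> level n"] n by (simp add: m_def)
  obtain h i where h: "h \<in> level n" "x = h \<otimes> gen n [^] (i::int)" using m n by auto
  have i: "\<not> int (period n) dvd i"
    using nl h gen_pow_level_iff subgroup.m_closed[OF level_subgroup] by blast
  interpret C: prob_space "coord_measure n" by (rule prob_space_coord_measure)
  let ?Q = "PiM (UNIV - {n}) coord_measure"
  interpret Q: prob_space ?Q by (rule prob_space_PiM) (rule prob_space_coord_measure)
  interpret CQ: pair_prob_space "coord_measure n" ?Q by unfold_locales
  \<comment> \<open>\<open>F\<close> isolates the dependence on coordinate \<open>n\<close>: apart
    from \<open>u n\<close> it involves only the angle at stage \<open>n\<close>, which is fixed by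
    earlier coordinates.\<close>
  define F where "F u = chi n u h * cis (2 * pi * (of_int i * gen_angle n (angle n u) (u n)))" for u
  have [measurable]: "(\<lambda>u. u n) \<in> borel_measurable ?P"
    using measurable_component_singleton[of n UNIV coord_measure] by (simp cong: measurable_cong_sets)
  note [measurable] = measurable_angle
  have cisF: "F u = cis (2 * pi * angle n u h + 2 * pi * (of_int i * gen_angle n (angle n u) (u n)))" for u
    by (simp add: F_def chi_def cis_mult)
  have F [measurable]: "F \<in> borel_measurable ?P"
    unfolding cisF[abs_def]
    by (rule measurable_compose[OF _ borel_measurable_continuous_onI[OF continuous_on_cis[OF continuous_on_id]]])
      (auto simp: gen_angle_def)
  have Fb: "cmod (F u) = 1" for u by (simp add: cisF)
  have upd: "(\<lambda>(t, Y). Y(n := t)) \<in> measurable (coord_measure n \<Otimes>\<^sub>M ?Q) ?P"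
    using measurable_fun_upd[where I=UNIV and J="UNIV - {n}" and i=n and M=coord_measure and N="coord_measure n \<Otimes>\<^sub>M ?Q" and f=snd and h=fst]
    by (simp add: split_beta)
  have "(LINT u|?P. character x u) = (LINT u|?P. F u)"
  proof (rule integral_cong_AE)
    show "AE u in ?P. character x u = F u"
      using AE_coord_space
    proof eventually_elim
      case (elim u)
      have "character x u = chi (Suc n) u x" using character_eq_chi[OF elim, of x m] m n by simp
      then show ?case using chi_step[OF elim h(1), of i] h(2) by (simp add: F_def)
    qed
  qed (use measurable_character F in auto)
  also have "\<dots> = (LINT u|distr (coord_measure n \<Otimes>\<^sub>M ?Q) ?P (\<lambda>(t, Y). Y(n := t)). F u)"
    using distr_pair_PiM_eq_PiM[of "UNIV - {n}" coord_measure n] prob_space_coord_measure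
    by (simp add: insert_absorb)
  also have "\<dots> = (LINT p|(coord_measure n \<Otimes>\<^sub>M ?Q). F ((snd p)(n := fst p)))"
    using upd by (subst integral_distr) (auto simp: split_beta)
  also have "\<dots> = (LINT Y|?Q. LINT t|coord_measure n. F (Y(n := t)))"
  proof -
    have "integrable (coord_measure n \<Otimes>\<^sub>M ?Q) (\<lambda>(t, Y). F (Y(n := t)))"
      using measurable_compose[OF upd F]
      by (intro CQ.P.integrable_const_bound[of _ 1]) (auto simp: Fb split_beta)
    from CQ.integral_snd[OF this] show ?thesis by (simp add: case_prod_unfold)
  qed
  also have "(\<lambda>Y. LINT t|coord_measure n. F (Y(n := t))) = (\<lambda>Y. 0)"
  proof
    fix Y
    \<comment> \<open>The angle at stage \<open>n\<close> reads only coordinates below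
      \<open>n\<close>, hence is constant in the inner integral.\<close>
    have "angle n (Y(n := t)) = angle n Y" for t by (rule angle_cong) auto
    then show "(LINT t|coord_measure n. F (Y(n := t))) = 0"
      by (simp add: F_def chi_def integral_cis_coord_measure[OF i])
  qed
  finally show ?thesis by simp
qed

text \<open>The last property is arranged by shrinking the sigma-algebra of the product space to the
  one generated by the characters; uniqueness of Fourier coefficients rests on it.\<close>

lemma ex_random_character:
  obtains \<Omega> :: "(nat \<Rightarrow> real) measure" and \<xi>
  where "prob_space \<Omega>"
    and "\<And>a. a \<in> carrier G \<Longrightarrow> \<xi> a \<in> borel_measurable \<Omega>"
    and "\<And>a b w. a \<in> carrier G \<Longrightarrow> b \<in> carrier G \<Longrightarrow> \<xi> (a \<otimes> b) w = \<xi> a w * \<xi> b w"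
    and "\<And>a w. cmod (\<xi> a w) = 1"
    and "\<And>a. a \<in> carrier G \<Longrightarrow> a \<noteq> \<one> \<Longrightarrow> (LINT w|\<Omega>. \<xi> a w) = 0"
    and "sets \<Omega> = sigma_sets (space \<Omega>)
      ({{w \<in> space \<Omega>. c < Re (\<xi> a w)} | a c. a \<in> carrier G} \<union>
       {{w \<in> space \<Omega>. c < Im (\<xi> a w)} | a c. a \<in> carrier G})"
proof -
  let ?P = "PiM UNIV coord_measure"
  interpret P: prob_space ?P by (rule prob_space_PiM_coord_measure)
  \<comment> \<open>Replacing the character by the trivial one off the null set where labels fail to
    be integers makes multiplicativity hold at every point.\<close>
  define \<xi> where "\<xi> a u = (if u \<in> coord_space then character a u else 1)" for a u
  have [measurable]: "\<xi> a \<in> borel_measurable ?P" for a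
    unfolding \<xi>_def[abs_def] using measurable_character sets_coord_space
    by (intro measurable_If_set) (auto simp: space_PiM)
  define G' where "G' = {{w. c < Re (\<xi> a w)} | a c. a \<in> carrier G} \<union> {{w. c < Im (\<xi> a w)} | a c. a \<in> carrier G}"
  \<comment> \<open>The same points with only the events that the characters can see; the measure is
    carried over along the identity map.\<close>
  define N where "N = sigma (UNIV :: (nat \<Rightarrow> real) set) G'"
  have spP: "space ?P = UNIV" by (simp add: space_PiM)
  have G'P: "G' \<subseteq> sets ?P"
  proof -
    have "{w \<in> space ?P. c < Re (\<xi> a w)} \<in> sets ?P" "{w \<in> space ?P. c < Im (\<xi> a w)} \<in> sets ?P" for a c
      by measurable
    then show ?thesis unfolding G'_def spP by auto
  qed
  have N: "space N = UNIV" "sets N = sigma_sets UNIV G'" by (auto simp: N_def)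
  have id: "(\<lambda>w. w) \<in> measurable ?P N"
    unfolding N_def by (rule measurable_measure_of) (use G'P spP in auto)
  define \<Omega> where "\<Omega> = distr ?P N (\<lambda>w. w)"
  have sp: "space \<Omega> = UNIV" "sets \<Omega> = sigma_sets UNIV G'" by (auto simp: \<Omega>_def N)
  have meas: "\<xi> a \<in> borel_measurable N" if "a \<in> carrier G" for a
  proof (subst borel_measurable_complex_iff, intro conjI)
    have "{w. c < Re (\<xi> a w)} \<in> sets N" "{w. c < Im (\<xi> a w)} \<in> sets N" for c
      unfolding N using that by (auto intro!: sigma_sets.Basic simp: G'_def)
    then show "(\<lambda>w. Re (\<xi> a w)) \<in> borel_measurable N" "(\<lambda>w. Im (\<xi> a w)) \<in> borel_measurable N"
      by (simp_all add: borel_measurable_iff_greater N)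
  qed
  show ?thesis
  proof
    show "prob_space \<Omega>" unfolding \<Omega>_def by (rule P.prob_space_distr[OF id])
    show "\<xi> a \<in> borel_measurable \<Omega>" if "a \<in> carrier G" for a
      using meas[OF that] by (simp add: \<Omega>_def)
    show "\<xi> (a \<otimes> b) w = \<xi> a w * \<xi> b w" if "a \<in> carrier G" "b \<in> carrier G" for a b w
      using that by (simp add: \<xi>_def character_mult)
    show "cmod (\<xi> a w) = 1" for a w by (simp add: \<xi>_def norm_character)
    show "(LINT w|\<Omega>. \<xi> a w) = 0" if "a \<in> carrier G" "a \<noteq> \<one>" for a
    proof -
      have "(LINT w|\<Omega>. \<xi> a w) = (LINT w|?P. \<xi> a w)"
        unfolding \<Omega>_def using id meas that by (subst integral_distr) auto
      also have "\<dots> = (LINT w|?P. character a w)"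
      proof (rule integral_cong_AE)
        show "AE w in ?P. \<xi> a w = character a w"
          using AE_coord_space by eventually_elim (simp add: \<xi>_def)
      qed (use measurable_character in auto)
      finally show ?thesis using integral_character_eq_0 that by simp
    qed
    show "sets \<Omega> = sigma_sets (space \<Omega>)
      ({{w \<in> space \<Omega>. c < Re (\<xi> a w)} | a c. a \<in> carrier G} \<union>
       {{w \<in> space \<Omega>. c < Im (\<xi> a w)} | a c. a \<in> carrier G})"
      by (simp add: sp G'_def)
  qed
qed

end

section \<open>Uniqueness of Fourier coefficients\<close>

locale random_char = comm_group T + prob: prob_space \<Omega>
  for T :: "('g, 'm) monoid_scheme" (structure) and \<Omega> :: "'w measure" +
  fixes \<Gamma> :: "'g set" and \<xi> :: "'g \<Rightarrow> 'w \<Rightarrow> complex"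
  assumes \<Gamma>: "subgroup \<Gamma> T"
    and \<xi>_measurable: "a \<in> \<Gamma> \<Longrightarrow> \<xi> a \<in> borel_measurable \<Omega>"
    and \<xi>_mult: "a \<in> \<Gamma> \<Longrightarrow> b \<in> \<Gamma> \<Longrightarrow> \<xi> (a \<otimes> b) w = \<xi> a w * \<xi> b w"
    and norm_\<xi>: "cmod (\<xi> a w) = 1"
    and \<xi>_mean: "a \<in> \<Gamma> \<Longrightarrow> a \<noteq> \<one> \<Longrightarrow> (LINT w|\<Omega>. \<xi> a w) = 0"
    and sets_\<Omega>: "sets \<Omega> = sigma_sets (space \<Omega>)
      ({{w \<in> space \<Omega>. c < Re (\<xi> a w)} | a c. a \<in> \<Gamma>} \<union> {{w \<in> space \<Omega>. c < Im (\<xi> a w)} | a c. a \<in> \<Gamma>})"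
begin

lemma \<Gamma>_ops [simp, intro]:
  shows "\<one> \<in> \<Gamma>" "a \<in> \<Gamma> \<Longrightarrow> b \<in> \<Gamma> \<Longrightarrow> a \<otimes> b \<in> \<Gamma>" "a \<in> \<Gamma> \<Longrightarrow> inv a \<in> \<Gamma>" "a \<in> \<Gamma> \<Longrightarrow> a \<in> carrier T"
  using \<Gamma> by (auto simp: subgroup_def)

lemma \<xi>_one: "\<xi> \<one> w = 1"
proof -
  have "\<xi> \<one> w = \<xi> \<one> w * \<xi> \<one> w" using \<xi>_mult[of \<one> \<one> w] by simp
  moreover have "\<xi> \<one> w \<noteq> 0" using norm_\<xi>[of \<one> w] by auto
  ultimately show ?thesis by simp
qed

lemma \<xi>_mult_cnj: "\<xi> a w * cnj (\<xi> a w) = 1"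
  using complex_norm_square[of "\<xi> a w"] by (simp add: norm_\<xi>)

lemma \<xi>_inv: "a \<in> \<Gamma> \<Longrightarrow> \<xi> (inv a) w = cnj (\<xi> a w)"
proof -
  assume a: "a \<in> \<Gamma>"
  then have "\<xi> (inv a) w * \<xi> a w = 1" using \<xi>_mult[of "inv a" a w] \<xi>_one by simp
  then show ?thesis using \<xi>_mult_cnj[of a w] by (metis mult.commute mult.left_commute mult_1_right)
qed

lemma \<xi>_orthonormal:
  assumes "a \<in> \<Gamma>" "b \<in> \<Gamma>"
  shows "(LINT w|\<Omega>. \<xi> a w * cnj (\<xi> b w)) = (if a = b then 1 else 0)"
proof -
  have "\<xi> a w * cnj (\<xi> b w) = \<xi> (a \<otimes> inv b) w" for w
    using assms by (simp add: \<xi>_mult \<xi>_inv)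
  moreover have "a \<otimes> inv b = \<one> \<longleftrightarrow> a = b"
    using assms inv_solve_right'[of \<one> a b] \<Gamma>_ops(4) by auto
  ultimately show ?thesis
    using assms \<xi>_mean[of "a \<otimes> inv b"] \<xi>_one by (auto simp: prob.prob_space)
qed

text \<open>The multipliers preserving vanishing of all Fourier coefficients form an algebra closed under
  bounded pointwise limits; it contains the characters, hence all indicators of events.\<close>

definition fourier_null :: "('w \<Rightarrow> complex) \<Rightarrow> bool" where
  "fourier_null F \<longleftrightarrow> integrable \<Omega> F \<and> (\<forall>a\<in>\<Gamma>. (LINT w|\<Omega>. \<xi> a w * F w) = 0)"

definition null_multiplier :: "('w \<Rightarrow> complex) \<Rightarrow> bool" where
  "null_multiplier b \<longleftrightarrow> b \<in> borel_measurable \<Omega> \<and> (\<exists>K. \<forall>w\<in>space \<Omega>. cmod (b w) \<le> K) \<and>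
     (\<forall>F. fourier_null F \<longrightarrow> fourier_null (\<lambda>w. b w * F w))"

lemma integrable_bounded_mult:
  fixes b F :: "'w \<Rightarrow> complex"
  assumes F: "integrable \<Omega> F" and b: "b \<in> borel_measurable \<Omega>" "\<And>w. w \<in> space \<Omega> \<Longrightarrow> cmod (b w) \<le> K"
  shows "integrable \<Omega> (\<lambda>w. b w * F w)"
proof (rule Bochner_Integration.integrable_bound)
  show "integrable \<Omega> (\<lambda>w. K * cmod (F w))" using F by simp
  show "(\<lambda>w. b w * F w) \<in> borel_measurable \<Omega>" using F b by measurable
  show "AE w in \<Omega>. cmod (b w * F w) \<le> norm (K * cmod (F w))"
  proof (rule AE_I2)
    fix w assume "w \<in> space \<Omega>"
    then have "cmod (b w) \<le> \<bar>K\<bar>" using b(2)[of w] by linarith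
    then show "cmod (b w * F w) \<le> norm (K * cmod (F w))"
      by (simp add: norm_mult abs_mult mult_right_mono)
  qed
qed

lemma integrable_\<xi>_mult: "a \<in> \<Gamma> \<Longrightarrow> integrable \<Omega> F \<Longrightarrow> integrable \<Omega> (\<lambda>w. \<xi> a w * F w)"
  by (rule integrable_bounded_mult[where K=1]) (auto simp: \<xi>_measurable norm_\<xi>)

lemma null_multiplier_const: "null_multiplier (\<lambda>w. c)"
  unfolding null_multiplier_def fourier_null_def
  by (auto intro!: exI[of _ "cmod c"] simp: mult.left_commute)

text \<open>Multiplication by a character only shifts the index of the Fourier coefficients.\<close>

lemma null_multiplier_\<xi>: "a \<in> \<Gamma> \<Longrightarrow> null_multiplier (\<xi> a)"
  unfolding null_multiplier_def
proof (intro conjI allI impI)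
  fix F assume a: "a \<in> \<Gamma>" and F: "fourier_null F"
  have "(LINT w|\<Omega>. \<xi> b w * (\<xi> a w * F w)) = 0" if "b \<in> \<Gamma>" for b
  proof -
    have "(\<lambda>w. \<xi> b w * (\<xi> a w * F w)) = (\<lambda>w. \<xi> (b \<otimes> a) w * F w)"
      using a that by (simp add: \<xi>_mult mult.assoc)
    then show ?thesis using F a that by (simp add: fourier_null_def)
  qed
  then show "fourier_null (\<lambda>w. \<xi> a w * F w)"
    using a F by (simp add: fourier_null_def integrable_\<xi>_mult)
qed (auto simp: \<xi>_measurable norm_\<xi> intro!: exI[of _ 1])

lemma null_multiplier_mult:
  assumes "null_multiplier b" "null_multiplier c"
  shows "null_multiplier (\<lambda>w. b w * c w)"
proof -
  obtain K L where K: "\<forall>w\<in>space \<Omega>. cmod (b w) \<le> K" "\<forall>w\<in>space \<Omega>. cmod (c w) \<le> L"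
    using assms by (auto simp: null_multiplier_def)
  have "cmod (b w * c w) \<le> \<bar>K\<bar> * \<bar>L\<bar>" if "w \<in> space \<Omega>" for w
    unfolding norm_mult
    by (rule mult_mono) (use K that in \<open>auto intro: order.trans[OF _ abs_ge_self]\<close>)
  moreover have "fourier_null (\<lambda>w. b w * c w * F w)" if "fourier_null F" for F
    using assms that unfolding null_multiplier_def mult.assoc by blast
  ultimately show ?thesis using assms unfolding null_multiplier_def by (auto intro!: borel_measurable_times)
qed

lemma null_multiplier_add:
  assumes "null_multiplier b" "null_multiplier c"
  shows "null_multiplier (\<lambda>w. b w + c w)"
proof -
  obtain K L where K: "\<forall>w\<in>space \<Omega>. cmod (b w) \<le> K" "\<forall>w\<in>space \<Omega>. cmod (c w) \<le> L"
    using assms by (auto simp: null_multiplier_def)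
  have "cmod (b w + c w) \<le> K + L" if "w \<in> space \<Omega>" for w
    using K that by (intro order.trans[OF norm_triangle_ineq]) (auto intro: add_mono)
  moreover have "fourier_null (\<lambda>w. (b w + c w) * F w)" if "fourier_null F" for F
  proof -
    have "fourier_null (\<lambda>w. b w * F w)" "fourier_null (\<lambda>w. c w * F w)"
      using assms that unfolding null_multiplier_def by auto
    then show ?thesis
      unfolding fourier_null_def by (auto simp: ring_distribs integrable_\<xi>_mult)
  qed
  ultimately show ?thesis using assms unfolding null_multiplier_def by (auto intro!: borel_measurable_add)
qed

lemma null_multiplier_cmult: "null_multiplier b \<Longrightarrow> null_multiplier (\<lambda>w. c * b w)"
  by (rule null_multiplier_mult[OF null_multiplier_const])

lemma null_multiplier_diff:
  assumes "null_multiplier b" "null_multiplier c"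
  shows "null_multiplier (\<lambda>w. b w - c w)"
  using null_multiplier_add[OF assms(1) null_multiplier_cmult[OF assms(2), of "- 1"]] by simp

lemma null_multiplier_prod:
  "finite I \<Longrightarrow> (\<And>i. i \<in> I \<Longrightarrow> null_multiplier (b i)) \<Longrightarrow> null_multiplier (\<lambda>w. \<Prod>i\<in>I. b i w)"
  by (induction I rule: finite_induct) (auto simp: null_multiplier_const null_multiplier_mult)

text \<open>Dominated convergence, with \<open>K * cmod (F w)\<close> as the common bound.\<close>

lemma null_multiplier_limit:
  assumes b: "\<And>n. null_multiplier (b n)"
    and K: "\<And>n w. w \<in> space \<Omega> \<Longrightarrow> cmod (b n w) \<le> K"
    and lim: "\<And>w. w \<in> space \<Omega> \<Longrightarrow> (\<lambda>n. b n w) \<longlonglongrightarrow> c w"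
  shows "null_multiplier c"
proof -
  have bm: "b n \<in> borel_measurable \<Omega>" for n using b by (simp add: null_multiplier_def)
  have cm: "c \<in> borel_measurable \<Omega>" by (rule borel_measurable_LIMSEQ_metric[OF bm lim])
  have cK: "cmod (c w) \<le> K" if "w \<in> space \<Omega>" for w
    by (rule LIMSEQ_le_const2[OF tendsto_norm[OF lim[OF that]]]) (use K that in auto)
  have "fourier_null (\<lambda>w. c w * F w)" if F: "fourier_null F" for F
    unfolding fourier_null_def
  proof (intro conjI ballI)
    have Fi: "integrable \<Omega> F" using F by (simp add: fourier_null_def)
    show "integrable \<Omega> (\<lambda>w. c w * F w)" by (rule integrable_bounded_mult[OF Fi cm cK])
    fix a assume a: "a \<in> \<Gamma>"
    have "(\<lambda>n. LINT w|\<Omega>. \<xi> a w * (b n w * F w)) \<longlonglongrightarrow> (LINT w|\<Omega>. \<xi> a w * (c w * F w))"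
    proof (rule integral_dominated_convergence[where w="\<lambda>w. K * cmod (F w)"])
      show "(\<lambda>w. \<xi> a w * (c w * F w)) \<in> borel_measurable \<Omega>"
        "(\<lambda>w. \<xi> a w * (b n w * F w)) \<in> borel_measurable \<Omega>" for n
        using \<xi>_measurable[OF a] cm bm Fi by measurable
      show "integrable \<Omega> (\<lambda>w. K * cmod (F w))" using Fi by simp
      show "AE w in \<Omega>. (\<lambda>n. \<xi> a w * (b n w * F w)) \<longlonglongrightarrow> \<xi> a w * (c w * F w)"
        by (intro AE_I2 tendsto_intros lim)
      show "AE w in \<Omega>. cmod (\<xi> a w * (b n w * F w)) \<le> K * cmod (F w)" for n
        using K by (intro AE_I2) (auto simp: norm_mult norm_\<xi> mult_right_mono)
    qed
    moreover have "(LINT w|\<Omega>. \<xi> a w * (b n w * F w)) = 0" for n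
      using b[of n] F a by (auto simp: null_multiplier_def fourier_null_def)
    ultimately show "(LINT w|\<Omega>. \<xi> a w * (c w * F w)) = 0"
      by (simp add: LIMSEQ_const_iff)
  qed
  with cm cK show ?thesis unfolding null_multiplier_def by blast
qed

text \<open>Polynomials in \<open>r\<close> are multipliers by the algebra rules; Weierstrass
  approximates \<open>h\<close> uniformly by polynomials on the interval containing the values of
  \<open>r\<close>.\<close>

lemma null_multiplier_continuous:
  fixes r :: "'w \<Rightarrow> real" and h :: "real \<Rightarrow> real"
  assumes r: "null_multiplier (\<lambda>w. of_real (r w))" and bound: "\<And>w. \<bar>r w\<bar> \<le> 1"
    and h: "continuous_on {-1..1} h"
  shows "null_multiplier (\<lambda>w. of_real (h (r w)))"
proof -
  have poly: "null_multiplier (\<lambda>w. of_real (p (r w)))" if "real_polynomial_function p" for p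
    using that
  proof induction
    case (linear f)
    then obtain c where "f = (\<lambda>x. x * c)" using real_bounded_linear by blast
    then show ?case using null_multiplier_cmult[OF r, of "of_real c"] by (simp add: mult.commute)
  qed (auto simp: null_multiplier_const null_multiplier_add null_multiplier_mult)
  have "\<exists>p. real_polynomial_function p \<and> (\<forall>x\<in>{-1..1}. \<bar>h x - p x\<bar> < inverse (real (Suc n)))" for n
    by (rule Stone_Weierstrass_real_polynomial_function[OF compact_Icc h, of "inverse (real (Suc n))"]) auto
  then obtain p where p: "\<And>n. real_polynomial_function (p n)"
    "\<And>n x. x \<in> {-1..1} \<Longrightarrow> \<bar>h x - p n x\<bar> < inverse (real (Suc n))" by metis
  obtain B where B: "\<And>x. x \<in> {-1..1} \<Longrightarrow> \<bar>h x\<bar> \<le> B"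
    using compact_imp_bounded[OF compact_continuous_image[OF h compact_Icc]]
    unfolding bounded_iff by (metis imageI real_norm_def)
  have rI: "r w \<in> {-1..1}" for w using bound[of w] by auto
  show ?thesis
  proof (rule null_multiplier_limit)
    show "null_multiplier (\<lambda>w. of_real (p n (r w)))" for n by (rule poly[OF p(1)])
    fix w
    have "inverse (real (Suc n)) \<le> 1" for n by (simp add: inverse_le_1_iff)
    then show "cmod (of_real (p n (r w))) \<le> B + 1" for n
      using p(2)[OF rI[of w], of n] B[OF rI[of w]] unfolding norm_of_real by (smt (verit))
    have "(\<lambda>n. p n (r w)) \<longlonglongrightarrow> h (r w)"
    proof (rule LIM_zero_cancel, rule Lim_null_comparison[OF _ LIMSEQ_inverse_real_of_nat])
      show "\<forall>\<^sub>F n in sequentially. norm (p n (r w) - h (r w)) \<le> inverse (real (Suc n))"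
        using p(2)[OF rI[of w]] by (intro always_eventually allI) (auto simp: abs_minus_commute less_imp_le)
    qed
    then show "(\<lambda>n. complex_of_real (p n (r w))) \<longlonglongrightarrow> of_real (h (r w))" by (rule tendsto_of_real)
  qed
qed

lemma null_multiplier_superlevel:
  assumes r: "null_multiplier (\<lambda>w. of_real (r w))" and bound: "\<And>w. \<bar>r w\<bar> \<le> 1"
  shows "null_multiplier (indicator {w \<in> space \<Omega>. c < r w})"
proof (rule null_multiplier_limit)
  \<comment> \<open>Ramps that vanish up to \<open>c\<close> and rise to 1 with slope
    \<open>n\<close>; they converge pointwise to the indicator of the values above
    \<open>c\<close>.\<close>
  let ?h = "\<lambda>n x. min 1 (real n * max 0 (x - c))"
  show "null_multiplier (\<lambda>w. of_real (?h n (r w)))" for n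
    by (rule null_multiplier_continuous[OF r bound]) (intro continuous_intros)
  fix w assume w: "w \<in> space \<Omega>"
  show "cmod (of_real (?h n (r w))) \<le> 1" for n by (simp add: norm_of_real)
  have "(\<lambda>n. ?h n (r w)) \<longlonglongrightarrow> indicator {w \<in> space \<Omega>. c < r w} w"
  proof (cases "c < r w")
    case True
    obtain N where N: "1 / (r w - c) \<le> real N" using real_arch_simple by blast
    have "?h n (r w) = 1" if "n \<ge> N" for n
    proof -
      have "1 / (r w - c) \<le> real n" using N that by linarith
      then show ?thesis using True by (simp add: field_simps)
    qed
    then show ?thesis using True w
      by (intro tendsto_eventually eventually_sequentiallyI[of N]) auto
  qed (use w in simp)
  then show "(\<lambda>n. complex_of_real (?h n (r w))) \<longlonglongrightarrow> indicator {w \<in> space \<Omega>. c < r w} w"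
    using tendsto_of_real by (fastforce simp: of_real_indicator)
qed

lemma null_multiplier_indicator:
  assumes "A \<in> sets \<Omega>"
  shows "null_multiplier (indicator A)"
  using assms unfolding sets_\<Omega>
proof induction
  case (Basic A)
  have *: "null_multiplier (\<lambda>w. of_real (Re (\<xi> a w)))" "null_multiplier (\<lambda>w. of_real (Im (\<xi> a w)))"
    if a: "a \<in> \<Gamma>" for a
  proof -
    \<comment> \<open>Conjugating a character inverts its index, so real and imaginary parts are
      linear combinations of two characters.\<close>
    have "(\<lambda>w. of_real (Re (\<xi> a w))) = (\<lambda>w. 1/2 * (\<xi> a w + \<xi> (inv a) w))"
      using a by (auto simp: \<xi>_inv complex_eq_iff)
    then show "null_multiplier (\<lambda>w. of_real (Re (\<xi> a w)))"
      using a by (simp only:) (intro null_multiplier_cmult null_multiplier_add null_multiplier_\<xi>, auto)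
    have "(\<lambda>w. of_real (Im (\<xi> a w))) = (\<lambda>w. - \<i> / 2 * (\<xi> a w - \<xi> (inv a) w))"
      using a by (auto simp: \<xi>_inv complex_eq_iff)
    then show "null_multiplier (\<lambda>w. of_real (Im (\<xi> a w)))"
      using a by (simp only:) (intro null_multiplier_cmult null_multiplier_diff null_multiplier_\<xi>, auto)
  qed
  have b: "\<bar>Re (\<xi> a w)\<bar> \<le> 1" "\<bar>Im (\<xi> a w)\<bar> \<le> 1" for a w
    using abs_Re_le_cmod[of "\<xi> a w"] abs_Im_le_cmod[of "\<xi> a w"] by (auto simp: norm_\<xi>)
  from Basic show ?case
    using null_multiplier_superlevel[OF *(1) b(1)] null_multiplier_superlevel[OF *(2) b(2)] by auto
next
  case Empty
  then show ?case using null_multiplier_const[of 0] by (simp add: indicator_def[abs_def])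
next
  case (Compl A)
  \<comment> \<open>The indicator of the complement agrees with \<open>1 - indicator A\<close> only
    on \<open>space \<Omega>\<close>. A constant sequence in the limit rule transfers the property
    across such a change.\<close>
  have cong: "null_multiplier c" if bc: "null_multiplier b" "\<And>w. w \<in> space \<Omega> \<Longrightarrow> b w = c w" for b c
  proof -
    obtain K where K: "\<forall>w\<in>space \<Omega>. cmod (b w) \<le> K" using bc(1) by (auto simp: null_multiplier_def)
    show ?thesis by (rule null_multiplier_limit[of "\<lambda>n. b" K]) (use bc K in auto)
  qed
  show ?case
    by (rule cong[OF null_multiplier_diff[OF null_multiplier_const[of 1] Compl.IH]])
      (auto simp: indicator_def)
next
  case (Union A)
  \<comment> \<open>De Morgan: indicators of finite unions are written with products and
    differences, which preserve multipliers, and then pass to the limit.\<close>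
  let ?b = "\<lambda>n w. 1 - (\<Prod>i<n. 1 - indicator (A i) w :: complex)"
  have eq: "?b n w = indicator (\<Union>i<n. A i) w" for n w
    by (auto simp: indicator_def prod_zero_iff intro!: prod.neutral)
  show ?case
  proof (rule null_multiplier_limit)
    show "null_multiplier (?b n)" for n
      by (intro null_multiplier_diff null_multiplier_const null_multiplier_prod Union.IH) auto
    show "cmod (?b n w) \<le> 1" for n w unfolding eq by (simp add: indicator_def)
    show "(\<lambda>n. ?b n w) \<longlonglongrightarrow> indicator (\<Union>i. A i) w" for w
      unfolding eq by (rule LIMSEQ_indicator_UN)
  qed
qed

text \<open>Multiplying by the indicator of an event keeps all coefficients zero; the coefficient at
  the identity is then the integral of \<open>F\<close> over that event.\<close>

lemma fourier_unique:
  assumes "integrable \<Omega> F" "\<And>a. a \<in> \<Gamma> \<Longrightarrow> (LINT w|\<Omega>. \<xi> a w * F w) = 0"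
  shows "AE w in \<Omega>. F w = 0"
proof (rule prob.density_zero[OF assms(1)])
  have F: "fourier_null F" using assms by (simp add: fourier_null_def)
  fix A assume "A \<in> sets \<Omega>"
  then have "fourier_null (\<lambda>w. indicator A w * F w)"
    using F null_multiplier_indicator by (auto simp: null_multiplier_def)
  then have "(LINT w|\<Omega>. \<xi> \<one> w * (indicator A w * F w)) = 0" by (simp add: fourier_null_def)
  moreover have "indicator A w * F w = indicator A w *\<^sub>R F w" for w
    by (simp add: indicator_def)
  ultimately show "set_lebesgue_integral \<Omega> A F = 0"
    by (simp add: \<xi>_one set_lebesgue_integral_def)
qed

end

section \<open>The induced unitary representation\<close>

locale quasi_invariant_action = comm_group T + mu: sigma_finite_measure M
  for T :: "('g, 'm) monoid_scheme" (structure) and M :: "'x measure" +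
  fixes \<sigma> :: "'g \<Rightarrow> 'x \<Rightarrow> 'x" and J :: "'g \<Rightarrow> 'x \<Rightarrow> real"
  assumes action: "measurable_action T M \<sigma>" and jacobian: "is_jacobian T M \<sigma> J"
begin

abbreviation \<rho> :: "'g \<Rightarrow> ('x \<Rightarrow> complex) \<Rightarrow> 'x \<Rightarrow> complex" where
  "\<rho> \<equiv> rep T \<sigma> J"

lemma \<sigma>_measurable [measurable]: "g \<in> carrier T \<Longrightarrow> \<sigma> g \<in> M \<rightarrow>\<^sub>M M"
  and \<sigma>_comp: "g \<in> carrier T \<Longrightarrow> h \<in> carrier T \<Longrightarrow> x \<in> space M \<Longrightarrow> \<sigma> g (\<sigma> h x) = \<sigma> (g \<otimes> h) x"
  and \<sigma>_one: "x \<in> space M \<Longrightarrow> \<sigma> \<one> x = x"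
  using action by (auto simp: measurable_action_def)

lemma \<sigma>_space: "g \<in> carrier T \<Longrightarrow> x \<in> space M \<Longrightarrow> \<sigma> g x \<in> space M"
  using measurable_space[OF \<sigma>_measurable] by blast

lemma \<sigma>_inv: "g \<in> carrier T \<Longrightarrow> x \<in> space M \<Longrightarrow> \<sigma> (inv g) (\<sigma> g x) = x"
  "g \<in> carrier T \<Longrightarrow> x \<in> space M \<Longrightarrow> \<sigma> g (\<sigma> (inv g) x) = x"
  by (simp_all add: \<sigma>_comp \<sigma>_one)

text \<open>Rewriting an image as a preimage under the inverse makes images of measurable sets
  measurable.\<close>

lemma \<sigma>_image: "g \<in> carrier T \<Longrightarrow> E \<subseteq> space M \<Longrightarrow> \<sigma> g ` E = {x \<in> space M. \<sigma> (inv g) x \<in> E}"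
  by (auto simp: \<sigma>_inv \<sigma>_space subset_iff image_iff) (metis \<sigma>_inv(2))

lemma \<sigma>_image_sets: "g \<in> carrier T \<Longrightarrow> E \<in> sets M \<Longrightarrow> \<sigma> g ` E \<in> sets M"
  using sets.sets_into_space[of E M] by (simp add: \<sigma>_image)

lemma J_measurable [measurable]: "g \<in> carrier T \<Longrightarrow> J g \<in> borel_measurable M"
proof -
  assume g: "g \<in> carrier T"
  have "(\<lambda>x. (g, x)) \<in> M \<rightarrow>\<^sub>M count_space (carrier T) \<Otimes>\<^sub>M M" using g by simp
  moreover have "(\<lambda>(g, x). J g x) \<in> borel_measurable (count_space (carrier T) \<Otimes>\<^sub>M M)"
    using jacobian by (simp add: is_jacobian_def)
  ultimately have "(\<lambda>x. case (g, x) of (g, x) \<Rightarrow> J g x) \<in> borel_measurable M"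
    by (rule measurable_compose)
  then show ?thesis by simp
qed

lemma J_pos: "g \<in> carrier T \<Longrightarrow> x \<in> space M \<Longrightarrow> 0 < J g x"
  using jacobian by (simp add: is_jacobian_def)

text \<open>The Jacobian is specified through images of sets. Stated as a push-forward identity it
  gives access to the integral rules for \<open>distr\<close> and \<open>density\<close>.\<close>

lemma distr_density_J:
  assumes g: "g \<in> carrier T"
  shows "distr (density M (J g)) M (\<sigma> g) = M"
proof (rule measure_eqI)
  fix E assume "E \<in> sets (distr (density M (J g)) M (\<sigma> g))"
  then have E: "E \<in> sets M" by simp
  let ?E = "\<sigma> g -` E \<inter> space M"
  have E': "?E \<in> sets M" using g E by measurable
  have im: "\<sigma> g ` ?E = E"
  proof
    show "E \<subseteq> \<sigma> g ` ?E"
    proof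
      fix y assume y: "y \<in> E"
      then have sp: "y \<in> space M" using sets.sets_into_space[OF E] by blast
      then have "\<sigma> (inv g) y \<in> ?E" using y g by (simp add: \<sigma>_inv \<sigma>_space)
      then show "y \<in> \<sigma> g ` ?E" using \<sigma>_inv(2)[OF g sp] by (metis image_eqI)
    qed
  qed auto
  have "emeasure (distr (density M (J g)) M (\<sigma> g)) E = emeasure (density M (J g)) ?E"
    using g E by (subst emeasure_distr) auto
  also have "\<dots> = (\<integral>\<^sup>+x\<in>?E. ennreal (J g x) \<partial>M)" using g E' by (subst emeasure_density) auto
  also have "\<dots> = emeasure M (\<sigma> g ` ?E)" using jacobian g E' by (simp add: is_jacobian_def)
  finally show "emeasure (distr (density M (J g)) M (\<sigma> g)) E = emeasure M E" by (simp add: im)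
qed simp

lemma nn_integral_change_variables:
  assumes g: "g \<in> carrier T" and f [measurable]: "f \<in> borel_measurable M"
  shows "(\<integral>\<^sup>+x. ennreal (J g x) * f (\<sigma> g x) \<partial>M) = (\<integral>\<^sup>+x. f x \<partial>M)"
proof -
  have "(\<integral>\<^sup>+x. f x \<partial>M) = (\<integral>\<^sup>+x. f x \<partial>distr (density M (J g)) M (\<sigma> g))"
    using g by (simp add: distr_density_J)
  also have "\<dots> = (\<integral>\<^sup>+x. f (\<sigma> g x) \<partial>density M (J g))" using g by (subst nn_integral_distr) auto
  also have "\<dots> = (\<integral>\<^sup>+x. ennreal (J g x) * f (\<sigma> g x) \<partial>M)" using g by (subst nn_integral_density) auto
  finally show ?thesis by simp
qed

lemma
  fixes f :: "'x \<Rightarrow> 'b::{banach, second_countable_topology}"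
  assumes g: "g \<in> carrier T" and f [measurable]: "f \<in> borel_measurable M"
  shows integrable_change_variables: "integrable M (\<lambda>x. J g x *\<^sub>R f (\<sigma> g x)) \<longleftrightarrow> integrable M f"
    and integral_change_variables: "(LINT x|M. J g x *\<^sub>R f (\<sigma> g x)) = (LINT x|M. f x)"
proof -
  have nn: "AE x in M. 0 \<le> J g x" using J_pos[OF g] by (auto intro: less_imp_le)
  have "integrable M f \<longleftrightarrow> integrable (distr (density M (J g)) M (\<sigma> g)) f"
    using g by (simp add: distr_density_J)
  also have "\<dots> \<longleftrightarrow> integrable (density M (J g)) (\<lambda>x. f (\<sigma> g x))"
    using g by (subst integrable_distr_eq) auto
  also have "\<dots> \<longleftrightarrow> integrable M (\<lambda>x. J g x *\<^sub>R f (\<sigma> g x))"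
    using g nn by (subst integrable_density) auto
  finally show "integrable M (\<lambda>x. J g x *\<^sub>R f (\<sigma> g x)) \<longleftrightarrow> integrable M f" by simp
  have "(LINT x|M. f x) = (LINT x|distr (density M (J g)) M (\<sigma> g). f x)"
    using g by (simp add: distr_density_J)
  also have "\<dots> = (LINT x|density M (J g). f (\<sigma> g x))" using g by (subst integral_distr) auto
  also have "\<dots> = (LINT x|M. J g x *\<^sub>R f (\<sigma> g x))" using g nn by (subst integral_density) auto
  finally show "(LINT x|M. J g x *\<^sub>R f (\<sigma> g x)) = (LINT x|M. f x)" by simp
qed

lemma J_cocycle:
  assumes g: "g \<in> carrier T" and h: "h \<in> carrier T"
  shows "AE x in M. J (g \<otimes> h) x = J g (\<sigma> h x) * J h x"
proof -
  have "density M (\<lambda>x. ennreal (J (g \<otimes> h) x)) = density M (\<lambda>x. ennreal (J g (\<sigma> h x) * J h x))"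
  proof (rule measure_eqI)
    fix E assume "E \<in> sets (density M (\<lambda>x. ennreal (J (g \<otimes> h) x)))"
    then have E: "E \<in> sets M" by simp
    note Es = sets.sets_into_space[OF E, THEN subsetD]
    have "emeasure (density M (\<lambda>x. ennreal (J (g \<otimes> h) x))) E = emeasure M (\<sigma> (g \<otimes> h) ` E)"
      using jacobian g h E by (subst emeasure_density) (auto simp: is_jacobian_def)
    also have "\<sigma> (g \<otimes> h) ` E = \<sigma> g ` (\<sigma> h ` E)"
      unfolding image_image using g h Es by (intro image_cong) (auto simp: \<sigma>_comp)
    also have "emeasure M \<dots> = (\<integral>\<^sup>+x. ennreal (J g x) * indicator (\<sigma> h ` E) x \<partial>M)"
      using jacobian g \<sigma>_image_sets[OF h E] by (auto simp: is_jacobian_def)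
    also have "\<dots> = (\<integral>\<^sup>+x. ennreal (J h x) * (ennreal (J g (\<sigma> h x)) * indicator (\<sigma> h ` E) (\<sigma> h x)) \<partial>M)"
      using g h \<sigma>_image_sets[OF h E]
      by (intro nn_integral_change_variables[symmetric, where f="\<lambda>x. ennreal (J g x) * indicator (\<sigma> h ` E) x"]) auto
    also have "\<dots> = (\<integral>\<^sup>+x. ennreal (J g (\<sigma> h x) * J h x) * indicator E x \<partial>M)"
    proof (rule nn_integral_cong)
      fix x assume x: "x \<in> space M"
      have "\<sigma> h x \<in> \<sigma> h ` E \<longleftrightarrow> x \<in> E"
        using h Es x by (auto simp: image_iff) (metis \<sigma>_inv(1))
      moreover have "0 \<le> J h x" "0 \<le> J g (\<sigma> h x)"
        using J_pos[OF h x] J_pos[OF g \<sigma>_space[OF h x]] by auto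
      ultimately show "ennreal (J h x) * (ennreal (J g (\<sigma> h x)) * indicator (\<sigma> h ` E) (\<sigma> h x))
          = ennreal (J g (\<sigma> h x) * J h x) * indicator E x"
        by (auto simp: indicator_def ennreal_mult mult.commute)
    qed
    also have "\<dots> = emeasure (density M (\<lambda>x. ennreal (J g (\<sigma> h x) * J h x))) E"
      using g h E by (subst emeasure_density) auto
    finally show "emeasure (density M (\<lambda>x. ennreal (J (g \<otimes> h) x))) E
        = emeasure (density M (\<lambda>x. ennreal (J g (\<sigma> h x) * J h x))) E" .
  qed simp
  then have "AE x in M. ennreal (J (g \<otimes> h) x) = ennreal (J g (\<sigma> h x) * J h x)"
    using g h by (subst (asm) mu.density_unique_iff) auto
  then show ?thesis using AE_space
  proof eventually_elim
    case (elim x)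
    then show ?case
      using J_pos[of "g \<otimes> h" x] J_pos[of g "\<sigma> h x"] J_pos[of h x] g h \<sigma>_space[of h x]
      by (subst (asm) ennreal_inj) (auto intro: less_imp_le)
  qed
qed

text \<open>The cocycle rule makes the Jacobian at the identity equal to its square, and it is
  positive.\<close>

lemma J_one: "AE x in M. J \<one> x = 1"
  using J_cocycle[OF one_closed one_closed] AE_space
proof eventually_elim
  case (elim x)
  then have "J \<one> x * J \<one> x = J \<one> x" by (simp add: \<sigma>_one)
  then show ?case using J_pos[OF one_closed elim(2)] by simp
qed

lemma rep_add: "\<rho> g (f + f') = \<rho> g f + \<rho> g f'"
  and rep_diff: "\<rho> g (f - f') = \<rho> g f - \<rho> g f'"
  and rep_scale: "\<rho> g (cfun_scale c f) = cfun_scale c (\<rho> g f)"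
  and rep_zero: "\<rho> g 0 = 0"
  by (auto simp: rep_def cfun_scale_def fun_eq_iff algebra_simps)

lemma rep_measurable:
  assumes "g \<in> carrier T" "f \<in> borel_measurable M"
  shows "\<rho> g f \<in> borel_measurable M"
proof -
  have [measurable]: "f \<in> borel_measurable M" "\<sigma> (inv g) \<in> M \<rightarrow>\<^sub>M M" "J (inv g) \<in> borel_measurable M"
    using assms by auto
  show ?thesis unfolding rep_def by measurable
qed

lemma rep_L2:
  assumes g: "g \<in> carrier T" and f: "f \<in> L2 M"
  shows "\<rho> g f \<in> L2 M"
proof -
  have "integrable M (\<lambda>x. J (inv g) x *\<^sub>R (cmod (f (\<sigma> (inv g) x)))\<^sup>2)"
    using integrable_change_variables[of "inv g" "\<lambda>x. (cmod (f x))\<^sup>2"] g f by (auto simp: L2_def)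
  moreover have "J (inv g) x *\<^sub>R (cmod (f (\<sigma> (inv g) x)))\<^sup>2 = (cmod (\<rho> g f x))\<^sup>2" if "x \<in> space M" for x
    using J_pos[of "inv g" x] that g
    by (simp add: rep_def norm_mult power_mult_distrib less_imp_le flip: of_real_power)
  ultimately have "integrable M (\<lambda>x. (cmod (\<rho> g f x))\<^sup>2)"
    by (subst Bochner_Integration.integrable_cong[OF refl]) auto
  then show ?thesis using rep_measurable[OF g] f by (simp add: L2_def)
qed

lemma rep_inner:
  assumes g: "g \<in> carrier T" and f: "f \<in> L2 M" "f' \<in> L2 M"
  shows "l2_inner M (\<rho> g f) (\<rho> g f') = l2_inner M f f'"
proof -
  have "l2_inner M (\<rho> g f) (\<rho> g f')
      = (LINT x|M. J (inv g) x *\<^sub>R (f (\<sigma> (inv g) x) * cnj (f' (\<sigma> (inv g) x))))"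
    unfolding l2_inner_def
  proof (rule Bochner_Integration.integral_cong[OF refl])
    fix x assume "x \<in> space M"
    then have "0 \<le> J (inv g) x" using J_pos[of "inv g" x] g by simp
    then have "complex_of_real (sqrt (J (inv g) x)) * complex_of_real (sqrt (J (inv g) x)) = of_real (J (inv g) x)"
      by (simp flip: of_real_mult)
    then show "\<rho> g f x * cnj (\<rho> g f' x) = J (inv g) x *\<^sub>R (f (\<sigma> (inv g) x) * cnj (f' (\<sigma> (inv g) x)))"
      by (simp add: rep_def scaleR_conv_of_real algebra_simps)
  qed
  also have "\<dots> = l2_inner M f f'"
    unfolding l2_inner_def
    by (rule integral_change_variables) (use g borel_measurable_integrable[OF L2_mult_integrable[OF f]] in simp_all)
  finally show ?thesis .
qed

lemma rep_norm: "g \<in> carrier T \<Longrightarrow> f \<in> L2 M \<Longrightarrow> l2_norm M (\<rho> g f) = l2_norm M f"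
  using rep_inner[of g f f] l2_norm_sq_Re[of M] by (metis l2_norm_nonneg power2_eq_imp_eq)

lemma rep_mult_AE:
  assumes g: "g \<in> carrier T" and h: "h \<in> carrier T"
  shows "AE x in M. \<rho> g (\<rho> h f) x = \<rho> (g \<otimes> h) f x"
  using J_cocycle[OF inv_closed[OF h] inv_closed[OF g]] AE_space
proof eventually_elim
  case (elim x)
  then show ?case
    using g h by (simp add: rep_def \<sigma>_comp inv_mult_group real_sqrt_mult)
qed

lemma rep_one_AE: "AE x in M. \<rho> \<one> f x = f x"
  using J_one AE_space by eventually_elim (simp add: rep_def \<sigma>_one)

text \<open>The isometry property replaces an argument about images of null sets:
  \<open>\<rho> g (f - f')\<close> has norm 0.\<close>

lemma rep_cong_AE:
  assumes g: "g \<in> carrier T" and "f \<in> L2 M" "f' \<in> L2 M" "AE x in M. f x = f' x"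
  shows "AE x in M. \<rho> g f x = \<rho> g f' x"
proof -
  have "l2_norm M (\<rho> g f - \<rho> g f') = 0"
    using assms l2_norm_diff_eq_0[of f M f'] by (simp add: rep_norm L2_diff flip: rep_diff)
  then show ?thesis using assms by (simp add: l2_norm_diff_eq_0 rep_L2)
qed

lemma rep_inv_AE:
  assumes g: "g \<in> carrier T" and f: "f \<in> L2 M"
  shows "AE x in M. \<rho> g (\<rho> (inv g) f) x = f x"
  using rep_mult_AE[OF g inv_closed[OF g], of f] rep_one_AE[of f]
  by eventually_elim (simp add: g)

lemma rep_adjoint:
  assumes g: "g \<in> carrier T" and f: "f \<in> L2 M" "f' \<in> L2 M"
  shows "l2_inner M (\<rho> g f) f' = l2_inner M f (\<rho> (inv g) f')"
proof -
  have "l2_inner M (\<rho> g f) f' = l2_inner M (\<rho> g f) (\<rho> g (\<rho> (inv g) f'))"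
    using assms rep_inv_AE[OF g f(2)]
    by (intro l2_inner_cong_AE) (auto simp: rep_L2)
  then show ?thesis using assms by (simp add: rep_inner rep_L2)
qed

end

section \<open>The Zak transform and the bracket\<close>

lemma sum_fun_apply: "(\<Sum>i\<in>I. f i) x = (\<Sum>i\<in>I. f i x)"
  by (induction I rule: infinite_finite_induct) auto

lemma l2_inner_tendsto:
  assumes "\<And>n. f n \<in> L2 M" "f' \<in> L2 M" "(\<lambda>n. l2_norm M (f n - f')) \<longlonglongrightarrow> 0"
    and "\<And>n. g n \<in> L2 M" "g' \<in> L2 M" "(\<lambda>n. l2_norm M (g n - g')) \<longlonglongrightarrow> 0"
  shows "(\<lambda>n. l2_inner M (f n) (g n)) \<longlonglongrightarrow> l2_inner M f' g'"
proof (rule LIM_zero_cancel, rule Lim_null_comparison)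
  let ?b = "\<lambda>n. l2_norm M (f n - f') * (l2_norm M (g n - g') + l2_norm M g') + l2_norm M f' * l2_norm M (g n - g')"
  have "?b \<longlonglongrightarrow> 0 * (0 + l2_norm M g') + l2_norm M f' * 0"
    by (intro tendsto_intros assms)
  then show "?b \<longlonglongrightarrow> 0" by simp
  show "\<forall>\<^sub>F n in sequentially. norm (l2_inner M (f n) (g n) - l2_inner M f' g') \<le> ?b n"
  proof (intro always_eventually allI)
    fix n
    have "l2_inner M (f n) (g n) - l2_inner M f' g'
        = l2_inner M (f n - f') (g n) + l2_inner M f' (g n - g')"
      using assms by (simp add: l2_inner_diff_left l2_inner_diff_right)
    also have "norm \<dots> \<le> l2_norm M (f n - f') * l2_norm M (g n) + l2_norm M f' * l2_norm M (g n - g')"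
      using assms by (intro order.trans[OF norm_triangle_ineq] add_mono l2_cauchy_schwarz L2_diff)
    finally have *: "norm (l2_inner M (f n) (g n) - l2_inner M f' g')
        \<le> l2_norm M (f n - f') * l2_norm M (g n) + l2_norm M f' * l2_norm M (g n - g')" .
    have "l2_norm M (g n) \<le> l2_norm M (g n - g') + l2_norm M g'"
      using l2_norm_triangle[of "g n - g'" M g'] assms by (simp add: L2_diff)
    then have "l2_norm M (f n - f') * l2_norm M (g n) \<le> l2_norm M (f n - f') * (l2_norm M (g n - g') + l2_norm M g')"
      by (rule mult_left_mono) simp
    with * show "norm (l2_inner M (f n) (g n) - l2_inner M f' g') \<le> ?b n"
      by linarith
  qed
qed

definition l2_tensor :: "('w \<Rightarrow> complex) \<Rightarrow> ('x \<Rightarrow> complex) \<Rightarrow> 'w \<times> 'x \<Rightarrow> complex" where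
  "l2_tensor b f = (\<lambda>p. b (fst p) * f (snd p))"

context pair_sigma_finite
begin

lemma l2_tensor_integral:
  fixes b :: "'a \<Rightarrow> complex" and f :: "'b \<Rightarrow> complex"
  assumes b: "integrable M1 b" and f: "integrable M2 f"
  shows "integrable (M1 \<Otimes>\<^sub>M M2) (l2_tensor b f)"
    and "(LINT p|(M1 \<Otimes>\<^sub>M M2). l2_tensor b f p) = (LINT w|M1. b w) * (LINT x|M2. f x)"
proof -
  note [measurable] = borel_measurable_integrable[OF b] borel_measurable_integrable[OF f]
  have "integrable (M1 \<Otimes>\<^sub>M M2) (\<lambda>(w, x). b w * f x)"
    using b f by (intro Fubini_integrable) (auto simp: norm_mult)
  then show i: "integrable (M1 \<Otimes>\<^sub>M M2) (l2_tensor b f)"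
    by (simp add: l2_tensor_def case_prod_unfold)
  show "(LINT p|(M1 \<Otimes>\<^sub>M M2). l2_tensor b f p) = (LINT w|M1. b w) * (LINT x|M2. f x)"
    using integral_fst'[OF i] by (simp add: l2_tensor_def)
qed

lemma l2_tensor_L2:
  assumes "b \<in> L2 M1" "f \<in> L2 M2"
  shows "l2_tensor b f \<in> L2 (M1 \<Otimes>\<^sub>M M2)"
proof -
  note [measurable] = L2_D(1)[OF assms(1)] L2_D(1)[OF assms(2)]
  have "integrable (M1 \<Otimes>\<^sub>M M2) (l2_tensor (\<lambda>w. b w * cnj (b w)) (\<lambda>x. f x * cnj (f x)))"
    using assms by (intro l2_tensor_integral L2_mult_integrable)
  from integrable_norm[OF this] have "integrable (M1 \<Otimes>\<^sub>M M2) (\<lambda>p. (cmod (l2_tensor b f p))\<^sup>2)"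
    by (simp add: l2_tensor_def norm_mult power2_eq_square mult_ac)
  moreover have "l2_tensor b f \<in> borel_measurable (M1 \<Otimes>\<^sub>M M2)"
    unfolding l2_tensor_def by measurable
  ultimately show ?thesis by (simp add: L2_def)
qed

lemma l2_tensor_inner:
  assumes "b \<in> L2 M1" "c \<in> L2 M1" "f \<in> L2 M2" "g \<in> L2 M2"
  shows "l2_inner (M1 \<Otimes>\<^sub>M M2) (l2_tensor b f) (l2_tensor c g) = l2_inner M1 b c * l2_inner M2 f g"
proof -
  have "l2_inner (M1 \<Otimes>\<^sub>M M2) (l2_tensor b f) (l2_tensor c g)
      = (LINT p|(M1 \<Otimes>\<^sub>M M2). l2_tensor (\<lambda>w. b w * cnj (c w)) (\<lambda>x. f x * cnj (g x)) p)"
    by (simp add: l2_inner_def l2_tensor_def mult_ac)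
  also have "\<dots> = l2_inner M1 b c * l2_inner M2 f g"
    using assms by (subst l2_tensor_integral(2)) (auto simp: l2_inner_def L2_mult_integrable)
  finally show ?thesis .
qed

lemma L2_slice_AE:
  assumes "h \<in> L2 (M1 \<Otimes>\<^sub>M M2)"
  shows "AE w in M1. (\<lambda>x. h (w, x)) \<in> L2 M2"
proof -
  have "AE w in M1. integrable M2 (\<lambda>x. (cmod (h (w, x)))\<^sup>2)"
    using AE_integrable_fst'[OF L2_D(2)[OF assms]] .
  then show ?thesis using AE_space
    by eventually_elim (auto simp: L2_def intro!: measurable_compose[OF measurable_Pair1' L2_D(1)[OF assms]])
qed

end

locale tiled_action = quasi_invariant_action T M \<sigma> J + random_char T \<Omega> \<Gamma> \<xi>
  for T :: "('g, 'm) monoid_scheme" (structure) and M :: "'x measure" and \<sigma> J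
    and \<Omega> :: "'w measure" and \<Gamma> \<xi> +
  fixes C :: "'x set"
  assumes countable_\<Gamma>: "countable \<Gamma>"
    and tile_sets: "C \<in> sets M"
    and tile_cover: "AE x in M. \<exists>!a. a \<in> \<Gamma> \<and> x \<in> \<sigma> a ` C"
begin

sublocale pair: pair_sigma_finite \<Omega> M ..

lemma \<Gamma>_carrier: "a \<in> \<Gamma> \<Longrightarrow> a \<in> carrier T" by simp

definition cut :: "'g \<Rightarrow> ('x \<Rightarrow> complex) \<Rightarrow> 'x \<Rightarrow> complex" where
  "cut a f = (\<lambda>x. indicator (\<sigma> a ` C) x * f x)"

text \<open>The piece of \<open>f\<close> on the translate of the tile \<open>C\<close> by
  \<open>a\<close>, moved back to \<open>C\<close>; see \<open>coef_eq_rep_cut\<close>. These are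
  the coefficients of the Fourier series defining the Zak transform.\<close>

definition coef :: "'g \<Rightarrow> ('x \<Rightarrow> complex) \<Rightarrow> 'x \<Rightarrow> complex" where
  "coef a f = (\<lambda>x. indicator C x * \<rho> (inv a) f x)"

definition fourier_sum :: "'g set \<Rightarrow> ('x \<Rightarrow> complex) \<Rightarrow> 'w \<times> 'x \<Rightarrow> complex" where
  "fourier_sum A f = (\<Sum>a\<in>A. l2_tensor (\<xi> a) (coef a f))"

lemma L2_indicator_mult: "A \<in> sets M \<Longrightarrow> f \<in> L2 M \<Longrightarrow> (\<lambda>x. indicator A x * f x) \<in> L2 M"
proof -
  assume A: "A \<in> sets M" and f: "f \<in> L2 M"
  have "integrable M (\<lambda>x. indicator A x *\<^sub>R (cmod (f x))\<^sup>2)"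
    by (rule integrable_mult_indicator[OF A L2_D(2)[OF f]])
  moreover have "(\<lambda>x. indicator A x *\<^sub>R (cmod (f x))\<^sup>2) = (\<lambda>x. (cmod (indicator A x * f x))\<^sup>2)"
    by (auto simp: indicator_def)
  ultimately show ?thesis
    using A L2_D(1)[OF f] by (simp add: L2_def)
qed

lemma cut_L2: "a \<in> carrier T \<Longrightarrow> f \<in> L2 M \<Longrightarrow> cut a f \<in> L2 M"
  unfolding cut_def by (intro L2_indicator_mult \<sigma>_image_sets tile_sets)

lemma coef_L2: "a \<in> carrier T \<Longrightarrow> f \<in> L2 M \<Longrightarrow> coef a f \<in> L2 M"
  unfolding coef_def by (intro L2_indicator_mult rep_L2 tile_sets) auto

lemma coef_eq_rep_cut:
  assumes "a \<in> carrier T" "x \<in> space M"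
  shows "coef a f x = \<rho> (inv a) (cut a f) x"
proof -
  have "\<sigma> a x \<in> \<sigma> a ` C \<longleftrightarrow> x \<in> C"
    using assms sets.sets_into_space[OF tile_sets] by (subst \<sigma>_image) (auto simp: \<sigma>_inv \<sigma>_space)
  then show ?thesis using assms by (simp add: coef_def cut_def rep_def indicator_def)
qed

lemma coef_inner:
  assumes a: "a \<in> \<Gamma>" and c: "c \<in> \<Gamma>" and f: "f \<in> L2 M" "g \<in> L2 M"
  shows "l2_inner M (coef a f) (coef (c \<otimes> a) g) = l2_inner M (cut a f) (\<rho> (inv c) g)"
proof -
  note ca = \<Gamma>_carrier[OF a] \<Gamma>_carrier[OF c]
  have "l2_inner M (coef a f) (coef (c \<otimes> a) g) = l2_inner M (coef a f) (\<rho> (inv (c \<otimes> a)) g)"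
    unfolding l2_inner_def
    by (rule Bochner_Integration.integral_cong[OF refl]) (simp add: coef_def indicator_def)
  also have "\<dots> = l2_inner M (\<rho> (inv a) (cut a f)) (\<rho> (inv a) (\<rho> (inv c) g))"
  proof (rule l2_inner_cong_AE)
    show "AE x in M. coef a f x = \<rho> (inv a) (cut a f) x"
      using ca coef_eq_rep_cut by (intro AE_I2) auto
    have "AE x in M. \<rho> (inv a) (\<rho> (inv c) g) x = \<rho> (inv a \<otimes> inv c) g x"
      using ca by (intro rep_mult_AE) auto
    then show "AE x in M. \<rho> (inv (c \<otimes> a)) g x = \<rho> (inv a) (\<rho> (inv c) g) x"
      using ca by (simp add: inv_mult_group eq_commute)
  qed (use ca f in \<open>auto intro!: coef_L2 rep_L2 cut_L2\<close>)
  also have "\<dots> = l2_inner M (cut a f) (\<rho> (inv c) g)"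
    using ca f by (intro rep_inner rep_L2 cut_L2) auto
  finally show ?thesis .
qed

lemma \<xi>_L2: "a \<in> \<Gamma> \<Longrightarrow> \<xi> a \<in> L2 \<Omega>"
  by (simp add: L2_def \<xi>_measurable norm_\<xi>)

definition modulate :: "('w \<Rightarrow> complex) \<Rightarrow> ('w \<times> 'x \<Rightarrow> complex) \<Rightarrow> 'w \<times> 'x \<Rightarrow> complex" where
  "modulate b h = (\<lambda>p. b (fst p) * h p)"

lemma modulate_\<xi>_L2: "c \<in> \<Gamma> \<Longrightarrow> h \<in> L2 (\<Omega> \<Otimes>\<^sub>M M) \<Longrightarrow> modulate (\<xi> c) h \<in> L2 (\<Omega> \<Otimes>\<^sub>M M)"
  using \<xi>_measurable[of c] by (auto simp: modulate_def L2_def norm_mult norm_\<xi>)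

lemma fourier_sum_L2: "A \<subseteq> \<Gamma> \<Longrightarrow> f \<in> L2 M \<Longrightarrow> fourier_sum A f \<in> L2 (\<Omega> \<Otimes>\<^sub>M M)"
  unfolding fourier_sum_def by (intro L2_sum pair.l2_tensor_L2 \<xi>_L2 coef_L2) auto

text \<open>Modulation by \<open>\<xi> c\<close> shifts the index \<open>a\<close> to
  \<open>c \<otimes> a\<close>, and orthonormality of the characters keeps only the pairs with
  \<open>b = c \<otimes> a\<close>.\<close>

lemma fourier_sum_inner:
  assumes A: "finite A" "A \<subseteq> \<Gamma>" and B: "finite B" "B \<subseteq> \<Gamma>" and c: "c \<in> \<Gamma>"
    and f: "f \<in> L2 M" "g \<in> L2 M"
  shows "l2_inner (\<Omega> \<Otimes>\<^sub>M M) (modulate (\<xi> c) (fourier_sum A f)) (fourier_sum B g)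
    = (\<Sum>a\<in>{a\<in>A. c \<otimes> a \<in> B}. l2_inner M (cut a f) (\<rho> (inv c) g))"
proof -
  let ?I = "l2_inner (\<Omega> \<Otimes>\<^sub>M M)"
  have eq: "modulate (\<xi> c) (fourier_sum A f) = (\<Sum>a\<in>A. l2_tensor (\<xi> (c \<otimes> a)) (coef a f))"
    using A c by (auto simp: modulate_def fourier_sum_def l2_tensor_def fun_eq_iff sum_fun_apply
        sum_distrib_left \<xi>_mult subset_iff mult.assoc intro!: sum.cong)
  have "?I (modulate (\<xi> c) (fourier_sum A f)) (fourier_sum B g)
      = (\<Sum>a\<in>A. \<Sum>b\<in>B. ?I (l2_tensor (\<xi> (c \<otimes> a)) (coef a f)) (l2_tensor (\<xi> b) (coef b g)))"
    unfolding eq unfolding fourier_sum_def using A B c f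
    by (subst l2_inner_sum_left)
      (auto intro!: sum.cong L2_sum pair.l2_tensor_L2 \<xi>_L2 coef_L2 l2_inner_sum_right)
  also have "\<dots> = (\<Sum>a\<in>A. \<Sum>b\<in>B. if b = c \<otimes> a then l2_inner M (cut a f) (\<rho> (inv c) g) else 0)"
  proof (intro sum.cong refl)
    fix a b assume ab: "a \<in> A" "b \<in> B"
    then have G: "a \<in> \<Gamma>" "b \<in> \<Gamma>" using A B by auto
    have "?I (l2_tensor (\<xi> (c \<otimes> a)) (coef a f)) (l2_tensor (\<xi> b) (coef b g))
        = l2_inner \<Omega> (\<xi> (c \<otimes> a)) (\<xi> b) * l2_inner M (coef a f) (coef b g)"
      using G c f by (intro pair.l2_tensor_inner \<xi>_L2 coef_L2) auto
    then show "?I (l2_tensor (\<xi> (c \<otimes> a)) (coef a f)) (l2_tensor (\<xi> b) (coef b g))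
        = (if b = c \<otimes> a then l2_inner M (cut a f) (\<rho> (inv c) g) else 0)"
      using \<xi>_orthonormal[of "c \<otimes> a" b] G c coef_inner[OF G(1) c f] by (auto simp: l2_inner_def)
  qed
  also have "\<dots> = (\<Sum>a\<in>A. if c \<otimes> a \<in> B then l2_inner M (cut a f) (\<rho> (inv c) g) else 0)"
    using B by (intro sum.cong refl) (simp add: sum.delta')
  also have "\<dots> = (\<Sum>a\<in>{a\<in>A. c \<otimes> a \<in> B}. l2_inner M (cut a f) (\<rho> (inv c) g))"
    using A by (simp add: sum.inter_filter)
  finally show ?thesis .
qed

text \<open>Almost every point lies in exactly one translate of the tile, so the partial sums are
  eventually equal to \<open>f x\<close>. General sets \<open>A n\<close> are allowed because
  \<open>zak_inner\<close> intersects with a shifted copy.\<close>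

lemma cut_sum_tendsto:
  assumes f: "f \<in> L2 M" "g \<in> L2 M" and A: "\<And>n. finite (A n)" "\<And>n. A n \<subseteq> \<Gamma>"
    and ev: "\<And>a. a \<in> \<Gamma> \<Longrightarrow> \<forall>\<^sub>F n in sequentially. a \<in> A n"
  shows "(\<lambda>n. \<Sum>a\<in>A n. l2_inner M (cut a f) g) \<longlonglongrightarrow> l2_inner M f g"
proof -
  have "(\<Sum>a\<in>A n. l2_inner M (cut a f) g) = l2_inner M (\<Sum>a\<in>A n. cut a f) g" for n
    using f A by (intro l2_inner_sum_left[symmetric] cut_L2) auto
  moreover have "(\<lambda>n. l2_inner M (\<Sum>a\<in>A n. cut a f) g) \<longlonglongrightarrow> l2_inner M f g"
    unfolding l2_inner_def
  proof (rule integral_dominated_convergence[where w="\<lambda>x. cmod (f x * cnj (g x))"])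
    have L: "(\<Sum>a\<in>A n. cut a f) \<in> L2 M" for n using f A by (intro L2_sum cut_L2) auto
    show "(\<lambda>x. f x * cnj (g x)) \<in> borel_measurable M"
      "(\<lambda>x. (\<Sum>a\<in>A n. cut a f) x * cnj (g x)) \<in> borel_measurable M" for n
      using f L by (auto intro!: borel_measurable_integrable L2_mult_integrable)
    show "integrable M (\<lambda>x. cmod (f x * cnj (g x)))"
      using f by (intro integrable_norm L2_mult_integrable)
    have one: "(\<Sum>a\<in>A n. cut a f) x = (if b \<in> A n then f x else 0)"
      if b: "b \<in> \<Gamma>" "x \<in> \<sigma> b ` C" and u: "\<exists>!a. a \<in> \<Gamma> \<and> x \<in> \<sigma> a ` C" for n x b
    proof -
      have "(\<Sum>a\<in>A n. cut a f) x = (\<Sum>a\<in>A n. if a = b then f x else 0)"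
        unfolding sum_fun_apply using b u A(2)[of n]
        by (intro sum.cong refl) (auto simp: cut_def indicator_def)
      then show ?thesis using A(1) by simp
    qed
    show "AE x in M. (\<lambda>n. (\<Sum>a\<in>A n. cut a f) x * cnj (g x)) \<longlonglongrightarrow> f x * cnj (g x)"
      using tile_cover
    proof eventually_elim
      case (elim x)
      then obtain b where b: "b \<in> \<Gamma>" "x \<in> \<sigma> b ` C" by blast
      show ?case
        by (rule tendsto_eventually, rule eventually_mono[OF ev[OF b(1)]]) (simp add: one[OF b elim])
    qed
    show "AE x in M. cmod ((\<Sum>a\<in>A n. cut a f) x * cnj (g x)) \<le> cmod (f x * cnj (g x))" for n
      using tile_cover
    proof eventually_elim
      case (elim x)
      then obtain b where b: "b \<in> \<Gamma>" "x \<in> \<sigma> b ` C" by blast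
      show ?case by (simp add: one[OF b elim])
    qed
  qed
  ultimately show ?thesis by simp
qed

definition initial :: "nat \<Rightarrow> 'g set" where
  "initial n = {a \<in> \<Gamma>. to_nat_on \<Gamma> a < n}"

lemma initial: "finite (initial n)" "initial n \<subseteq> \<Gamma>" "a \<in> \<Gamma> \<Longrightarrow> \<forall>\<^sub>F n in sequentially. a \<in> initial n"
  "m \<le> n \<Longrightarrow> initial m \<subseteq> initial n"
proof -
  have "finite (to_nat_on \<Gamma> ` initial n)"
    by (rule finite_subset[of _ "{..<n}"]) (auto simp: initial_def)
  then show "finite (initial n)"
    by (rule finite_imageD) (auto simp: initial_def intro: inj_on_subset[OF inj_on_to_nat_on[OF countable_\<Gamma>]])
qed (auto simp: initial_def intro: eventually_gt_at_top)

text \<open>Inner products of partial sums depend only on the smaller index, so squared distances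
  are bounded by increments of the convergent real sequence \<open>t\<close>.\<close>

lemma fourier_sum_convergent:
  assumes f: "f \<in> L2 M"
  shows "\<exists>h\<in>L2 (\<Omega> \<Otimes>\<^sub>M M). (\<lambda>n. l2_norm (\<Omega> \<Otimes>\<^sub>M M) (fourier_sum (initial n) f - h)) \<longlonglongrightarrow> 0"
proof -
  let ?N = "\<Omega> \<Otimes>\<^sub>M M" and ?s = "\<lambda>n. fourier_sum (initial n) f"
  have sf: "sigma_finite_measure ?N" by (rule pair.P.sigma_finite_measure_axioms)
  have sL: "?s n \<in> L2 ?N" for n by (rule fourier_sum_L2[OF initial(2) f])
  define t where "t n = Re (\<Sum>a\<in>initial n. l2_inner M (cut a f) f)" for n
  have inner: "l2_inner ?N (?s n) (?s m) = (\<Sum>a\<in>initial (min n m). l2_inner M (cut a f) f)" for n m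
  proof -
    have "{a \<in> initial n. \<one> \<otimes> a \<in> initial m} = initial (min n m)" by (auto simp: initial_def)
    moreover have "modulate (\<xi> \<one>) (?s n) = ?s n" by (simp add: modulate_def \<xi>_one)
    moreover have "l2_inner M (cut a f) (\<rho> (inv \<one>) f) = l2_inner M (cut a f) f" if "a \<in> initial k" for a k
      using that initial(2)[of k] f rep_one_AE[of f]
      by (intro l2_inner_cong_AE) (auto simp: cut_L2 rep_L2 subset_iff)
    ultimately show ?thesis
      using fourier_sum_inner[OF initial(1) initial(2) initial(1) initial(2) \<Gamma>_ops(1) f f, of n m] by simp
  qed
  have nd: "(l2_norm ?N (?s n - ?s m))\<^sup>2 = t n + t m - 2 * t (min n m)" for n m
    unfolding l2_norm_sq_diff[OF sL sL] by (simp add: l2_norm_sq_Re inner t_def)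
  have "t \<longlonglongrightarrow> Re (l2_inner M f f)"
    unfolding t_def by (intro tendsto_Re cut_sum_tendsto f initial)
  then have tc: "Cauchy t" using convergent_Cauchy convergentI by blast
  have "\<exists>K. \<forall>i\<ge>K. \<forall>j\<ge>K. l2_norm ?N (?s i - ?s j) < e" if e: "0 < e" for e
  proof -
    obtain K where K: "\<And>m n. m \<ge> K \<Longrightarrow> n \<ge> K \<Longrightarrow> \<bar>t m - t n\<bar> < e\<^sup>2"
      using metric_CauchyD[OF tc, of "e\<^sup>2"] e by (auto simp: dist_real_def)
    have "l2_norm ?N (?s i - ?s j) < e" if "i \<ge> K" "j \<ge> K" for i j
    proof (rule power2_less_imp_less)
      have "t i + t j - 2 * t (min i j) \<le> \<bar>t i - t j\<bar>" by (auto simp: min_def)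
      then show "(l2_norm ?N (?s i - ?s j))\<^sup>2 < e\<^sup>2" using K[OF that] by (simp add: nd)
    qed (use e in simp)
    then show ?thesis by blast
  qed
  then obtain h where "h \<in> L2 ?N" "(\<lambda>n. l2_norm ?N (?s n - h)) \<longlonglongrightarrow> 0"
    by (rule l2_complete[OF sf sL])
  then show ?thesis by blast
qed

text \<open>The limit is determined only up to null functions, so linearity and the like hold almost
  everywhere and are derived for the bracket instead.\<close>

definition zak :: "('x \<Rightarrow> complex) \<Rightarrow> 'w \<times> 'x \<Rightarrow> complex" where
  "zak f = (SOME h. h \<in> L2 (\<Omega> \<Otimes>\<^sub>M M) \<and>
     (\<lambda>n. l2_norm (\<Omega> \<Otimes>\<^sub>M M) (fourier_sum (initial n) f - h)) \<longlonglongrightarrow> 0)"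

lemma zak:
  assumes "f \<in> L2 M"
  shows "zak f \<in> L2 (\<Omega> \<Otimes>\<^sub>M M)" "(\<lambda>n. l2_norm (\<Omega> \<Otimes>\<^sub>M M) (fourier_sum (initial n) f - zak f)) \<longlonglongrightarrow> 0"
proof -
  have "zak f \<in> L2 (\<Omega> \<Otimes>\<^sub>M M) \<and> (\<lambda>n. l2_norm (\<Omega> \<Otimes>\<^sub>M M) (fourier_sum (initial n) f - zak f)) \<longlonglongrightarrow> 0"
    unfolding zak_def
    using fourier_sum_convergent[OF assms] someI_ex[of "\<lambda>h. h \<in> L2 (\<Omega> \<Otimes>\<^sub>M M) \<and>
      (\<lambda>n. l2_norm (\<Omega> \<Otimes>\<^sub>M M) (fourier_sum (initial n) f - h)) \<longlonglongrightarrow> 0"]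
    by blast
  then show "zak f \<in> L2 (\<Omega> \<Otimes>\<^sub>M M)" "(\<lambda>n. l2_norm (\<Omega> \<Otimes>\<^sub>M M) (fourier_sum (initial n) f - zak f)) \<longlonglongrightarrow> 0"
    by auto
qed

text \<open>Both sides are limits of the inner products of partial sums; the indices
  \<open>a\<close> with \<open>a\<close> and \<open>c \<otimes> a\<close> in
  \<open>initial n\<close> still exhaust \<open>\<Gamma>\<close>.\<close>

lemma zak_inner:
  assumes f: "f \<in> L2 M" "g \<in> L2 M" and c: "c \<in> \<Gamma>"
  shows "l2_inner (\<Omega> \<Otimes>\<^sub>M M) (modulate (\<xi> c) (zak f)) (zak g) = l2_inner M (\<rho> c f) g"
proof (rule LIMSEQ_unique)
  let ?N = "\<Omega> \<Otimes>\<^sub>M M" and ?s = "\<lambda>f n. fourier_sum (initial n) f"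
  have "modulate (\<xi> c) h - modulate (\<xi> c) h' = modulate (\<xi> c) (h - h')" for h h'
    by (auto simp: modulate_def algebra_simps)
  moreover have "l2_norm ?N (modulate (\<xi> c) h) = l2_norm ?N h" for h
    by (simp add: modulate_def l2_norm_def norm_mult norm_\<xi>)
  ultimately show "(\<lambda>n. l2_inner ?N (modulate (\<xi> c) (?s f n)) (?s g n)) \<longlonglongrightarrow> l2_inner ?N (modulate (\<xi> c) (zak f)) (zak g)"
    using f c by (intro l2_inner_tendsto modulate_\<xi>_L2 fourier_sum_L2 zak initial) (simp_all add: zak)
  have "(\<lambda>n. \<Sum>a\<in>{a\<in>initial n. c \<otimes> a \<in> initial n}. l2_inner M (cut a f) (\<rho> (inv c) g))
      \<longlonglongrightarrow> l2_inner M f (\<rho> (inv c) g)"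
  proof (rule cut_sum_tendsto)
    show "\<forall>\<^sub>F n in sequentially. a \<in> {a \<in> initial n. c \<otimes> a \<in> initial n}" if "a \<in> \<Gamma>" for a
      using eventually_conj[OF initial(3)[OF that] initial(3)[of "c \<otimes> a"]] that c by simp
  qed (use f c initial in \<open>auto simp: rep_L2 subset_iff\<close>)
  then show "(\<lambda>n. l2_inner ?N (modulate (\<xi> c) (?s f n)) (?s g n)) \<longlonglongrightarrow> l2_inner M (\<rho> c f) g"
    using f c by (simp add: fourier_sum_inner initial rep_adjoint)
qed

text \<open>Slices are square-integrable only for almost every \<open>w\<close>; elsewhere the value
  is whatever the integral returns, and is irrelevant up to a null set.\<close>

definition bracket :: "('x \<Rightarrow> complex) \<Rightarrow> ('x \<Rightarrow> complex) \<Rightarrow> 'w \<Rightarrow> complex" where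
  "bracket f g w = l2_inner M (\<lambda>x. zak f (w, x)) (\<lambda>x. zak g (w, x))"

lemma bracket_cnj: "cnj (bracket f g w) = bracket g f w"
  by (simp add: bracket_def l2_inner_cnj)

lemma bracket_self: "bracket f f w = of_real (Re (bracket f f w))" "0 \<le> Re (bracket f f w)"
  by (simp_all add: bracket_def l2_inner_self)

lemma bracket_integrable:
  assumes "f \<in> L2 M" "g \<in> L2 M"
  shows "integrable \<Omega> (bracket f g)"
  using pair.integrable_fst'[OF L2_mult_integrable[OF zak(1)[OF assms(1)] zak(1)[OF assms(2)]]]
  by (simp add: bracket_def[abs_def] l2_inner_def)

lemma bracket_fourier:
  assumes f: "f \<in> L2 M" "g \<in> L2 M" and c: "c \<in> \<Gamma>"
  shows "(LINT w|\<Omega>. \<xi> c w * bracket f g w) = l2_inner M (\<rho> c f) g"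
proof -
  have "(LINT w|\<Omega>. \<xi> c w * bracket f g w)
      = (LINT w|\<Omega>. LINT x|M. modulate (\<xi> c) (zak f) (w, x) * cnj (zak g (w, x)))"
    by (simp add: bracket_def l2_inner_def modulate_def mult.assoc)
  also have "\<dots> = l2_inner M (\<rho> c f) g"
    using f c
    by (subst pair.integral_fst')
      (auto simp: zak modulate_\<xi>_L2 L2_mult_integrable simp flip: zak_inner l2_inner_def)
  finally show ?thesis .
qed

lemma bracket_cauchy_schwarz:
  assumes f: "f \<in> L2 M" "g \<in> L2 M"
  shows "AE w in \<Omega>. (cmod (bracket f g w))\<^sup>2 \<le> Re (bracket f f w) * Re (bracket g g w)"
  using pair.L2_slice_AE[OF zak(1)[OF f(1)]] pair.L2_slice_AE[OF zak(1)[OF f(2)]]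
proof eventually_elim
  case (elim w)
  have "(cmod (bracket f g w))\<^sup>2 \<le> (l2_norm M (\<lambda>x. zak f (w, x)) * l2_norm M (\<lambda>x. zak g (w, x)))\<^sup>2"
    unfolding bracket_def by (intro power_mono l2_cauchy_schwarz elim) simp
  then show ?case by (simp add: power_mult_distrib bracket_def l2_norm_sq_Re)
qed

end

section \<open>Multiplication on the dual side and Gram-Schmidt\<close>

lemma generated_space_closed:
  assumes "A \<subseteq> L2 M" "\<And>h f. h \<in> H \<Longrightarrow> f \<in> L2 M \<Longrightarrow> rep T \<sigma> J h f \<in> L2 M"
  shows "l2_closed_subspace M (generated_space T M \<sigma> J H A)"
    and "\<And>h \<phi>. h \<in> H \<Longrightarrow> \<phi> \<in> A \<Longrightarrow> rep T \<sigma> J h \<phi> \<in> generated_space T M \<sigma> J H A"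
proof -
  have S: "{rep T \<sigma> J h \<phi> |h \<phi>. h \<in> H \<and> \<phi> \<in> A} \<subseteq> L2 M" using assms by auto
  show "l2_closed_subspace M (generated_space T M \<sigma> J H A)"
    "\<And>h \<phi>. h \<in> H \<Longrightarrow> \<phi> \<in> A \<Longrightarrow> rep T \<sigma> J h \<phi> \<in> generated_space T M \<sigma> J H A"
    unfolding generated_space_def using l2_closed_subspace_span_closure[OF S] by auto
qed

section \<open>Generated spaces and the calculus of the bracket\<close>

context tiled_action
begin

abbreviation gen_space :: "('x \<Rightarrow> complex) set \<Rightarrow> ('x \<Rightarrow> complex) set" where
  "gen_space \<equiv> generated_space T M \<sigma> J \<Gamma>"

abbreviation inv_space :: "'g set \<Rightarrow> ('x \<Rightarrow> complex) set \<Rightarrow> bool" where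
  "inv_space \<equiv> invariant_space T M \<sigma> J"

lemma inv_spaceD:
  assumes "inv_space H V"
  shows "l2_closed_subspace M V" "V \<subseteq> L2 M" "h \<in> H \<Longrightarrow> f \<in> V \<Longrightarrow> \<rho> h f \<in> V" "cfun.subspace V"
  using assms l2_closed_subspaceD by (auto simp: invariant_space_def)

lemma rep_commute_AE:
  assumes "g \<in> carrier T" "h \<in> carrier T"
  shows "AE x in M. \<rho> g (\<rho> h f) x = \<rho> h (\<rho> g f) x"
  using rep_mult_AE[OF assms, of f] rep_mult_AE[OF assms(2,1), of f]
  by eventually_elim (simp add: m_comm assms)

text \<open>Closedness holds because \<open>\<rho> g\<close> is linear and isometric. It reduces
  invariance of a generated space to a check on generators.\<close>

lemma closed_rep_preimage:
  assumes V: "l2_closed_subspace M V" and g: "g \<in> carrier T"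
  shows "l2_closed_subspace M {f \<in> L2 M. \<rho> g f \<in> V}"
proof (rule l2_closed_subspaceI)
  note ops = cfun_subspace_ops[OF l2_closed_subspaceD(2)[OF V]]
  show "cfun.subspace {f \<in> L2 M. \<rho> g f \<in> V}"
    by (auto simp: cfun.subspace_def L2_intros rep_zero rep_add rep_scale ops)
  fix f assume f: "f \<in> L2 M" "\<And>e. 0 < e \<Longrightarrow> \<exists>k\<in>{f \<in> L2 M. \<rho> g f \<in> V}. l2_norm M (f - k) < e"
  have "\<rho> g f \<in> V"
  proof (rule l2_closed_subspace_approx[OF V rep_L2[OF g f(1)]])
    fix e :: real assume "0 < e"
    then obtain k where k: "k \<in> L2 M" "\<rho> g k \<in> V" "l2_norm M (f - k) < e" using f(2) by blast
    then show "\<exists>k\<in>V. l2_norm M (\<rho> g f - k) < e"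
      using rep_norm[OF g L2_diff[OF f(1) k(1)]] by (intro bexI[of _ "\<rho> g k"]) (simp_all flip: rep_diff)
  qed
  with f(1) show "f \<in> {f \<in> L2 M. \<rho> g f \<in> V}" by simp
qed auto

lemma gen_space_closed: "A \<subseteq> L2 M \<Longrightarrow> l2_closed_subspace M (gen_space A)"
  by (rule generated_space_closed(1)) (simp_all add: rep_L2)

lemma gen_space_rep: "A \<subseteq> L2 M \<Longrightarrow> c \<in> \<Gamma> \<Longrightarrow> \<phi> \<in> A \<Longrightarrow> \<rho> c \<phi> \<in> gen_space A"
  by (rule generated_space_closed(2)) (simp_all add: rep_L2)

lemma gen_space_incl:
  assumes "A \<subseteq> L2 M" "\<phi> \<in> A"
  shows "\<phi> \<in> gen_space A"
  using assms rep_one_AE[of \<phi>]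
  by (intro l2_closed_subspace_AE[OF gen_space_closed gen_space_rep[OF _ \<Gamma>_ops(1)]]) (auto simp: eq_commute)

lemma gen_space_subset:
  assumes A: "A \<subseteq> L2 M" and V: "l2_closed_subspace M V"
    and "\<And>c \<phi>. c \<in> \<Gamma> \<Longrightarrow> \<phi> \<in> A \<Longrightarrow> \<rho> c \<phi> \<in> V"
  shows "gen_space A \<subseteq> V"
  unfolding generated_space_def by (rule l2_closure_span_minimal[OF _ V]) (use assms in auto)

text \<open>The group is abelian, so \<open>\<rho> d\<close> moves past the translations by
  \<open>\<Gamma>\<close> that produce the space from its generators.\<close>

lemma gen_space_invariant_of_generators:
  assumes A: "A \<subseteq> L2 M" and d: "d \<in> carrier T" and gens: "\<And>\<phi>. \<phi> \<in> A \<Longrightarrow> \<rho> d \<phi> \<in> gen_space A"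
    and inv: "\<And>c f. c \<in> \<Gamma> \<Longrightarrow> f \<in> gen_space A \<Longrightarrow> \<rho> c f \<in> gen_space A"
    and f: "f \<in> gen_space A"
  shows "\<rho> d f \<in> gen_space A"
proof -
  have "gen_space A \<subseteq> {f \<in> L2 M. \<rho> d f \<in> gen_space A}"
  proof (rule gen_space_subset[OF A closed_rep_preimage[OF gen_space_closed[OF A] d]])
    fix c \<phi> assume c: "c \<in> \<Gamma>" and \<phi>: "\<phi> \<in> A"
    have L: "\<phi> \<in> L2 M" "\<rho> c \<phi> \<in> L2 M" using A \<phi> c by (auto intro: rep_L2)
    have "\<rho> d (\<rho> c \<phi>) \<in> gen_space A"
      by (rule l2_closed_subspace_AE[OF gen_space_closed[OF A] inv[OF c gens[OF \<phi>]] rep_L2[OF d L(2)]])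
        (rule rep_commute_AE[OF d \<Gamma>_carrier[OF c]])
    with L show "\<rho> c \<phi> \<in> {f \<in> L2 M. \<rho> d f \<in> gen_space A}" by simp
  qed
  with f show ?thesis by blast
qed

lemma gen_space_\<Gamma>_invariant:
  assumes A: "A \<subseteq> L2 M"
  shows "inv_space \<Gamma> (gen_space A)"
proof -
  have "\<rho> d f \<in> gen_space A" if d: "d \<in> \<Gamma>" and f: "f \<in> gen_space A" for d f
  proof -
    have "gen_space A \<subseteq> {f \<in> L2 M. \<rho> d f \<in> gen_space A}"
    proof (rule gen_space_subset[OF A closed_rep_preimage[OF gen_space_closed[OF A] \<Gamma>_carrier[OF d]]])
      fix c \<phi> assume c: "c \<in> \<Gamma>" and \<phi>: "\<phi> \<in> A"
      have L: "\<phi> \<in> L2 M" "\<rho> c \<phi> \<in> L2 M" using A \<phi> c by (auto intro: rep_L2)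
      have "\<rho> d (\<rho> c \<phi>) \<in> gen_space A"
        by (rule l2_closed_subspace_AE[OF gen_space_closed[OF A] gen_space_rep[OF A \<Gamma>_ops(2)[OF d c] \<phi>]
              rep_L2[OF \<Gamma>_carrier[OF d] L(2)] rep_mult_AE[OF \<Gamma>_carrier[OF d] \<Gamma>_carrier[OF c]]])
      with L show "\<rho> c \<phi> \<in> {f \<in> L2 M. \<rho> d f \<in> gen_space A}" by simp
    qed
    with f show ?thesis by blast
  qed
  with gen_space_closed[OF A] show ?thesis by (simp add: invariant_space_def)
qed

lemma gen_space_invariant:
  assumes A: "A \<subseteq> L2 M" and H: "H \<subseteq> carrier T"
    and gens: "\<And>d \<phi>. d \<in> H \<Longrightarrow> \<phi> \<in> A \<Longrightarrow> \<rho> d \<phi> \<in> gen_space A"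
  shows "inv_space H (gen_space A)"
  unfolding invariant_space_def
proof (intro conjI ballI)
  fix d f assume d: "d \<in> H" and f: "f \<in> gen_space A"
  have "d \<in> carrier T" using d H by blast
  from A this gens[OF d] inv_spaceD(3)[OF gen_space_\<Gamma>_invariant[OF A]] f show "\<rho> d f \<in> gen_space A"
    by (rule gen_space_invariant_of_generators)
qed (rule gen_space_closed[OF A])

text \<open>Uniqueness of Fourier coefficients. Every further rule for the bracket is verified on
  coefficients, where it becomes a fact about inner products, without touching
  \<open>zak\<close>.\<close>

lemma bracket_eqI:
  assumes f: "f \<in> L2 M" "g \<in> L2 M" and F: "integrable \<Omega> F"
    and eq: "\<And>c. c \<in> \<Gamma> \<Longrightarrow> (LINT w|\<Omega>. \<xi> c w * F w) = l2_inner M (\<rho> c f) g"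
  shows "AE w in \<Omega>. bracket f g w = F w"
proof -
  have "AE w in \<Omega>. bracket f g w - F w = 0"
  proof (rule fourier_unique)
    show "integrable \<Omega> (\<lambda>w. bracket f g w - F w)" using F bracket_integrable[OF f] by simp
    fix c assume c: "c \<in> \<Gamma>"
    show "(LINT w|\<Omega>. \<xi> c w * (bracket f g w - F w)) = 0"
      using c eq bracket_fourier[OF f] integrable_\<xi>_mult[OF c bracket_integrable[OF f]] integrable_\<xi>_mult[OF c F]
      by (simp add: right_diff_distrib)
  qed
  then show ?thesis by simp
qed

lemma bracket_add_left:
  assumes "f \<in> L2 M" "f' \<in> L2 M" "g \<in> L2 M"
  shows "AE w in \<Omega>. bracket (f + f') g w = bracket f g w + bracket f' g w"
proof (rule bracket_eqI)
  fix c assume c: "c \<in> \<Gamma>"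
  show "(LINT w|\<Omega>. \<xi> c w * (bracket f g w + bracket f' g w)) = l2_inner M (\<rho> c (f + f')) g"
    using assms c
    by (simp add: ring_distribs bracket_fourier rep_add l2_inner_add_left rep_L2
        integrable_\<xi>_mult bracket_integrable)
qed (use assms in \<open>auto intro: L2_add bracket_integrable\<close>)

lemma bracket_scale_left:
  assumes "f \<in> L2 M" "g \<in> L2 M"
  shows "AE w in \<Omega>. bracket (cfun_scale k f) g w = k * bracket f g w"
proof (rule bracket_eqI)
  fix c assume c: "c \<in> \<Gamma>"
  show "(LINT w|\<Omega>. \<xi> c w * (k * bracket f g w)) = l2_inner M (\<rho> c (cfun_scale k f)) g"
    using assms c
    by (simp add: mult.left_commute[of _ k] bracket_fourier rep_scale l2_inner_scale_left)
qed (use assms in \<open>auto intro: L2_scale bracket_integrable\<close>)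

lemma bracket_add_right:
  assumes "f \<in> L2 M" "f' \<in> L2 M" "g \<in> L2 M"
  shows "AE w in \<Omega>. bracket g (f + f') w = bracket g f w + bracket g f' w"
  using bracket_add_left[OF assms] by eventually_elim (metis bracket_cnj complex_cnj_add)

lemma bracket_scale_right:
  assumes "f \<in> L2 M" "g \<in> L2 M"
  shows "AE w in \<Omega>. bracket g (cfun_scale k f) w = cnj k * bracket g f w"
  using bracket_scale_left[OF assms, of k] by eventually_elim (metis bracket_cnj complex_cnj_mult)

lemma bracket_diff_left:
  assumes "f \<in> L2 M" "f' \<in> L2 M" "g \<in> L2 M"
  shows "AE w in \<Omega>. bracket (f - f') g w = bracket f g w - bracket f' g w"
  using bracket_add_left[OF L2_diff[OF assms(1,2)] assms(2,3)] by eventually_elim simp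

lemma bracket_zero_left: "g \<in> L2 M \<Longrightarrow> AE w in \<Omega>. bracket 0 g w = 0"
  using bracket_add_left[OF L2_zero L2_zero, of g] by (rule AE_mp) simp_all

lemma bracket_sum_left:
  assumes "\<And>i. i \<in> I \<Longrightarrow> f i \<in> L2 M" "g \<in> L2 M"
  shows "AE w in \<Omega>. bracket (\<Sum>i\<in>I. f i) g w = (\<Sum>i\<in>I. bracket (f i) g w)"
  using assms
proof (induction I rule: infinite_finite_induct)
  case (insert i I)
  then have "AE w in \<Omega>. bracket (f i + (\<Sum>i\<in>I. f i)) g w = bracket (f i) g w + bracket (\<Sum>i\<in>I. f i) g w"
    by (intro bracket_add_left L2_sum) auto
  moreover have "AE w in \<Omega>. bracket (\<Sum>i\<in>I. f i) g w = (\<Sum>i\<in>I. bracket (f i) g w)" using insert by simp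
  ultimately show ?case by eventually_elim (simp only: sum.insert[OF insert.hyps])
qed (simp_all add: bracket_zero_left)

lemma bracket_null:
  assumes "f \<in> L2 M" "g \<in> L2 M" "\<And>c. c \<in> \<Gamma> \<Longrightarrow> l2_inner M (\<rho> c f) g = 0"
  shows "AE w in \<Omega>. bracket f g w = 0"
  using assms by (intro bracket_eqI) auto

lemma bracket_integral:
  assumes "f \<in> L2 M" "g \<in> L2 M"
  shows "(LINT w|\<Omega>. bracket f g w) = l2_inner M f g"
proof -
  have "(LINT w|\<Omega>. bracket f g w) = l2_inner M (\<rho> \<one> f) g"
    using bracket_fourier[OF assms \<Gamma>_ops(1)] by (simp add: \<xi>_one)
  also have "\<dots> = l2_inner M f g"
    using assms rep_one_AE[of f] by (intro l2_inner_cong_AE) (auto simp: rep_L2)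
  finally show ?thesis .
qed

lemma bracket_null_fourier:
  assumes "f \<in> L2 M" "g \<in> L2 M" "AE w in \<Omega>. bracket f g w = 0" "c \<in> \<Gamma>"
  shows "l2_inner M (\<rho> c f) g = 0"
proof -
  have "(LINT w|\<Omega>. \<xi> c w * bracket f g w) = 0"
    by (rule integral_eq_zero_AE) (use assms(3) in \<open>eventually_elim, simp\<close>)
  then show ?thesis using bracket_fourier[OF assms(1,2,4)] by simp
qed

lemma bracket_rep:
  assumes "f \<in> L2 M" "g \<in> L2 M" "d \<in> carrier T"
  shows "AE w in \<Omega>. bracket (\<rho> d f) (\<rho> d g) w = bracket f g w"
proof (rule bracket_eqI)
  fix c assume c: "c \<in> \<Gamma>"
  have "l2_inner M (\<rho> c (\<rho> d f)) (\<rho> d g) = l2_inner M (\<rho> d (\<rho> c f)) (\<rho> d g)"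
    using assms c by (intro l2_inner_cong_AE rep_commute_AE) (auto simp: rep_L2)
  then show "(LINT w|\<Omega>. \<xi> c w * bracket f g w) = l2_inner M (\<rho> c (\<rho> d f)) (\<rho> d g)"
    using assms c by (simp add: rep_inner rep_L2 bracket_fourier)
qed (use assms in \<open>auto intro: rep_L2 bracket_integrable\<close>)

lemma bracket_eq_0_of_self:
  assumes "f \<in> L2 M" "g \<in> L2 M"
  shows "AE w in \<Omega>. bracket f f w = 0 \<longrightarrow> bracket f g w = 0"
  using bracket_cauchy_schwarz[OF assms] by eventually_elim auto

lemma bracket_self_integral: "f \<in> L2 M \<Longrightarrow> (LINT w|\<Omega>. Re (bracket f f w)) = (l2_norm M f)\<^sup>2"
  using bracket_integral[of f f] bracket_integrable[of f f] by (simp add: l2_norm_sq_Re)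

lemma bracket_cong_left:
  assumes "f \<in> L2 M" "f' \<in> L2 M" "g \<in> L2 M" "AE x in M. f x = f' x"
  shows "AE w in \<Omega>. bracket f g w = bracket f' g w"
proof (rule bracket_eqI)
  fix c assume c: "c \<in> \<Gamma>"
  have "l2_inner M (\<rho> c f') g = l2_inner M (\<rho> c f) g"
    using assms c rep_cong_AE[of c f f'] by (intro l2_inner_cong_AE) (auto simp: rep_L2)
  then show "(LINT w|\<Omega>. \<xi> c w * bracket f' g w) = l2_inner M (\<rho> c f) g"
    using assms c by (simp add: bracket_fourier)
qed (use assms in \<open>auto intro: bracket_integrable\<close>)

text \<open>\<open>is_multiple a f h\<close> says that \<open>h\<close> is the product of \<open>f\<close> with the function \<open>a\<close> on the dual
  side, that is \<open>zak h = modulate a (zak f)\<close>.\<close>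

definition is_multiple :: "('w \<Rightarrow> complex) \<Rightarrow> ('x \<Rightarrow> complex) \<Rightarrow> ('x \<Rightarrow> complex) \<Rightarrow> bool" where
  "is_multiple a f h \<longleftrightarrow> h \<in> L2 M \<and> (\<forall>g\<in>L2 M. AE w in \<Omega>. bracket h g w = a w * bracket f g w)"

text \<open>The functional sending \<open>g\<close> to the integral of
  \<open>a w * bracket f g w\<close> is bounded, by Cauchy-Schwarz first in the fibre and then over
  \<open>\<Omega>\<close>; Riesz represents it by \<open>h\<close>. The factor \<open>a\<close> may
  be unbounded.\<close>

lemma ex_multiple:
  assumes f: "f \<in> L2 M" and a [measurable]: "a \<in> borel_measurable \<Omega>"
    and int: "integrable \<Omega> (\<lambda>w. (cmod (a w))\<^sup>2 * Re (bracket f f w))"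
  shows "\<exists>h. is_multiple a f h"
proof -
  have bm [measurable]: "bracket f g \<in> borel_measurable \<Omega>" if "f \<in> L2 M" "g \<in> L2 M" for f g
    using bracket_integrable[OF that] by simp
  \<comment> \<open>\<open>u\<close> and \<open>v g\<close> are the fibre norms of the product and
    of \<open>g\<close>, viewed as elements of \<open>L2 \<Omega>\<close>; the second application of
    Cauchy-Schwarz is to them.\<close>
  define u where "u w = complex_of_real (cmod (a w) * sqrt (Re (bracket f f w)))" for w
  define v where "v g w = complex_of_real (sqrt (Re (bracket g g w)))" for g w
  have u: "u \<in> L2 \<Omega>"
    using int f bracket_self(2)[of f] by (simp add: L2_def u_def[abs_def] norm_mult power_mult_distrib)
  have v: "v g \<in> L2 \<Omega>" and nv: "l2_norm \<Omega> (v g) = l2_norm M g" if g: "g \<in> L2 M" for g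
  proof -
    show "v g \<in> L2 \<Omega>"
      using g bracket_self(2)[of g] bracket_integrable[OF g g] by (simp add: L2_def v_def[abs_def])
    have "(l2_norm \<Omega> (v g))\<^sup>2 = (l2_norm M g)\<^sup>2"
      using g bracket_self(2)[of g] by (simp add: l2_norm_sq[of \<Omega>] v_def bracket_self_integral)
    then show "l2_norm \<Omega> (v g) = l2_norm M g" by (simp add: power2_eq_iff_nonneg)
  qed
  have le: "AE w in \<Omega>. cmod (a w * bracket f g w) \<le> Re (u w * cnj (v g w))" if g: "g \<in> L2 M" for g
    using bracket_cauchy_schwarz[OF f g]
  proof eventually_elim
    case (elim w)
    have "cmod (bracket f g w) \<le> sqrt (Re (bracket f f w)) * sqrt (Re (bracket g g w))"
      using real_le_rsqrt[OF elim] by (simp add: real_sqrt_mult)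
    then show ?case by (simp add: u_def v_def norm_mult mult.assoc mult_left_mono)
  qed
  have uv: "integrable \<Omega> (\<lambda>w. Re (u w * cnj (v g w)))" if g: "g \<in> L2 M" for g
    by (rule integrable_Re[OF L2_mult_integrable[OF u v[OF g]]])
  have ab: "integrable \<Omega> (\<lambda>w. a w * bracket f g w)" if g: "g \<in> L2 M" for g
  proof (rule Bochner_Integration.integrable_bound[OF uv[OF g]])
    show "(\<lambda>w. a w * bracket f g w) \<in> borel_measurable \<Omega>" using f g by measurable
    show "AE w in \<Omega>. cmod (a w * bracket f g w) \<le> norm (Re (u w * cnj (v g w)))"
      using le[OF g] by eventually_elim simp
  qed
  define L where "L g = (LINT w|\<Omega>. a w * bracket f g w)" for g
  have L: "cmod (L g) \<le> l2_norm \<Omega> u * l2_norm M g" if g: "g \<in> L2 M" for g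
  proof -
    have "cmod (L g) \<le> (LINT w|\<Omega>. cmod (a w * bracket f g w))"
      unfolding L_def by (rule integral_norm_bound)
    also have "\<dots> \<le> (LINT w|\<Omega>. Re (u w * cnj (v g w)))"
      by (rule integral_mono_AE[OF integrable_norm[OF ab[OF g]] uv[OF g] le[OF g]])
    also have "\<dots> = Re (l2_inner \<Omega> u (v g))"
      unfolding l2_inner_def by (rule integral_Re[OF L2_mult_integrable[OF u v[OF g]]])
    also have "\<dots> \<le> cmod (l2_inner \<Omega> u (v g))" by (rule complex_Re_le_cmod)
    also have "\<dots> \<le> l2_norm \<Omega> u * l2_norm M g" using l2_cauchy_schwarz[OF u v[OF g]] nv[OF g] by simp
    finally show ?thesis .
  qed
  have ad: "L (g + g') = L g + L g'" if g: "g \<in> L2 M" "g' \<in> L2 M" for g g'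
  proof -
    have "L (g + g') = (LINT w|\<Omega>. a w * bracket f g w + a w * bracket f g' w)"
      unfolding L_def
    proof (rule integral_cong_AE)
      show "AE w in \<Omega>. a w * bracket f (g + g') w = a w * bracket f g w + a w * bracket f g' w"
        using bracket_add_right[OF g f] by eventually_elim (simp add: ring_distribs)
    qed (use f g L2_add[OF g] in measurable)
    then show ?thesis using ab g by (simp add: L_def)
  qed
  have sc: "L (cfun_scale k g) = cnj k * L g" if g: "g \<in> L2 M" for k g
  proof -
    have "L (cfun_scale k g) = (LINT w|\<Omega>. cnj k * (a w * bracket f g w))"
      unfolding L_def
    proof (rule integral_cong_AE)
      show "AE w in \<Omega>. a w * bracket f (cfun_scale k g) w = cnj k * (a w * bracket f g w)"
        using bracket_scale_right[OF g f, of k] by eventually_elim simp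
    qed (use f g L2_scale[OF g] in measurable)
    then show ?thesis by (simp add: L_def)
  qed
  obtain h where h: "h \<in> L2 M" "\<And>g. g \<in> L2 M \<Longrightarrow> l2_inner M h g = L g"
    using l2_riesz[OF mu.sigma_finite_measure_axioms ad sc L] by metis
  have "AE w in \<Omega>. bracket h g w = a w * bracket f g w" if g: "g \<in> L2 M" for g
  proof (rule bracket_eqI[OF h(1) g ab[OF g]])
    fix c assume c: "c \<in> \<Gamma>"
    have gc: "\<rho> (inv c) g \<in> L2 M" "\<rho> c f \<in> L2 M" using c g f by (auto intro: rep_L2)
    \<comment> \<open>Testing \<open>h\<close> against translates of \<open>g\<close> inserts the
      characters into the integral, so the scalar identity of Riesz gives all Fourier
      coefficients.\<close>
    have "AE w in \<Omega>. bracket f (\<rho> (inv c) g) w = \<xi> c w * bracket f g w"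
    proof (rule bracket_eqI[OF f gc(1) integrable_\<xi>_mult[OF c bracket_integrable[OF f g]]])
      fix b assume b: "b \<in> \<Gamma>"
      have "(LINT w|\<Omega>. \<xi> b w * (\<xi> c w * bracket f g w)) = (LINT w|\<Omega>. \<xi> (c \<otimes> b) w * bracket f g w)"
        using b c by (simp add: \<xi>_mult mult_ac)
      also have "\<dots> = l2_inner M (\<rho> (c \<otimes> b) f) g" using b c f g by (simp add: bracket_fourier)
      also have "\<dots> = l2_inner M (\<rho> c (\<rho> b f)) g"
        using rep_mult_AE[of c b f] b c f g by (intro l2_inner_cong_AE) (auto simp: rep_L2 eq_commute)
      also have "\<dots> = l2_inner M (\<rho> b f) (\<rho> (inv c) g)"
        using b c f g by (intro rep_adjoint) (auto simp: rep_L2)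
      finally show "(LINT w|\<Omega>. \<xi> b w * (\<xi> c w * bracket f g w)) = l2_inner M (\<rho> b f) (\<rho> (inv c) g)" .
    qed
    then have "L (\<rho> (inv c) g) = (LINT w|\<Omega>. \<xi> c w * (a w * bracket f g w))"
      unfolding L_def using f g gc \<xi>_measurable[OF c]
      by (intro integral_cong_AE) (auto elim!: AE_mp)
    then show "(LINT w|\<Omega>. \<xi> c w * (a w * bracket f g w)) = l2_inner M (\<rho> c h) g"
      using h gc(1) c g by (simp add: rep_adjoint)
  qed
  then show ?thesis using h(1) unfolding is_multiple_def by blast
qed

text \<open>The part \<open>q\<close> of \<open>h\<close> orthogonal to \<open>V\<close> has zero
  bracket with \<open>f\<close>, by invariance of \<open>V\<close>. Then its bracket with the
  multiple \<open>h\<close> vanishes too, so \<open>q\<close> is orthogonal to itself.\<close>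

lemma is_multiple_in_space:
  assumes V: "inv_space \<Gamma> V" and f: "f \<in> V" and h: "is_multiple a f h"
  shows "h \<in> V"
proof -
  note VL = inv_spaceD[OF V]
  have L: "h \<in> L2 M" "f \<in> L2 M" using h f VL by (auto simp: is_multiple_def)
  obtain p where p: "p \<in> V" "\<And>k. k \<in> V \<Longrightarrow> l2_inner M (h - p) k = 0"
    using l2_projection_exists[OF mu.sigma_finite_measure_axioms VL(1) L(1)] by blast
  have pL: "p \<in> L2 M" using p VL by auto
  define q where "q = h - p"
  have qL: "q \<in> L2 M" using L pL by (simp add: q_def L2_diff)
  have qo: "l2_inner M k q = 0" if "k \<in> V" for k
    using p(2)[OF that] by (metis complex_cnj_zero l2_inner_cnj q_def)
  have "AE w in \<Omega>. bracket f q w = 0"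
    by (rule bracket_null[OF L(2) qL]) (use qo VL(3) f in blast)
  moreover have "AE w in \<Omega>. bracket h q w = a w * bracket f q w" using h qL by (simp add: is_multiple_def)
  ultimately have "AE w in \<Omega>. bracket h q w = 0" by eventually_elim simp
  then have "l2_inner M h q = 0"
    unfolding bracket_integral[OF L(1) qL, symmetric] by (rule integral_eq_zero_AE)
  then have "l2_inner M (h - p) q = 0" using qo[OF p(1)] L pL qL by (simp add: l2_inner_diff_left)
  then have "l2_inner M q q = 0" by (simp add: q_def)
  then have "l2_norm M (h - p) = 0" by (simp add: l2_inner_self q_def)
  then show ?thesis using l2_closed_subspace_AE[OF VL(1) p(1) L(1)] L pL by (simp add: l2_norm_diff_eq_0)
qed

section \<open>Gram-Schmidt and projections with respect to the bracket\<close>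

lemma AE_all_lessThan:
  fixes n :: nat
  assumes "\<And>i. i < n \<Longrightarrow> AE w in N. P i w"
  shows "AE w in N. \<forall>i<n. P i w"
proof -
  have "AE w in N. \<forall>i\<in>{..<n}. P i w" by (rule AE_finite_allI) (use assms in auto)
  then show ?thesis by (rule eventually_mono) simp
qed

lemma null_imp_AE_eq:
  assumes "f \<in> L2 M" "p \<in> L2 M" "l2_inner M (f - p) (f - p) = 0"
  shows "AE x in M. f x = p x"
  using assms l2_norm_diff_eq_0[OF assms(1,2)] by (simp add: l2_inner_self)

text \<open>A member may vanish over part of \<open>\<Omega>\<close>: the dimension of the fibres
  changes with \<open>w\<close>, and a fibre where a vector is zero cannot be normalised.\<close>

definition partial_orthonormal :: "nat \<Rightarrow> (nat \<Rightarrow> 'x \<Rightarrow> complex) \<Rightarrow> bool" where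
  "partial_orthonormal n e \<longleftrightarrow> (\<forall>i<n. e i \<in> L2 M) \<and>
     (\<forall>i<n. \<forall>j<n. i \<noteq> j \<longrightarrow> (AE w in \<Omega>. bracket (e i) (e j) w = 0)) \<and>
     (\<forall>i<n. AE w in \<Omega>. bracket (e i) (e i) w = 0 \<or> bracket (e i) (e i) w = 1)"

lemma partial_orthonormalD:
  assumes "partial_orthonormal n e"
  shows "i < n \<Longrightarrow> e i \<in> L2 M"
    "i < n \<Longrightarrow> j < n \<Longrightarrow> i \<noteq> j \<Longrightarrow> AE w in \<Omega>. bracket (e i) (e j) w = 0"
    "i < n \<Longrightarrow> AE w in \<Omega>. bracket (e i) (e i) w = 0 \<or> bracket (e i) (e i) w = 1"
  using assms by (auto simp: partial_orthonormal_def)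

text \<open>Where \<open>e i\<close> has fibre norm 0, Cauchy-Schwarz kills its bracket with
  \<open>f\<close>; elsewhere the extra factor is 1.\<close>

lemma partial_orthonormal_absorb:
  assumes "partial_orthonormal n e" "i < n" "f \<in> L2 M"
  shows "AE w in \<Omega>. bracket f (e i) w * bracket (e i) (e i) w = bracket f (e i) w"
  using partial_orthonormalD(3)[OF assms(1,2)] bracket_eq_0_of_self[OF partial_orthonormalD(1)[OF assms(1,2)] assms(3)]
  by eventually_elim (metis bracket_cnj complex_cnj_zero mult_1_right mult_zero_left)

text \<open>\<open>p\<close> is the sum of the \<open>e i\<close> multiplied by
  \<open>bracket f (e i)\<close>; these multiples exist because the squared coefficient is dominated
  by \<open>bracket f f\<close>.\<close>

lemma partial_orthonormal_expansion:
  assumes e: "partial_orthonormal n e" and f: "f \<in> L2 M"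
  obtains p where "p \<in> L2 M"
    "\<forall>g\<in>L2 M. AE w in \<Omega>. bracket p g w = (\<Sum>i<n. bracket f (e i) w * bracket (e i) g w)"
    "\<forall>i<n. AE w in \<Omega>. bracket p (e i) w = bracket f (e i) w"
    "\<forall>V. inv_space \<Gamma> V \<longrightarrow> (\<forall>i<n. e i \<in> V) \<longrightarrow> p \<in> V"
proof -
  have "\<exists>h. is_multiple (bracket f (e i)) (e i) h" if i: "i < n" for i
  proof (rule ex_multiple)
    note eL = partial_orthonormalD(1)[OF e i]
    show "e i \<in> L2 M" "bracket f (e i) \<in> borel_measurable \<Omega>"
      using eL bracket_integrable[OF f eL] by auto
    show "integrable \<Omega> (\<lambda>w. (cmod (bracket f (e i) w))\<^sup>2 * Re (bracket (e i) (e i) w))"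
    proof (rule Bochner_Integration.integrable_bound)
      show "integrable \<Omega> (\<lambda>w. Re (bracket f f w))" using bracket_integrable[OF f f] by simp
      show "(\<lambda>w. (cmod (bracket f (e i) w))\<^sup>2 * Re (bracket (e i) (e i) w)) \<in> borel_measurable \<Omega>"
        using bracket_integrable[OF f eL] bracket_integrable[OF eL eL] by measurable
      show "AE w in \<Omega>. norm ((cmod (bracket f (e i) w))\<^sup>2 * Re (bracket (e i) (e i) w)) \<le> norm (Re (bracket f f w))"
        using bracket_cauchy_schwarz[OF f eL] partial_orthonormalD(3)[OF e i]
      proof eventually_elim
        case (elim w)
        then show ?case using bracket_self(2)[of f w] by auto
      qed
    qed
  qed
  then obtain h where h: "\<And>i. i < n \<Longrightarrow> is_multiple (bracket f (e i)) (e i) (h i)" by metis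
  have hL: "h i \<in> L2 M" if "i < n" for i using h[OF that] by (simp add: is_multiple_def)
  define p where "p = (\<Sum>i<n. h i)"
  have pL: "p \<in> L2 M" unfolding p_def by (rule L2_sum) (simp add: hL)
  have pg: "AE w in \<Omega>. bracket p g w = (\<Sum>i<n. bracket f (e i) w * bracket (e i) g w)" if g: "g \<in> L2 M" for g
  proof -
    have "AE w in \<Omega>. \<forall>i<n. bracket (h i) g w = bracket f (e i) w * bracket (e i) g w"
      using h g by (intro AE_all_lessThan) (simp add: is_multiple_def)
    moreover have "AE w in \<Omega>. bracket p g w = (\<Sum>i<n. bracket (h i) g w)"
      unfolding p_def using hL g by (intro bracket_sum_left) auto
    ultimately show ?thesis by eventually_elim simp
  qed
  show ?thesis
  proof (rule that[OF pL], intro ballI pg, assumption; intro allI impI)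
    fix i assume i: "i < n"
    have "AE w in \<Omega>. \<forall>j<n. j \<noteq> i \<longrightarrow> bracket (e j) (e i) w = 0"
    proof (rule AE_all_lessThan)
      fix j assume "j < n"
      then show "AE w in \<Omega>. j \<noteq> i \<longrightarrow> bracket (e j) (e i) w = 0"
        using partial_orthonormalD(2)[OF e _ i, of j] by (cases "j = i") auto
    qed
    with pg[OF partial_orthonormalD(1)[OF e i]] partial_orthonormal_absorb[OF e i f]
    show "AE w in \<Omega>. bracket p (e i) w = bracket f (e i) w"
    proof eventually_elim
      case (elim w)
      have "(\<Sum>j<n. bracket f (e j) w * bracket (e j) (e i) w)
          = (\<Sum>j<n. if j = i then bracket f (e i) w else 0)"
        using elim(2,3) by (intro sum.cong refl) auto
      then show ?case using elim(1) i by simp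
    qed
  next
    fix V assume V: "inv_space \<Gamma> V" and eV: "\<forall>i<n. e i \<in> V"
    show "p \<in> V"
      unfolding p_def
      by (rule cfun_subspace_ops(5)[OF inv_spaceD(4)[OF V]]) (use is_multiple_in_space[OF V _ h] eV in auto)
  qed
qed

text \<open>Spanning is expressed dually, by what is orthogonal to the family, since fibrewise
  linear combinations with measurable coefficients need not be square-integrable.\<close>

lemma gram_schmidt:
  assumes "\<And>k. k < n \<Longrightarrow> v k \<in> V" and V: "inv_space \<Gamma> V"
  shows "\<exists>e. partial_orthonormal n e \<and> (\<forall>i<n. e i \<in> V) \<and>
    (\<forall>q\<in>L2 M. (\<forall>i<n. AE w in \<Omega>. bracket q (e i) w = 0) \<longrightarrow> (\<forall>k<n. AE w in \<Omega>. bracket q (v k) w = 0))"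
  using assms(1)
proof (induction n)
  case (Suc n)
  then obtain e where e: "partial_orthonormal n e" "\<And>i. i < n \<Longrightarrow> e i \<in> V"
    and span: "\<And>q k. q \<in> L2 M \<Longrightarrow> (\<And>i. i < n \<Longrightarrow> AE w in \<Omega>. bracket q (e i) w = 0) \<Longrightarrow> k < n \<Longrightarrow>
      AE w in \<Omega>. bracket q (v k) w = 0"
    by (metis less_SucI)
  have vV: "v n \<in> V" by (rule Suc.prems) simp
  then have vL: "v n \<in> L2 M" using inv_spaceD(2)[OF V] by blast
  obtain p where p: "p \<in> L2 M"
    "\<forall>g\<in>L2 M. AE w in \<Omega>. bracket p g w = (\<Sum>i<n. bracket (v n) (e i) w * bracket (e i) g w)"
    "\<forall>i<n. AE w in \<Omega>. bracket p (e i) w = bracket (v n) (e i) w"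
    "\<forall>V. inv_space \<Gamma> V \<longrightarrow> (\<forall>i<n. e i \<in> V) \<longrightarrow> p \<in> V"
    by (rule partial_orthonormal_expansion[OF e(1) vL])
  note p = p(1) p(2)[rule_format] p(3)[rule_format] p(4)[rule_format]
  define u where "u = v n - p"
  have uL: "u \<in> L2 M" unfolding u_def by (rule L2_diff[OF vL p(1)])
  have uV: "u \<in> V" unfolding u_def
    by (rule cfun_subspace_ops(3)[OF inv_spaceD(4)[OF V] vV p(4)[OF V e(2)]])
  have ue: "AE w in \<Omega>. bracket u (e i) w = 0" if i: "i < n" for i
    using bracket_diff_left[OF vL p(1) partial_orthonormalD(1)[OF e(1) i]] p(3)[OF i] by eventually_elim (simp add: u_def)
  \<comment> \<open>Normalisation in the fibre; as \<open>inverse 0 = 0\<close>, the new vector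
    vanishes where the remainder \<open>u\<close> does.\<close>
  define a where "a w = complex_of_real (inverse (sqrt (Re (bracket u u w))))" for w
  have buu: "bracket u u \<in> borel_measurable \<Omega>" using bracket_integrable[OF uL uL] by simp
  then have am: "a \<in> borel_measurable \<Omega>" unfolding a_def[abs_def] by measurable
  have an: "(cmod (a w))\<^sup>2 * Re (bracket u u w) = (if Re (bracket u u w) = 0 then 0 else 1)" for w
    using bracket_self(2)[of u w] by (simp add: a_def norm_inverse power_inverse)
  have "\<exists>h. is_multiple a u h"
  proof (rule ex_multiple[OF uL am])
    show "integrable \<Omega> (\<lambda>w. (cmod (a w))\<^sup>2 * Re (bracket u u w))"
      by (rule prob.integrable_const_bound[of _ 1]) (use am buu in \<open>auto simp: an\<close>)
  qed
  then obtain h where h: "is_multiple a u h" by blast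
  have hL: "h \<in> L2 M" and hg: "\<And>g. g \<in> L2 M \<Longrightarrow> AE w in \<Omega>. bracket h g w = a w * bracket u g w"
    using h by (auto simp: is_multiple_def)
  define e' where "e' i = (if i = n then h else e i)" for i
  have he: "AE w in \<Omega>. bracket h (e i) w = 0" if i: "i < n" for i
    using ue[OF i] hg[OF partial_orthonormalD(1)[OF e(1) i]] by eventually_elim simp
  have hh: "AE w in \<Omega>. bracket h h w = 0 \<or> bracket h h w = 1"
    using hg[OF hL] hg[OF uL]
  proof eventually_elim
    case (elim w)
    have "bracket h h w = a w * cnj (a w) * bracket u u w"
      using elim bracket_cnj[of h u w] bracket_cnj[of u u w] by simp
    also have "\<dots> = of_real ((cmod (a w))\<^sup>2 * Re (bracket u u w))"
      using complex_norm_square[of "a w"] bracket_self(1)[of u w] by simp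
    finally show ?case unfolding an by auto
  qed
  have "partial_orthonormal (Suc n) e'"
    unfolding partial_orthonormal_def
  proof (intro conjI allI impI)
    fix i assume "i < Suc n"
    then show "e' i \<in> L2 M" using hL partial_orthonormalD(1)[OF e(1)] by (auto simp: e'_def less_Suc_eq)
    show "AE w in \<Omega>. bracket (e' i) (e' i) w = 0 \<or> bracket (e' i) (e' i) w = 1"
      using hh partial_orthonormalD(3)[OF e(1), of i] \<open>i < Suc n\<close> by (cases "i = n") (simp_all add: e'_def)
    fix j assume j: "j < Suc n" "i \<noteq> j"
    have eh: "AE w in \<Omega>. bracket (e i) h w = 0" if "i < n" for i
      using he[OF that] by eventually_elim (metis bracket_cnj complex_cnj_zero)
    show "AE w in \<Omega>. bracket (e' i) (e' j) w = 0"
      using he eh partial_orthonormalD(2)[OF e(1)] \<open>i < Suc n\<close> j by (auto simp: e'_def less_Suc_eq)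
  qed
  moreover have "e' i \<in> V" if "i < Suc n" for i
    using that e(2) is_multiple_in_space[OF V uV h] by (auto simp: e'_def less_Suc_eq)
  moreover have "AE w in \<Omega>. bracket q (v k) w = 0"
    if q: "q \<in> L2 M" and qe': "\<forall>i<Suc n. AE w in \<Omega>. bracket q (e' i) w = 0" and k: "k < Suc n" for q k
  proof -
    have qe: "AE w in \<Omega>. bracket q (e i) w = 0" if "i < n" for i
      using qe'[rule_format, of i] that by (simp add: e'_def)
    show ?thesis
    proof (cases "k < n")
      case True
      then show ?thesis using span[OF q qe] by blast
    next
      case False
      then have kn: "k = n" using k by simp
      have qh: "AE w in \<Omega>. bracket q h w = 0" using qe'[rule_format, of n] by (simp add: e'_def)
      have "AE w in \<Omega>. \<forall>i<n. bracket q (e i) w = 0" by (rule AE_all_lessThan[OF qe])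
      with p(2)[OF q] qh hg[OF q] bracket_eq_0_of_self[OF uL q] bracket_diff_left[OF vL p(1) q]
      have "AE w in \<Omega>. bracket (v n) q w = 0"
      proof eventually_elim
        case (elim w)
        have "bracket (e i) q w = 0" if "i < n" for i using elim(6) that by (metis bracket_cnj complex_cnj_zero)
        then have "bracket p q w = 0" using elim(1) by simp
        \<comment> \<open>Where \<open>u\<close> has positive fibre norm one divides by
          \<open>a w\<close>; where it has norm 0, Cauchy-Schwarz applies.\<close>
        moreover have "bracket u q w = 0"
        proof (cases "Re (bracket u u w) = 0")
          case True
          then show ?thesis using elim(4) bracket_self(1)[of u w] by simp
        next
          case False
          then have "a w \<noteq> 0" using bracket_self(2)[of u w] by (simp add: a_def)
          moreover have "a w * bracket u q w = 0" using elim(2,3) by (metis bracket_cnj complex_cnj_zero)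
          ultimately show ?thesis by simp
        qed
        ultimately show ?case using elim(5) by (simp add: u_def)
      qed
      then show ?thesis unfolding kn by eventually_elim (metis bracket_cnj complex_cnj_zero)
    qed
  qed
  ultimately show ?case by blast
qed (auto simp: partial_orthonormal_def)

text \<open>Bracket orthogonality to the family forces ordinary orthogonality to \<open>V\<close>.
  This form needs no closure and is exactly what identifies the projection onto
  \<open>V\<close>.\<close>

definition spans :: "nat \<Rightarrow> (nat \<Rightarrow> 'x \<Rightarrow> complex) \<Rightarrow> ('x \<Rightarrow> complex) set \<Rightarrow> bool" where
  "spans n e V \<longleftrightarrow> (\<forall>i<n. e i \<in> V) \<and>
     (\<forall>q\<in>L2 M. (\<forall>i<n. AE w in \<Omega>. bracket q (e i) w = 0) \<longrightarrow> (\<forall>f\<in>V. l2_inner M q f = 0))"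

lemma gen_space_ortho:
  assumes A: "A \<subseteq> L2 M" and q: "q \<in> L2 M" and null: "\<And>\<phi>. \<phi> \<in> A \<Longrightarrow> AE w in \<Omega>. bracket q \<phi> w = 0"
    and f: "f \<in> gen_space A"
  shows "l2_inner M q f = 0"
proof -
  have "l2_inner M q (\<rho> c \<phi>) = 0" if c: "c \<in> \<Gamma>" and \<phi>: "\<phi> \<in> A" for c \<phi>
  proof -
    have "AE w in \<Omega>. bracket \<phi> q w = 0"
      using null[OF \<phi>] by eventually_elim (metis bracket_cnj complex_cnj_zero)
    then have "l2_inner M (\<rho> c \<phi>) q = 0" using bracket_null_fourier[of \<phi> q c] A \<phi> c q by blast
    then show ?thesis by (metis l2_inner_cnj complex_cnj_zero)
  qed
  then have "gen_space A \<subseteq> {h \<in> L2 M. l2_inner M q h = 0}"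
    using A by (intro gen_space_subset[OF A l2_closed_subspace_ortho[OF q]]) (auto intro: rep_L2)
  with f show ?thesis by blast
qed

lemma ex_spanning_family:
  assumes v: "\<And>k. k < n \<Longrightarrow> v k \<in> L2 M"
  shows "\<exists>e. partial_orthonormal n e \<and> spans n e (gen_space (v ` {..<n}))"
proof -
  let ?V = "gen_space (v ` {..<n})"
  have A: "v ` {..<n} \<subseteq> L2 M" using v by auto
  have "v k \<in> ?V" if "k < n" for k using gen_space_incl[OF A] that by simp
  then obtain e where e: "partial_orthonormal n e" "\<forall>i<n. e i \<in> ?V"
    "\<forall>q\<in>L2 M. (\<forall>i<n. AE w in \<Omega>. bracket q (e i) w = 0) \<longrightarrow> (\<forall>k<n. AE w in \<Omega>. bracket q (v k) w = 0)"
    using gram_schmidt[of n v ?V] gen_space_\<Gamma>_invariant[OF A] by blast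
  have "l2_inner M q f = 0"
    if q: "q \<in> L2 M" "\<forall>i<n. AE w in \<Omega>. bracket q (e i) w = 0" and f: "f \<in> ?V" for q f
  proof (rule gen_space_ortho[OF A q(1) _ f])
    fix \<phi> assume "\<phi> \<in> v ` {..<n}"
    then show "AE w in \<Omega>. bracket q \<phi> w = 0" using e(3) q by blast
  qed
  with e show ?thesis unfolding spans_def by blast
qed

lemma partial_orthonormal_spans_gen_space:
  assumes "partial_orthonormal n e"
  shows "spans n e (gen_space (e ` {..<n}))"
proof -
  have A: "e ` {..<n} \<subseteq> L2 M" using partial_orthonormalD(1)[OF assms] by auto
  have "l2_inner M q f = 0"
    if q: "q \<in> L2 M" "\<forall>i<n. AE w in \<Omega>. bracket q (e i) w = 0" and f: "f \<in> gen_space (e ` {..<n})" for q f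
  proof (rule gen_space_ortho[OF A q(1) _ f])
    fix \<phi> assume "\<phi> \<in> e ` {..<n}"
    then show "AE w in \<Omega>. bracket q \<phi> w = 0" using q by blast
  qed
  then show ?thesis unfolding spans_def using gen_space_incl[OF A] by simp
qed

text \<open>The expansion of \<open>f\<close> lies in \<open>V\<close>, and the remainder has zero
  bracket with every \<open>e i\<close>; Pythagoras and Parseval in the fibres then turn the error
  into an integral over \<open>\<Omega>\<close>.\<close>

lemma partial_orthonormal_projection:
  assumes e: "partial_orthonormal n e" and V: "inv_space \<Gamma> V" and sp: "spans n e V" and f: "f \<in> L2 M"
  obtains p where "p \<in> V" "\<forall>h\<in>V. l2_inner M (f - p) h = 0"
    "\<forall>g\<in>L2 M. AE w in \<Omega>. bracket p g w = (\<Sum>i<n. bracket f (e i) w * bracket (e i) g w)"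
    "(l2_norm M (f - p))\<^sup>2 = (l2_norm M f)\<^sup>2 - (LINT w|\<Omega>. (\<Sum>i<n. (cmod (bracket f (e i) w))\<^sup>2))"
    "integrable \<Omega> (\<lambda>w. \<Sum>i<n. (cmod (bracket f (e i) w))\<^sup>2)"
proof -
  obtain p where p: "p \<in> L2 M"
    "\<forall>g\<in>L2 M. AE w in \<Omega>. bracket p g w = (\<Sum>i<n. bracket f (e i) w * bracket (e i) g w)"
    "\<forall>i<n. AE w in \<Omega>. bracket p (e i) w = bracket f (e i) w"
    "\<forall>V. inv_space \<Gamma> V \<longrightarrow> (\<forall>i<n. e i \<in> V) \<longrightarrow> p \<in> V"
    by (rule partial_orthonormal_expansion[OF e f])
  note p = p(1) p(2)[rule_format] p(3)[rule_format] p(4)[rule_format]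
  have pV: "p \<in> V" using p(4)[OF V] sp by (simp add: spans_def)
  have q: "AE w in \<Omega>. bracket (f - p) (e i) w = 0" if i: "i < n" for i
    using bracket_diff_left[OF f p(1) partial_orthonormalD(1)[OF e i]] p(3)[OF i] by eventually_elim simp
  have ortho: "l2_inner M (f - p) h = 0" if "h \<in> V" for h
    using sp that q L2_diff[OF f p(1)] by (auto simp: spans_def)
  have "AE w in \<Omega>. \<forall>i<n. bracket p (e i) w = bracket f (e i) w" by (rule AE_all_lessThan[OF p(3)])
  with p(2)[OF p(1)] have ae: "AE w in \<Omega>. Re (bracket p p w) = (\<Sum>i<n. (cmod (bracket f (e i) w))\<^sup>2)"
  proof eventually_elim
    case (elim w)
    have "bracket f (e i) w * bracket (e i) p w = of_real ((cmod (bracket f (e i) w))\<^sup>2)" if "i < n" for i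
      using elim(2) that bracket_cnj[of p "e i" w] complex_norm_square[of "bracket f (e i) w"] by simp
    then have "bracket p p w = (\<Sum>i<n. of_real ((cmod (bracket f (e i) w))\<^sup>2))" using elim(1) by simp
    then show ?case by simp
  qed
  have m: "(\<lambda>w. \<Sum>i<n. (cmod (bracket f (e i) w))\<^sup>2) \<in> borel_measurable \<Omega>"
    using bracket_integrable[OF f partial_orthonormalD(1)[OF e]] by (intro borel_measurable_sum) auto
  have int: "integrable \<Omega> (\<lambda>w. Re (bracket p p w))" using bracket_integrable[OF p(1) p(1)] by simp
  have "(LINT w|\<Omega>. (\<Sum>i<n. (cmod (bracket f (e i) w))\<^sup>2)) = (l2_norm M p)\<^sup>2"
    unfolding bracket_self_integral[OF p(1), symmetric]
    by (rule integral_cong_AE) (use ae m int in \<open>auto simp: eq_commute\<close>)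
  moreover have "(l2_norm M f)\<^sup>2 = (l2_norm M (f - p))\<^sup>2 + (l2_norm M p)\<^sup>2"
    using l2_norm_sq_add[OF L2_diff[OF f p(1)] p(1)] ortho[OF pV] by simp
  moreover have "integrable \<Omega> (\<lambda>w. \<Sum>i<n. (cmod (bracket f (e i) w))\<^sup>2)"
    using Bochner_Integration.integrable_cong_AE[THEN iffD1, OF _ m ae int] int by auto
  ultimately show ?thesis using that[OF pV] ortho p(2) by simp
qed

lemma partial_orthonormal_parseval:
  assumes e: "partial_orthonormal n e" and V: "inv_space \<Gamma> V" and sp: "spans n e V" and f: "f \<in> V" and g: "g \<in> L2 M"
  shows "AE w in \<Omega>. bracket f g w = (\<Sum>i<n. bracket f (e i) w * bracket (e i) g w)"
proof -
  have fL: "f \<in> L2 M" using f inv_spaceD(2)[OF V] by blast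
  obtain p where p: "p \<in> V" "\<forall>h\<in>V. l2_inner M (f - p) h = 0"
    "\<forall>g\<in>L2 M. AE w in \<Omega>. bracket p g w = (\<Sum>i<n. bracket f (e i) w * bracket (e i) g w)"
    by (rule partial_orthonormal_projection[OF e V sp fL])
  note p = p(1) p(2)[rule_format] p(3)[rule_format]
  have pL: "p \<in> L2 M" using p inv_spaceD(2)[OF V] by blast
  have "AE x in M. f x = p x"
    by (rule null_imp_AE_eq[OF fL pL p(2)]) (rule cfun_subspace_ops(3)[OF inv_spaceD(4)[OF V] f p(1)])
  from bracket_cong_left[OF fL pL g this] p(3)[OF g] show ?thesis by eventually_elim simp
qed

end

section \<open>Measurable selection of an optimal frame\<close>

definition caratheodory :: "'w measure \<Rightarrow> 'b::topological_space set \<Rightarrow> ('w \<Rightarrow> 'b \<Rightarrow> real) \<Rightarrow> bool" where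
  "caratheodory N K F \<longleftrightarrow> (\<forall>b\<in>K. (\<lambda>w. F w b) \<in> borel_measurable N) \<and> (\<forall>w\<in>space N. continuous_on K (F w))"

lemma constrained_max_attained:
  fixes K :: "'b::metric_space set"
  assumes K: "compact K" and FG: "continuous_on K f" "continuous_on K g" and z: "b \<in> K" "g b = (0::real)"
  shows "\<exists>b\<in>K. g b = 0 \<and> (\<forall>b'\<in>K. g b' = 0 \<longrightarrow> f b' \<le> (f b :: real))"
proof -
  let ?Z = "{b \<in> K. g b = 0}"
  have "closedin (top_of_set K) ?Z" by (rule continuous_closedin_preimage_constant[OF FG(2)])
  then have "compact ?Z" using K closedin_compact by blast
  moreover have "?Z \<noteq> {}" using z by blast
  moreover have "continuous_on ?Z f" by (rule continuous_on_subset[OF FG(1)]) auto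
  ultimately show ?thesis using continuous_attains_sup[of ?Z f] by auto
qed

text \<open>The maximum over the zero set of \<open>G\<close> is the limit of the unconstrained maxima of the penalised
  functions \<open>F - n G\<close>, each of which is a supremum over a countable dense set.\<close>

lemma measurable_constrained_max:
  fixes K :: "'b::{metric_space, second_countable_topology} set"
  assumes K: "compact K" and F: "caratheodory N K F" and G: "caratheodory N K G"
    and Gn: "\<And>w b. b \<in> K \<Longrightarrow> 0 \<le> G w b" and z: "\<And>w. w \<in> space N \<Longrightarrow> \<exists>b\<in>K. G w b = 0"
  obtains v where "v \<in> borel_measurable N"
    "\<forall>w\<in>space N. (\<exists>b\<in>K. G w b = 0 \<and> F w b = v w) \<and> (\<forall>b\<in>K. G w b = 0 \<longrightarrow> F w b \<le> v w)"
proof -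
  have cF: "continuous_on K (F w)" and cG: "continuous_on K (G w)" if "w \<in> space N" for w
    using F G that by (auto simp: caratheodory_def)
  have "\<exists>b. b \<in> K \<and> G w b = 0 \<and> (\<forall>b'\<in>K. G w b' = 0 \<longrightarrow> F w b' \<le> F w b)" if w: "w \<in> space N" for w
    using z[OF w] constrained_max_attained[OF K cF[OF w] cG[OF w]] by blast
  \<comment> \<open>This choice of maximisers carries no measurability; only the attained value
    \<open>v\<close> is shown to be measurable.\<close>
  then obtain \<beta> where \<beta>: "\<And>w. w \<in> space N \<Longrightarrow> \<beta> w \<in> K \<and> G w (\<beta> w) = 0 \<and> (\<forall>b'\<in>K. G w b' = 0 \<longrightarrow> F w b' \<le> F w (\<beta> w))"
    by metis
  define v where "v w = F w (\<beta> w)" for w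
  \<comment> \<open>A dense subset of \<open>K\<close> may miss the zero set of \<open>G\<close>
    entirely, which is why the constraint is replaced by a penalty before restricting to
    \<open>D\<close>.\<close>
  obtain D where D: "countable D" "D \<subseteq> K" "K \<subseteq> closure D"
    using separable[of K] by blast
  \<comment> \<open>The slack \<open>1 / real (Suc j)\<close> keeps the inequality strict when
    passing from the points of \<open>D\<close> to the supremum.\<close>
  have iff: "v w < c \<longleftrightarrow> (\<exists>n j. \<forall>b\<in>D. F w b - real n * G w b \<le> c - 1 / real (Suc j))"
    if w: "w \<in> space N" for w c
  proof
    assume "\<exists>n j. \<forall>b\<in>D. F w b - real n * G w b \<le> c - 1 / real (Suc j)"
    then obtain n j where nj: "\<And>b. b \<in> D \<Longrightarrow> F w b - real n * G w b \<le> c - 1 / real (Suc j)" by blast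
    have bK: "\<beta> w \<in> K" using \<beta>[OF w] by blast
    then obtain x where x: "\<And>i. x i \<in> D" "x \<longlonglongrightarrow> \<beta> w"
      using D(3) closure_sequential by blast
    have "continuous_on K (\<lambda>b. F w b - real n * G w b)" by (intro continuous_intros cF cG w)
    then have "(\<lambda>i. F w (x i) - real n * G w (x i)) \<longlonglongrightarrow> F w (\<beta> w) - real n * G w (\<beta> w)"
      using x D(2) bK unfolding continuous_on_sequentially comp_def by blast
    then have "F w (\<beta> w) - real n * G w (\<beta> w) \<le> c - 1 / real (Suc j)"
      by (rule LIMSEQ_le_const2) (use nj x in auto)
    then have "v w \<le> c - 1 / real (Suc j)" using \<beta>[OF w] by (simp add: v_def)
    also have "\<dots> < c" by simp
    finally show "v w < c" .
  next
    assume vc: "v w < c"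
    then obtain j where j: "inverse (real (Suc j)) < c - v w" using reals_Archimedean[of "c - v w"] by auto
    define c' where "c' = c - 1 / real (Suc j)"
    have c': "v w < c'" using j by (simp add: c'_def inverse_eq_divide)
    have "\<exists>n. \<forall>b\<in>D. F w b - real n * G w b \<le> c'"
    proof (rule ccontr)
      assume "\<nexists>n. \<forall>b\<in>D. F w b - real n * G w b \<le> c'"
      then have "\<forall>n. \<exists>b. b \<in> D \<and> c' < F w b - real n * G w b" by (meson not_le)
      \<comment> \<open>If no penalty suffices, each \<open>n\<close> has a violating point; these
        accumulate at some \<open>b\<close> that beats \<open>v w\<close>, and the growing penalty
        forces \<open>G w b = 0\<close>.\<close>
      then obtain x where x: "\<And>n. x n \<in> D" "\<And>n. c' < F w (x n) - real n * G w (x n)" by metis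
      then have xK: "x n \<in> K" for n using D(2) by blast
      obtain b r where b: "b \<in> K" "strict_mono (r :: nat \<Rightarrow> nat)" "(x \<circ> r) \<longlonglongrightarrow> b"
        using compact_imp_seq_compact[OF K] xK unfolding seq_compact_def by metis
      have Fl: "(\<lambda>i. F w (x (r i))) \<longlonglongrightarrow> F w b" and Gl: "(\<lambda>i. G w (x (r i))) \<longlonglongrightarrow> G w b"
        using cF[OF w] cG[OF w] b xK unfolding continuous_on_sequentially comp_def by auto
      have lo: "c' \<le> F w (x (r i))" for i
        using x(2)[of "r i"] mult_nonneg_nonneg[OF of_nat_0_le_iff[of "r i"] Gn[OF xK[of "r i"], of w]] by linarith
      have c'F: "c' \<le> F w b" by (rule LIMSEQ_le_const[OF Fl]) (use lo in auto)
      have "G w b \<le> 0"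
      proof (rule ccontr)
        assume "\<not> G w b \<le> 0"
        then have g: "0 < G w b" by simp
        have "filterlim (\<lambda>i. real (r i)) at_top sequentially"
          by (rule filterlim_compose[OF filterlim_real_sequentially filterlim_subseq[OF b(2)]])
        then have "filterlim (\<lambda>i. G w (x (r i)) * real (r i)) at_top sequentially"
          by (rule filterlim_tendsto_pos_mult_at_top[OF Gl g])
        then have "\<forall>\<^sub>F i in sequentially. F w b + 1 - c' \<le> G w (x (r i)) * real (r i)"
          by (simp add: filterlim_at_top)
        moreover have "\<forall>\<^sub>F i in sequentially. F w (x (r i)) < F w b + 1"
          by (rule order_tendstoD(2)[OF Fl]) simp
        ultimately have "\<forall>\<^sub>F i in sequentially. False"
        proof eventually_elim
          case (elim i)
          then show ?case using x(2)[of "r i"] by (simp add: mult.commute)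
        qed
        then show False by simp
      qed
      then have "G w b = 0" using Gn[OF b(1), of w] by simp
      then have "F w b \<le> v w" using \<beta>[OF w] b(1) by (simp add: v_def)
      then show False using c'F c' by simp
    qed
    then show "\<exists>n j. \<forall>b\<in>D. F w b - real n * G w b \<le> c - 1 / real (Suc j)" unfolding c'_def by blast
  qed
  have "v \<in> borel_measurable N"
  proof (rule borel_measurableI_less)
    fix c
    have "{w \<in> space N. v w < c} = {w \<in> space N. \<exists>n j. \<forall>b\<in>D. F w b - real n * G w b \<le> c - 1 / real (Suc j)}"
      using iff by blast
    also have "\<dots> \<in> sets N"
    proof -
      have [measurable]: "(\<lambda>w. F w b) \<in> borel_measurable N" "(\<lambda>w. G w b) \<in> borel_measurable N" if "b \<in> D" for b
        using F G D(2) that by (auto simp: caratheodory_def)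
      have "{w \<in> space N. F w b - real n * G w b \<le> c - 1 / real (Suc j)} \<in> sets N" if "b \<in> D" for n j b
        using that by measurable
      then have "{w \<in> space N. \<forall>b\<in>D. F w b - real n * G w b \<le> c - 1 / real (Suc j)} \<in> sets N" for n j
        by (intro sets.sets_Collect_countable_All'[OF _ D(1)])
      then show ?thesis by (intro sets.sets_Collect_countable_Ex)
    qed
    finally show "{w \<in> space N. v w < c} \<in> sets N" .
  qed
  then show ?thesis by (rule that) (use \<beta> in \<open>auto simp: v_def\<close>)
qed

text \<open>Each maximum, once measurable, is imposed as a further constraint and the next function
  is maximised. Only the maximality of \<open>F 0\<close> is recorded; the later functions serve to
  pin down the point.\<close>

lemma measurable_lexicographic_max:
  fixes K :: "'b::{metric_space, second_countable_topology} set" and F :: "nat \<Rightarrow> 'w \<Rightarrow> 'b \<Rightarrow> real"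
  assumes K: "compact K" and F: "\<And>n. caratheodory N K (F n)" and G: "caratheodory N K G"
    and Gn: "\<And>w b. b \<in> K \<Longrightarrow> 0 \<le> G w b" and z: "\<And>w. w \<in> space N \<Longrightarrow> \<exists>b\<in>K. G w b = 0"
  shows "\<exists>v. (\<forall>n<m. v n \<in> borel_measurable N) \<and>
    (\<forall>w\<in>space N. (\<exists>b\<in>K. G w b = 0 \<and> (\<forall>n<m. F n w b = v n w)) \<and>
       (0 < m \<longrightarrow> (\<forall>b\<in>K. G w b = 0 \<longrightarrow> F 0 w b \<le> v 0 w)))"
proof (induction m)
  case 0
  then show ?case using z by auto
next
  case (Suc m)
  then obtain v where v: "\<And>n. n < m \<Longrightarrow> v n \<in> borel_measurable N"
    "\<And>w. w \<in> space N \<Longrightarrow> \<exists>b\<in>K. G w b = 0 \<and> (\<forall>n<m. F n w b = v n w)"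
    "\<And>w b. w \<in> space N \<Longrightarrow> 0 < m \<Longrightarrow> b \<in> K \<Longrightarrow> G w b = 0 \<Longrightarrow> F 0 w b \<le> v 0 w"
    by metis
  \<comment> \<open>Adding the deviations from the earlier optimal values encodes all constraints in
    the zero set of one nonnegative function.\<close>
  define G' where "G' w b = G w b + (\<Sum>n<m. \<bar>F n w b - v n w\<bar>)" for w b
  have G'0: "G' w b = 0 \<longleftrightarrow> G w b = 0 \<and> (\<forall>n<m. F n w b = v n w)" if "b \<in> K" for w b
  proof -
    have "0 \<le> (\<Sum>n<m. \<bar>F n w b - v n w\<bar>)" by (simp add: sum_nonneg)
    moreover have "(\<Sum>n<m. \<bar>F n w b - v n w\<bar>) = 0 \<longleftrightarrow> (\<forall>n<m. F n w b = v n w)"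
      by (subst sum_nonneg_eq_0_iff) auto
    ultimately show ?thesis unfolding G'_def by (simp add: add_nonneg_eq_0_iff Gn[OF that])
  qed
  have "caratheodory N K G'"
    unfolding caratheodory_def G'_def
  proof (intro conjI ballI)
    show "(\<lambda>w. G w b + (\<Sum>n<m. \<bar>F n w b - v n w\<bar>)) \<in> borel_measurable N" if "b \<in> K" for b
      using F G v(1) that unfolding caratheodory_def
      by (intro borel_measurable_add borel_measurable_sum borel_measurable_abs borel_measurable_diff) auto
    show "continuous_on K (\<lambda>b. G w b + (\<Sum>n<m. \<bar>F n w b - v n w\<bar>))" if "w \<in> space N" for w
      using F G that unfolding caratheodory_def by (intro continuous_intros) auto
  qed
  moreover have "0 \<le> G' w b" if "b \<in> K" for w b
    unfolding G'_def using Gn[OF that] by (simp add: sum_nonneg)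
  moreover have "\<exists>b\<in>K. G' w b = 0" if "w \<in> space N" for w
    using v(2)[OF that] G'0 by blast
  ultimately obtain y where y: "y \<in> borel_measurable N"
    "\<forall>w\<in>space N. (\<exists>b\<in>K. G' w b = 0 \<and> F m w b = y w) \<and> (\<forall>b\<in>K. G' w b = 0 \<longrightarrow> F m w b \<le> y w)"
    using measurable_constrained_max[OF K F[of m], of G'] by metis
  show ?case
  proof (rule exI[of _ "v(m := y)"], intro conjI allI ballI impI)
    show "(v(m := y)) n \<in> borel_measurable N" if "n < Suc m" for n
      using v(1) y(1) that by (auto simp: less_Suc_eq)
    fix w assume w: "w \<in> space N"
    obtain b where "b \<in> K" "G' w b = 0" "F m w b = y w" using y(2) w by blast
    then show "\<exists>b\<in>K. G w b = 0 \<and> (\<forall>n<Suc m. F n w b = (v(m := y)) n w)"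
      using G'0[of b w] by (intro bexI[of _ b]) (auto simp: less_Suc_eq)
    fix b assume b: "b \<in> K" "G w b = 0"
    show "F 0 w b \<le> (v(m := y)) 0 w"
    proof (cases "m = 0")
      case True
      then show ?thesis using y(2) w b G'0[of b w] by simp
    next
      case False
      then show ?thesis using v(3)[OF w _ b] by simp
    qed
  qed
qed

text \<open>After the objective, real and imaginary parts of the coordinates are maximised in turn.
  A point realising all these values has the listed coordinates equal to measurable functions,
  however it is chosen.\<close>

lemma measurable_argmax_unit_box:
  fixes F G :: "'w \<Rightarrow> (nat \<times> nat \<Rightarrow> complex) \<Rightarrow> real"
  defines "K \<equiv> {b. \<forall>p. cmod (b p) \<le> 1}"
  assumes F: "caratheodory N K F" and G: "caratheodory N K G"
    and Gn: "\<And>w b. b \<in> K \<Longrightarrow> 0 \<le> G w b" and z: "\<And>w. w \<in> space N \<Longrightarrow> \<exists>b\<in>K. G w b = 0"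
    and P: "finite P"
  obtains s where "\<forall>p\<in>P. (\<lambda>w. s w p) \<in> borel_measurable N"
    "\<forall>w\<in>space N. s w \<in> K \<and> G w (s w) = 0 \<and> (\<forall>b\<in>K. G w b = 0 \<longrightarrow> F w b \<le> F w (s w))"
proof -
  have K: "compact K"
  proof -
    have "K = PiE UNIV (\<lambda>_. cball 0 1)" by (auto simp: K_def PiE_def Pi_def)
    moreover have "compactin (product_topology (\<lambda>_. euclidean) UNIV) (PiE UNIV (\<lambda>_::nat \<times> nat. cball (0::complex) 1))"
      by (subst compactin_PiE) auto
    ultimately show ?thesis by (simp add: euclidean_product_topology)
  qed
  \<comment> \<open>Number 0 is the objective; the coordinate with code \<open>e\<close> contributes
    its real part as number \<open>2 * e + 1\<close> and its imaginary part as
    \<open>2 * e + 2\<close>.\<close>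
  define H where "H n w b = (case n of 0 \<Rightarrow> F w b
    | Suc m \<Rightarrow> (if even m then Re (b (prod_decode (m div 2))) else Im (b (prod_decode (m div 2)))))" for n w b
  have coord: "continuous_on K (\<lambda>b. b p)" for p
    by (rule continuous_on_subset[OF continuous_on_product_coordinates]) auto
  have H: "caratheodory N K (H n)" for n
  proof (cases n)
    case 0
    then show ?thesis using F by (simp add: H_def[abs_def])
  next
    case (Suc m)
    have "continuous_on K (\<lambda>b. Re (b p))" "continuous_on K (\<lambda>b. Im (b p))" for p
      by (intro continuous_intros coord)+
    then show ?thesis by (cases "even m") (auto simp: caratheodory_def H_def Suc)
  qed
  obtain B where B: "\<And>p. p \<in> P \<Longrightarrow> prod_encode p < B"
    using finite_nat_set_iff_bounded[of "prod_encode ` P"] P by auto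
  have "\<exists>v. (\<forall>n<Suc (2 * B). v n \<in> borel_measurable N) \<and>
    (\<forall>w\<in>space N. (\<exists>b\<in>K. G w b = 0 \<and> (\<forall>n<Suc (2 * B). H n w b = v n w)) \<and>
       (0 < Suc (2 * B) \<longrightarrow> (\<forall>b\<in>K. G w b = 0 \<longrightarrow> H 0 w b \<le> v 0 w)))"
    by (rule measurable_lexicographic_max[OF K H G]) (use Gn z in auto)
  then obtain v where v: "\<And>n. n < Suc (2 * B) \<Longrightarrow> v n \<in> borel_measurable N"
    "\<And>w. w \<in> space N \<Longrightarrow> \<exists>b\<in>K. G w b = 0 \<and> (\<forall>n<Suc (2 * B). H n w b = v n w)"
    "\<And>w b. w \<in> space N \<Longrightarrow> b \<in> K \<Longrightarrow> G w b = 0 \<Longrightarrow> H 0 w b \<le> v 0 w"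
    by (metis zero_less_Suc)
  then obtain s where s: "\<And>w. w \<in> space N \<Longrightarrow> s w \<in> K \<and> G w (s w) = 0 \<and> (\<forall>n<Suc (2 * B). H n w (s w) = v n w)"
    by metis
  have "(\<lambda>w. s w p) \<in> borel_measurable N" if "p \<in> P" for p
  proof -
    define e where "e = prod_encode p"
    have e: "Suc (2 * e) < Suc (2 * B)" "Suc (Suc (2 * e)) < Suc (2 * B)" using B[OF that] by (auto simp: e_def)
    have "Re (s w p) = v (Suc (2 * e)) w" "Im (s w p) = v (Suc (Suc (2 * e))) w" if "w \<in> space N" for w
    proof -
      have "H (Suc (2 * e)) w (s w) = v (Suc (2 * e)) w" "H (Suc (Suc (2 * e))) w (s w) = v (Suc (Suc (2 * e))) w"
        using s[OF that] e by blast+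
      then show "Re (s w p) = v (Suc (2 * e)) w" "Im (s w p) = v (Suc (Suc (2 * e))) w"
        by (simp_all add: H_def e_def)
    qed
    then have "s w p = Complex (v (Suc (2 * e)) w) (v (Suc (Suc (2 * e))) w)" if "w \<in> space N" for w
      using that by (simp add: complex_eq_iff)
    moreover have "(\<lambda>w. Complex (v (Suc (2 * e)) w) (v (Suc (Suc (2 * e))) w)) \<in> borel_measurable N"
      using v(1)[OF e(1)] v(1)[OF e(2)] by (simp add: borel_measurable_complex_iff)
    ultimately show ?thesis by (simp cong: measurable_cong)
  qed
  moreover have "F w b \<le> F w (s w)" if "w \<in> space N" "b \<in> K" "G w b = 0" for w b
  proof -
    have "H 0 w (s w) = v 0 w" using s[OF that(1)] by blast
    then show ?thesis using v(3)[OF that] by (simp add: H_def)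
  qed
  ultimately show ?thesis using s by (intro that) auto
qed


section \<open>Frames in the fibres and their measurable optimisation\<close>

definition gram :: "nat \<Rightarrow> (nat \<times> nat \<Rightarrow> complex) \<Rightarrow> nat \<Rightarrow> nat \<Rightarrow> complex" where
  "gram N b i i' = (\<Sum>k<N. b (i, k) * cnj (b (i', k)))"

definition act_row :: "nat \<Rightarrow> (nat \<Rightarrow> nat \<Rightarrow> complex) \<Rightarrow> (nat \<times> nat \<Rightarrow> complex) \<Rightarrow> nat \<Rightarrow> nat \<Rightarrow> complex" where
  "act_row N D b i k' = (\<Sum>k<N. b (i, k) * D k k')"

text \<open>For rows that are orthogonal and of norm 0 or 1, this is the orthogonal projection of
  row \<open>i\<close> of \<open>b D\<close> onto the span of the rows; equality with
  \<open>act_row\<close> therefore says that \<open>D\<close> maps the row into the span.\<close>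

definition projected_row :: "nat \<Rightarrow> nat \<Rightarrow> (nat \<Rightarrow> nat \<Rightarrow> complex) \<Rightarrow> (nat \<times> nat \<Rightarrow> complex) \<Rightarrow> nat \<Rightarrow> nat \<Rightarrow> complex" where
  "projected_row N l D b i k = (\<Sum>i'<l. (\<Sum>k'<N. act_row N D b i k' * cnj (b (i', k'))) * b (i', k))"

text \<open>The rows of \<open>b\<close> are orthogonal, of norm 0 or 1, supported where \<open>E = 1\<close>, and their span is
  invariant under right multiplication by each matrix \<open>D r\<close>.\<close>

definition feasible ::
  "nat \<Rightarrow> nat \<Rightarrow> 'r set \<Rightarrow> (nat \<Rightarrow> complex) \<Rightarrow> ('r \<Rightarrow> nat \<Rightarrow> nat \<Rightarrow> complex) \<Rightarrow> (nat \<times> nat \<Rightarrow> complex) \<Rightarrow> bool" where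
  "feasible N l R E D b \<longleftrightarrow>
     (\<forall>i<l. \<forall>i'<l. gram N b i i' * (if i = i' then gram N b i i - 1 else 1) = 0) \<and>
     (\<forall>i<l. \<forall>k<N. b (i, k) * (1 - E k) = 0) \<and>
     (\<forall>r\<in>R. \<forall>i<l. \<forall>k<N. act_row N (D r) b i k - projected_row N l (D r) b i k = 0)"

text \<open>Absolute values of the defining equations are added, so that feasibility is the zero set
  of a single continuous nonnegative function, as the selection lemma requires.\<close>

definition defect ::
  "nat \<Rightarrow> nat \<Rightarrow> 'r set \<Rightarrow> (nat \<Rightarrow> complex) \<Rightarrow> ('r \<Rightarrow> nat \<Rightarrow> nat \<Rightarrow> complex) \<Rightarrow> (nat \<times> nat \<Rightarrow> complex) \<Rightarrow> real" where
  "defect N l R E D b =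
     (\<Sum>i<l. \<Sum>i'<l. cmod (gram N b i i' * (if i = i' then gram N b i i - 1 else 1))) +
     (\<Sum>i<l. \<Sum>k<N. cmod (b (i, k) * (1 - E k))) +
     (\<Sum>r\<in>R. \<Sum>i<l. \<Sum>k<N. cmod (act_row N (D r) b i k - projected_row N l (D r) b i k))"

definition energy :: "nat \<Rightarrow> nat \<Rightarrow> nat \<Rightarrow> (nat \<Rightarrow> nat \<Rightarrow> complex) \<Rightarrow> (nat \<times> nat \<Rightarrow> complex) \<Rightarrow> real" where
  "energy N l m A b = (\<Sum>j=1..m. \<Sum>i<l. (cmod (\<Sum>k<N. A j k * cnj (b (i, k))))\<^sup>2)"

lemma defect_nonneg: "0 \<le> defect N l R E D b"
  unfolding defect_def by (intro add_nonneg_nonneg sum_nonneg) auto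

lemma defect_eq_0_iff: "finite R \<Longrightarrow> defect N l R E D b = 0 \<longleftrightarrow> feasible N l R E D b"
  unfolding defect_def feasible_def
  by (simp add: add_nonneg_eq_0_iff sum_nonneg sum_nonneg_eq_0_iff del: mult_eq_0_iff right_minus_eq)
    (auto simp only: Ball_def lessThan_iff)

lemma caratheodory_defect:
  assumes "\<And>k. k < N \<Longrightarrow> (\<lambda>w. E w k) \<in> borel_measurable \<Omega>"
    and "\<And>r k k'. r \<in> R \<Longrightarrow> k < N \<Longrightarrow> k' < N \<Longrightarrow> (\<lambda>w. D w r k k') \<in> borel_measurable \<Omega>"
  shows "caratheodory \<Omega> K (\<lambda>w. defect N l R (E w) (D w))"
proof -
  have coord: "continuous_on K (\<lambda>b :: nat \<times> nat \<Rightarrow> complex. b p)" for p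
    by (rule continuous_on_subset[OF continuous_on_product_coordinates]) auto
  have gram: "continuous_on K (\<lambda>b. gram N b i i')" for i i'
    unfolding gram_def by (intro continuous_intros coord)
  have "continuous_on K (\<lambda>b. gram N b i i' * (if i = i' then gram N b i i - 1 else 1))" for i i'
    by (cases "i = i'") (auto intro!: continuous_intros gram)
  moreover have "continuous_on K (\<lambda>b. b (i, k) * (1 - E w k))" for i k w
    by (intro continuous_intros coord)
  moreover have "continuous_on K (\<lambda>b. act_row N (D w r) b i k - projected_row N l (D w r) b i k)" for r i k w
    unfolding projected_row_def act_row_def by (intro continuous_intros coord)
  ultimately have c: "continuous_on K (defect N l R (E w) (D w))" for w
    unfolding defect_def[abs_def] by (intro continuous_on_add continuous_on_sum continuous_on_norm)
  have "(\<lambda>w. defect N l R (E w) (D w) b) \<in> borel_measurable \<Omega>" for b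
    unfolding defect_def projected_row_def act_row_def
    by (intro borel_measurable_add borel_measurable_sum measurable_compose[OF _ borel_measurable_norm] borel_measurable_times
        borel_measurable_diff borel_measurable_const assms) auto
  with c show ?thesis by (simp add: caratheodory_def)
qed

lemma caratheodory_energy:
  assumes "\<And>j k. j \<in> {1..m} \<Longrightarrow> k < N \<Longrightarrow> (\<lambda>w. A w j k) \<in> borel_measurable \<Omega>"
  shows "caratheodory \<Omega> K (\<lambda>w. energy N l m (A w))"
proof -
  have coord: "continuous_on K (\<lambda>b :: nat \<times> nat \<Rightarrow> complex. b p)" for p
    by (rule continuous_on_subset[OF continuous_on_product_coordinates]) auto
  have "continuous_on K (energy N l m (A w))" for w
    unfolding energy_def[abs_def] by (intro continuous_intros coord)
  moreover have "(\<lambda>w. energy N l m (A w) b) \<in> borel_measurable \<Omega>" for b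
    unfolding energy_def
    by (intro borel_measurable_sum borel_measurable_power measurable_compose[OF _ borel_measurable_norm] borel_measurable_times
        borel_measurable_const assms) auto
  ultimately show ?thesis by (simp add: caratheodory_def)
qed

lemma measurable_optimal_frame:
  fixes R :: "'r set"
  assumes R: "finite R"
    and E: "\<And>k. k < N \<Longrightarrow> (\<lambda>w. E w k) \<in> borel_measurable \<Omega>"
    and D: "\<And>r k k'. r \<in> R \<Longrightarrow> k < N \<Longrightarrow> k' < N \<Longrightarrow> (\<lambda>w. D w r k k') \<in> borel_measurable \<Omega>"
    and A: "\<And>j k. j \<in> {1..m} \<Longrightarrow> k < N \<Longrightarrow> (\<lambda>w. A w j k) \<in> borel_measurable \<Omega>"
  obtains s :: "'w \<Rightarrow> nat \<times> nat \<Rightarrow> complex"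
  where "\<forall>i<l. \<forall>k<N. (\<lambda>w. s w (i, k)) \<in> borel_measurable \<Omega>"
    and "\<forall>w\<in>space \<Omega>. (\<forall>p. cmod (s w p) \<le> 1) \<and> feasible N l R (E w) (D w) (s w) \<and>
      (\<forall>b. (\<forall>p. cmod (b p) \<le> 1) \<longrightarrow> feasible N l R (E w) (D w) b \<longrightarrow> energy N l m (A w) b \<le> energy N l m (A w) (s w))"
proof -
  let ?K = "{b. \<forall>p. cmod (b p) \<le> 1} :: (nat \<times> nat \<Rightarrow> complex) set"
  \<comment> \<open>The zero frame is always feasible, so the constraint set is nonempty over every
    \<open>w\<close>.\<close>
  have "feasible N l R (E w) (D w) (\<lambda>_. 0)" for w
    by (simp add: feasible_def gram_def act_row_def projected_row_def)
  then have z: "\<exists>b\<in>?K. defect N l R (E w) (D w) b = 0" for w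
    by (intro bexI[of _ "\<lambda>_. 0"]) (auto simp: defect_eq_0_iff[OF R])
  obtain s where s: "\<forall>p\<in>{..<l} \<times> {..<N}. (\<lambda>w. s w p) \<in> borel_measurable \<Omega>"
    "\<forall>w\<in>space \<Omega>. s w \<in> ?K \<and> defect N l R (E w) (D w) (s w) = 0 \<and>
      (\<forall>b\<in>?K. defect N l R (E w) (D w) b = 0 \<longrightarrow> energy N l m (A w) b \<le> energy N l m (A w) (s w))"
    by (rule measurable_argmax_unit_box[where P="{..<l} \<times> {..<N}", OF caratheodory_energy[OF A] caratheodory_defect[OF E D] defect_nonneg z])
      auto
  show ?thesis
    by (rule that[of s]) (use s in \<open>auto simp: defect_eq_0_iff[OF R]\<close>)
qed

context tiled_action
begin

subsection \<open>Projection of invariant spaces\<close>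

lemma bracket_rep_left:
  assumes f: "f \<in> L2 M" "g \<in> L2 M" and d: "d \<in> carrier T"
  shows "AE w in \<Omega>. bracket (\<rho> d f) g w = bracket f (\<rho> (inv d) g) w"
proof -
  have L: "\<rho> d f \<in> L2 M" "\<rho> (inv d) g \<in> L2 M" "\<rho> d (\<rho> (inv d) g) \<in> L2 M"
    using f d by (auto intro: rep_L2)
  have "AE w in \<Omega>. bracket g (\<rho> d f) w = bracket (\<rho> d (\<rho> (inv d) g)) (\<rho> d f) w"
    using rep_inv_AE[OF d f(2)] by (intro bracket_cong_left f L) (auto simp: eq_commute)
  with bracket_rep[OF f(1) L(2) d] show ?thesis
    by eventually_elim (metis bracket_cnj)
qed

text \<open>Zero vectors bring every competitor to a family of exactly \<open>l\<close> vectors, the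
  shape over which the frames are optimised.\<close>

lemma partial_orthonormal_pad:
  assumes "partial_orthonormal n e" "n \<le> l"
  shows "partial_orthonormal l (\<lambda>i. if i < n then e i else 0)"
proof -
  have r: "AE w in \<Omega>. bracket g 0 w = 0" if "g \<in> L2 M" for g
    using bracket_zero_left[OF that] by eventually_elim (metis bracket_cnj complex_cnj_zero)
  have z: "AE w in \<Omega>. bracket 0 0 w = 0 \<or> bracket 0 0 w = 1"
    using bracket_zero_left[OF L2_zero] by eventually_elim simp
  show ?thesis
    unfolding partial_orthonormal_def
  proof (intro conjI allI impI)
    fix i j :: nat
    show "(if i < n then e i else 0) \<in> L2 M" using partial_orthonormalD(1)[OF assms(1)] by (simp add: L2_zero)
    show "AE w in \<Omega>. bracket (if i < n then e i else 0) (if i < n then e i else 0) w = 0 \<or>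
        bracket (if i < n then e i else 0) (if i < n then e i else 0) w = 1"
      using partial_orthonormalD(3)[OF assms(1)] z by simp
    assume "i \<noteq> j"
    then show "AE w in \<Omega>. bracket (if i < n then e i else 0) (if j < n then e j else 0) w = 0"
      using partial_orthonormalD(1,2)[OF assms(1)] bracket_zero_left[OF L2_zero] bracket_zero_left r by auto
  qed
qed

lemma spans_pad:
  assumes "spans n e V" "n \<le> l" "0 \<in> V"
  shows "spans l (\<lambda>i. if i < n then e i else 0) V"
  unfolding spans_def
proof (intro conjI ballI allI impI)
  fix i assume "i < l" show "(if i < n then e i else 0) \<in> V" using assms by (simp add: spans_def)
next
  fix q f assume q: "q \<in> L2 M" and n: "\<forall>i<l. AE w in \<Omega>. bracket q (if i < n then e i else 0) w = 0" and f: "f \<in> V"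
  have "AE w in \<Omega>. bracket q (e i) w = 0" if "i < n" for i
    using n[rule_format, of i] that assms(2) by simp
  then show "l2_inner M q f = 0" using assms(1) q f by (simp add: spans_def)
qed

text \<open>Every element of \<open>\<Delta>\<close> factors through \<open>\<Gamma>\<close> and
  \<open>R\<close>, and the generated space is invariant under \<open>\<Gamma>\<close> by
  construction.\<close>

lemma inv_space_of_reps:
  assumes A: "A \<subseteq> L2 M" and \<Delta>: "\<Delta> \<subseteq> carrier T" and R: "R \<subseteq> carrier T"
    and fact: "\<And>d. d \<in> \<Delta> \<Longrightarrow> \<exists>c\<in>\<Gamma>. \<exists>r\<in>R. d = c \<otimes> r"
    and gens: "\<And>r \<phi>. r \<in> R \<Longrightarrow> \<phi> \<in> A \<Longrightarrow> \<rho> r \<phi> \<in> gen_space A"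
  shows "inv_space \<Delta> (gen_space A)"
proof (rule gen_space_invariant[OF A \<Delta>])
  fix d \<phi> assume d: "d \<in> \<Delta>" and \<phi>: "\<phi> \<in> A"
  obtain c r where cr: "c \<in> \<Gamma>" "r \<in> R" "d = c \<otimes> r" using fact[OF d] by blast
  have L: "\<rho> d \<phi> \<in> L2 M" using A \<phi> d \<Delta> by (auto intro!: rep_L2)
  have "\<rho> c (\<rho> r \<phi>) \<in> gen_space A"
    by (rule inv_spaceD(3)[OF gen_space_\<Gamma>_invariant[OF A] cr(1) gens[OF cr(2) \<phi>]])
  then show "\<rho> d \<phi> \<in> gen_space A"
    by (rule l2_closed_subspace_AE[OF gen_space_closed[OF A] _ L])
      (use rep_mult_AE[of c r \<phi>] cr R in \<open>auto simp: eq_commute\<close>)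
qed

lemma projection_unique:
  assumes S: "l2_closed_subspace M S" and f: "f \<in> L2 M" and p: "p \<in> S" "p' \<in> S"
    and o: "\<And>h. h \<in> S \<Longrightarrow> l2_inner M (f - p) h = 0" "\<And>h. h \<in> S \<Longrightarrow> l2_inner M (f - p') h = 0"
  shows "AE x in M. p x = p' x"
proof -
  have L: "p \<in> L2 M" "p' \<in> L2 M" using p l2_closed_subspaceD(1)[OF S] by auto
  have "p - p' \<in> S" using cfun_subspace_ops(3)[OF l2_closed_subspaceD(2)[OF S] p] .
  then have "l2_inner M ((f - p') - (f - p)) (p - p') = 0"
    using o f L by (subst l2_inner_diff_left) (auto intro: L2_diff)
  then show ?thesis using null_imp_AE_eq[OF L] by simp
qed

abbreviation orth_proj :: "('x \<Rightarrow> complex) set \<Rightarrow> ('x \<Rightarrow> complex) \<Rightarrow> 'x \<Rightarrow> complex" where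
  "orth_proj \<equiv> l2_proj M"

lemma orth_proj:
  assumes "l2_closed_subspace M S" "f \<in> L2 M"
  shows "orth_proj S f \<in> S" "orth_proj S f \<in> L2 M" "h \<in> S \<Longrightarrow> l2_inner M (f - orth_proj S f) h = 0"
  using l2_proj[OF mu.sigma_finite_measure_axioms assms] l2_closed_subspaceD(1)[OF assms(1)]
  by auto

text \<open>\<open>\<rho> d\<close> is unitary, and \<open>S\<close> is invariant under
  \<open>d\<close> and its inverse; so \<open>\<rho> d\<close> carries the orthogonal decomposition
  of \<open>f\<close> to that of \<open>\<rho> d f\<close>.\<close>

lemma orth_proj_rep:
  assumes S: "inv_space \<Delta> S" and \<Delta>: "subgroup \<Delta> T" and d: "d \<in> \<Delta>" and f: "f \<in> L2 M"
  shows "AE x in M. orth_proj S (\<rho> d f) x = \<rho> d (orth_proj S f) x"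
proof -
  note Sc = inv_spaceD(1)[OF S]
  have dc: "d \<in> carrier T" "inv d \<in> \<Delta>" using \<Delta> d by (auto simp: subgroup_def)
  note p = orth_proj[OF Sc f]
  show ?thesis
  proof (rule projection_unique[OF Sc rep_L2[OF dc(1) f]])
    show "orth_proj S (\<rho> d f) \<in> S" "\<And>h. h \<in> S \<Longrightarrow> l2_inner M (\<rho> d f - orth_proj S (\<rho> d f)) h = 0"
      using orth_proj[OF Sc rep_L2[OF dc(1) f]] by auto
    show "\<rho> d (orth_proj S f) \<in> S" using inv_spaceD(3)[OF S d p(1)] .
    fix h assume h: "h \<in> S"
    have "l2_inner M (\<rho> d f - \<rho> d (orth_proj S f)) h = l2_inner M (f - orth_proj S f) (\<rho> (inv d) h)"
      using h inv_spaceD(2)[OF S] f p dc by (subst rep_diff[symmetric], subst rep_adjoint) (auto intro: L2_diff)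
    also have "\<dots> = 0" using p(3)[OF inv_spaceD(3)[OF S dc(2) h]] .
    finally show "l2_inner M (\<rho> d f - \<rho> d (orth_proj S f)) h = 0" .
  qed
qed

lemma orth_proj_add:
  assumes S: "l2_closed_subspace M S" and f: "f \<in> L2 M" "g \<in> L2 M"
  shows "AE x in M. orth_proj S (f + g) x = (orth_proj S f + orth_proj S g) x"
proof (rule projection_unique[OF S L2_add[OF f]])
  note p = orth_proj[OF S f(1)] orth_proj[OF S f(2)]
  show "orth_proj S f + orth_proj S g \<in> S" using cfun_subspace_ops(2)[OF l2_closed_subspaceD(2)[OF S]] p by blast
  fix h assume h: "h \<in> S"
  have "f + g - (orth_proj S f + orth_proj S g) = (f - orth_proj S f) + (g - orth_proj S g)" by simp
  then show "l2_inner M (f + g - (orth_proj S f + orth_proj S g)) h = 0"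
    using h p f l2_closed_subspaceD(1)[OF S] by (simp only:) (subst l2_inner_add_left, auto intro: L2_diff)
qed (use orth_proj[OF S L2_add[OF f]] in auto)

lemma orth_proj_scale:
  assumes S: "l2_closed_subspace M S" and f: "f \<in> L2 M"
  shows "AE x in M. orth_proj S (cfun_scale c f) x = cfun_scale c (orth_proj S f) x"
proof (rule projection_unique[OF S L2_scale[OF f]])
  note p = orth_proj[OF S f]
  show "cfun_scale c (orth_proj S f) \<in> S" using cfun_subspace_ops(4)[OF l2_closed_subspaceD(2)[OF S] p(1)] .
  fix h assume h: "h \<in> S"
  show "l2_inner M (cfun_scale c f - cfun_scale c (orth_proj S f)) h = 0"
    using p(3)[OF h] by (simp add: l2_inner_scale_left flip: cfun.scale_right_diff_distrib)
qed (use orth_proj[OF S L2_scale[OF f]] in auto)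

lemma orth_proj_norm_le:
  assumes S: "l2_closed_subspace M S" and f: "f \<in> L2 M"
  shows "l2_norm M (orth_proj S f) \<le> l2_norm M f"
proof (rule power2_le_imp_le)
  have "(l2_norm M (f - 0))\<^sup>2 = (l2_norm M (f - orth_proj S f))\<^sup>2 + (l2_norm M (orth_proj S f - 0))\<^sup>2"
    using orth_proj[OF S f] cfun_subspace_ops(1)[OF l2_closed_subspaceD(2)[OF S]] by (intro l2_ortho_norm_le[OF S f])
  then show "(l2_norm M (orth_proj S f))\<^sup>2 \<le> (l2_norm M f)\<^sup>2" by simp
qed simp

lemma closed_orth_proj_preimage:
  assumes S: "l2_closed_subspace M S" and V: "l2_closed_subspace M V"
  shows "l2_closed_subspace M {f \<in> L2 M. orth_proj S f \<in> V}"
proof (rule l2_closed_subspaceI)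
  note ops = cfun_subspace_ops[OF l2_closed_subspaceD(2)[OF V]]
  have diff: "AE x in M. orth_proj S (f - g) x = (orth_proj S f - orth_proj S g) x" if "f \<in> L2 M" "g \<in> L2 M" for f g
    using orth_proj_add[OF S L2_diff[OF that] that(2)] by eventually_elim simp
  have "orth_proj S 0 \<in> V"
  proof -
    have "l2_norm M (orth_proj S 0) \<le> l2_norm M 0" by (rule orth_proj_norm_le[OF S L2_zero])
    moreover have "l2_norm M (0 :: 'x \<Rightarrow> complex) = 0" by (simp add: l2_norm_def)
    ultimately have "l2_norm M (orth_proj S 0) = 0"
      using l2_norm_nonneg[of M "orth_proj S 0"] by linarith
    then have "AE x in M. orth_proj S 0 x = 0" using l2_norm_eq_0 orth_proj(2)[OF S L2_zero] by blast
    then show ?thesis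
      using l2_closed_subspace_AE[OF V ops(1) orth_proj(2)[OF S L2_zero]] by simp
  qed
  moreover have "orth_proj S (f + g) \<in> V" if "f \<in> L2 M" "g \<in> L2 M" "orth_proj S f \<in> V" "orth_proj S g \<in> V" for f g
    by (rule l2_closed_subspace_AE[OF V ops(2)[OF that(3,4)] orth_proj(2)[OF S L2_add[OF that(1,2)]] orth_proj_add[OF S that(1,2)]])
  moreover have "orth_proj S (cfun_scale c f) \<in> V" if "f \<in> L2 M" "orth_proj S f \<in> V" for c f
    by (rule l2_closed_subspace_AE[OF V ops(4)[OF that(2)] orth_proj(2)[OF S L2_scale[OF that(1)]] orth_proj_scale[OF S that(1)]])
  ultimately show "cfun.subspace {f \<in> L2 M. orth_proj S f \<in> V}"
    by (auto simp: cfun.subspace_def L2_intros)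
  fix f assume f: "f \<in> L2 M" "\<And>e. 0 < e \<Longrightarrow> \<exists>k\<in>{f \<in> L2 M. orth_proj S f \<in> V}. l2_norm M (f - k) < e"
  have "orth_proj S f \<in> V"
  proof (rule l2_closed_subspace_approx[OF V orth_proj(2)[OF S f(1)]])
    fix e :: real assume "0 < e"
    then obtain k where k: "k \<in> L2 M" "orth_proj S k \<in> V" "l2_norm M (f - k) < e" using f(2) by blast
    have "l2_norm M (orth_proj S f - orth_proj S k) = l2_norm M (orth_proj S (f - k))"
    proof -
      have L: "orth_proj S f - orth_proj S k \<in> L2 M" "orth_proj S (f - k) \<in> L2 M"
        using orth_proj(2)[OF S] f(1) k(1) by (auto intro!: L2_diff)
      show ?thesis unfolding l2_norm_def
        using L diff[OF f(1) k(1)]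
        by (intro arg_cong[of _ _ sqrt] integral_cong_AE) (auto simp: L2_def elim!: eventually_mono)
    qed
    also have "\<dots> \<le> l2_norm M (f - k)" by (rule orth_proj_norm_le[OF S L2_diff[OF f(1) k(1)]])
    finally show "\<exists>g\<in>V. l2_norm M (orth_proj S f - g) < e" using k by force
  qed
  with f(1) show "f \<in> {f \<in> L2 M. orth_proj S f \<in> V}" by simp
qed auto

text \<open>The image of a closed space under \<open>orth_proj S\<close> need not be closed, so the
  space generated by the projected generators replaces it. The projection commutes with
  \<open>\<Delta>\<close>, which preserves length bound and invariance.\<close>

lemma projected_gen_space:
  assumes B: "B \<subseteq> L2 M" and \<Delta>: "subgroup \<Delta> T" "\<Gamma> \<subseteq> \<Delta>" and S: "inv_space \<Delta> S"
    and W: "inv_space \<Delta> (gen_space B)"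
  shows "w \<in> gen_space B \<Longrightarrow> orth_proj S w \<in> gen_space (orth_proj S ` B)"
    and "gen_space (orth_proj S ` B) \<subseteq> S"
    and "inv_space \<Delta> (gen_space (orth_proj S ` B))"
proof -
  note Sc = inv_spaceD(1)[OF S]
  have B': "orth_proj S ` B \<subseteq> L2 M" using orth_proj(2)[OF Sc] B by blast
  note cl = gen_space_closed[OF B']
  have \<Delta>c: "d \<in> carrier T" if "d \<in> \<Delta>" for d using \<Delta> that by (auto simp: subgroup_def)
  have sub: "gen_space B \<subseteq> {f \<in> L2 M. orth_proj S f \<in> gen_space (orth_proj S ` B)}"
  proof (rule gen_space_subset[OF B closed_orth_proj_preimage[OF Sc cl]])
    fix c \<phi> assume c: "c \<in> \<Gamma>" and \<phi>: "\<phi> \<in> B"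
    then have L: "\<phi> \<in> L2 M" "\<rho> c \<phi> \<in> L2 M" using B by (auto intro!: rep_L2)
    have "\<rho> c (orth_proj S \<phi>) \<in> gen_space (orth_proj S ` B)" using \<phi> c by (intro gen_space_rep[OF B']) auto
    then have "orth_proj S (\<rho> c \<phi>) \<in> gen_space (orth_proj S ` B)"
      by (rule l2_closed_subspace_AE[OF cl _ orth_proj(2)[OF Sc L(2)]])
        (use orth_proj_rep[OF S \<Delta>(1) _ L(1)] c \<Delta>(2) in blast)
    with L show "\<rho> c \<phi> \<in> {f \<in> L2 M. orth_proj S f \<in> gen_space (orth_proj S ` B)}" by simp
  qed
  then show "w \<in> gen_space B \<Longrightarrow> orth_proj S w \<in> gen_space (orth_proj S ` B)" for w by blast
  show "gen_space (orth_proj S ` B) \<subseteq> S"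
    using \<Delta>(2) orth_proj(1)[OF Sc] B inv_spaceD(3)[OF S] by (intro gen_space_subset[OF B' Sc]) blast
  show "inv_space \<Delta> (gen_space (orth_proj S ` B))"
  proof (rule gen_space_invariant[OF B'])
    show "\<Delta> \<subseteq> carrier T" using \<Delta>c by blast
    fix d \<phi>' assume d: "d \<in> \<Delta>" and "\<phi>' \<in> orth_proj S ` B"
    then obtain \<phi> where \<phi>: "\<phi> \<in> B" "\<phi>' = orth_proj S \<phi>" by blast
    have L: "\<phi> \<in> L2 M" using \<phi> B by blast
    have "\<rho> d \<phi> \<in> gen_space B" by (rule inv_spaceD(3)[OF W d gen_space_incl[OF B \<phi>(1)]])
    then have "orth_proj S (\<rho> d \<phi>) \<in> gen_space (orth_proj S ` B)" using sub by blast
    then show "\<rho> d \<phi>' \<in> gen_space (orth_proj S ` B)"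
      unfolding \<phi>(2)
      by (rule l2_closed_subspace_AE[OF cl _ rep_L2[OF \<Delta>c[OF d] orth_proj(2)[OF Sc L]]])
        (use orth_proj_rep[OF S \<Delta>(1) d L] in \<open>eventually_elim, simp\<close>)
  qed
qed


subsection \<open>Invariant spaces in coordinates\<close>

text \<open>Removes the minimum in the definition of length: a bound on it amounts to having some
  generating set of that size.\<close>

lemma class_C_extra_iff:
  "W \<in> class_C_extra T M \<sigma> J \<Gamma> \<Delta> l \<longleftrightarrow>
    (\<exists>B. finite B \<and> card B \<le> l \<and> B \<subseteq> L2 M \<and> W = gen_space B \<and> inv_space \<Delta> W)"
proof
  assume W: "W \<in> class_C_extra T M \<sigma> J \<Gamma> \<Delta> l"
  then have "\<exists>n A. finite A \<and> card A = n \<and> A \<subseteq> L2 M \<and> W = gen_space A"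
    by (auto simp: class_C_extra_def class_C_def finitely_generated_def)
  from LeastI_ex[OF this] W show "\<exists>B. finite B \<and> card B \<le> l \<and> B \<subseteq> L2 M \<and> W = gen_space B \<and> inv_space \<Delta> W"
    unfolding class_C_extra_def class_C_def space_length_def by (metis (mono_tags, lifting) mem_Collect_eq)
next
  assume "\<exists>B. finite B \<and> card B \<le> l \<and> B \<subseteq> L2 M \<and> W = gen_space B \<and> inv_space \<Delta> W"
  then obtain B where B: "finite B" "card B \<le> l" "B \<subseteq> L2 M" "W = gen_space B" "inv_space \<Delta> W" by blast
  have "space_length T M \<sigma> J \<Gamma> W \<le> card B"
    unfolding space_length_def using B by (intro Least_le) blast
  then show "W \<in> class_C_extra T M \<sigma> J \<Gamma> \<Delta> l"
    using B gen_space_\<Gamma>_invariant[OF B(3)]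
    unfolding class_C_extra_def class_C_def finitely_generated_def by auto
qed

context
  fixes N :: nat and e :: "nat \<Rightarrow> 'x \<Rightarrow> complex" and S :: "('x \<Rightarrow> complex) set" and \<Delta> R :: "'g set"
  assumes \<Delta>: "subgroup \<Delta> T" "\<Gamma> \<subseteq> \<Delta>" and R: "finite R" "R \<subseteq> \<Delta>"
    and S: "inv_space \<Delta> S" and e: "partial_orthonormal N e" and sp: "spans N e S"
begin

definition fiber_E :: "'w \<Rightarrow> nat \<Rightarrow> complex" where
  "fiber_E w k = bracket (e k) (e k) w"

text \<open>The matrix of \<open>\<rho> r\<close> in the family \<open>e\<close>, acting from the
  right: the coordinate row of \<open>\<rho> r f\<close> is that of \<open>f\<close> times this
  matrix, for \<open>f\<close> in \<open>S\<close>.\<close>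

definition fiber_D :: "'w \<Rightarrow> 'g \<Rightarrow> nat \<Rightarrow> nat \<Rightarrow> complex" where
  "fiber_D w r k k' = bracket (\<rho> r (e k)) (e k') w"

definition fiber_A :: "(nat \<Rightarrow> 'x \<Rightarrow> complex) \<Rightarrow> 'w \<Rightarrow> nat \<Rightarrow> nat \<Rightarrow> complex" where
  "fiber_A \<psi> w j k = bracket (\<psi> j) (e k) w"

lemma \<Delta>_carrier: "d \<in> \<Delta> \<Longrightarrow> d \<in> carrier T"
  using \<Delta> by (auto simp: subgroup_def)

lemma R_carrier: "r \<in> R \<Longrightarrow> r \<in> carrier T"
  using R \<Delta>_carrier by blast

lemma S_\<Gamma>: "inv_space \<Gamma> S"
  using S \<Delta>(2) by (auto simp: invariant_space_def)

lemma eL: "k < N \<Longrightarrow> e k \<in> L2 M"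
  using partial_orthonormalD(1)[OF e] .

lemma parseval:
  assumes "f \<in> S" "g \<in> L2 M"
  shows "AE w in \<Omega>. bracket f g w = (\<Sum>k<N. bracket f (e k) w * bracket (e k) g w)"
  by (rule partial_orthonormal_parseval[OF e S_\<Gamma> sp assms])

text \<open>The matrix of brackets \<open>bracket (f i) (e k) w\<close> is the required frame: each
  feasibility equation and the energy formula is an instance of Parseval, either in \<open>S\<close>
  or in \<open>V\<close>.\<close>

lemma candidate_frame:
  assumes f: "partial_orthonormal l f" and V: "inv_space \<Delta> V" and fV: "spans l f V" and VS: "V \<subseteq> S"
    and \<psi>: "\<And>j. j \<in> {1..m} \<Longrightarrow> \<psi> j \<in> S"
  shows "AE w in \<Omega>. \<exists>b. (\<forall>p. cmod (b p) \<le> 1) \<and> feasible N l R (fiber_E w) (fiber_D w) b \<and>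
    energy N l m (fiber_A \<psi> w) b = (\<Sum>j=1..m. \<Sum>i<l. (cmod (bracket (\<psi> j) (f i) w))\<^sup>2)"
proof -
  have V\<Gamma>: "inv_space \<Gamma> V" using V \<Delta>(2) by (auto simp: invariant_space_def)
  have fi: "f i \<in> V" "f i \<in> S" "f i \<in> L2 M" if "i < l" for i
    using fV VS partial_orthonormalD(1)[OF f] that by (auto simp: spans_def)
  have rf: "\<rho> r (f i) \<in> V" "\<rho> r (f i) \<in> S" "\<rho> r (f i) \<in> L2 M" if "r \<in> R" "i < l" for r i
    using inv_spaceD(3)[OF V _ fi(1)[OF that(2)], of r] that R VS inv_spaceD(2)[OF V] by auto
  have 1: "AE w in \<Omega>. \<forall>i<l. \<forall>k<N. cmod (bracket (f i) (e k) w) \<le> 1"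
  proof (intro AE_all_lessThan)
    fix i k assume i: "i < l" and k: "k < N"
    show "AE w in \<Omega>. cmod (bracket (f i) (e k) w) \<le> 1"
      using bracket_cauchy_schwarz[OF fi(3)[OF i] eL[OF k]] partial_orthonormalD(3)[OF f i] partial_orthonormalD(3)[OF e k]
    proof eventually_elim
      case (elim w)
      then have "(cmod (bracket (f i) (e k) w))\<^sup>2 \<le> 1" by auto
      then show ?case by (simp add: power_le_one_iff abs_square_le_1)
    qed
  qed
  have 2: "AE w in \<Omega>. \<forall>i<l. \<forall>i'<l. (\<Sum>k<N. bracket (f i) (e k) w * bracket (e k) (f i') w) = bracket (f i) (f i') w
      \<and> (if i = i' then bracket (f i) (f i) w = 0 \<or> bracket (f i) (f i) w = 1 else bracket (f i) (f i') w = 0)"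
  proof (intro AE_all_lessThan)
    fix i i' assume i: "i < l" and i': "i' < l"
    show "AE w in \<Omega>. (\<Sum>k<N. bracket (f i) (e k) w * bracket (e k) (f i') w) = bracket (f i) (f i') w
      \<and> (if i = i' then bracket (f i) (f i) w = 0 \<or> bracket (f i) (f i) w = 1 else bracket (f i) (f i') w = 0)"
    proof (cases "i = i'")
      case True
      then show ?thesis
        using parseval[OF fi(2)[OF i] fi(3)[OF i']] partial_orthonormalD(3)[OF f i] by (auto elim!: eventually_elim2)
    next
      case False
      then show ?thesis
        using parseval[OF fi(2)[OF i] fi(3)[OF i']] partial_orthonormalD(2)[OF f i i' False]
        by (auto elim!: eventually_elim2)
    qed
  qed
  have 3: "AE w in \<Omega>. \<forall>i<l. \<forall>k<N. bracket (f i) (e k) w * fiber_E w k = bracket (f i) (e k) w"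
    unfolding fiber_E_def by (intro AE_all_lessThan partial_orthonormal_absorb[OF e] fi)
  have 4: "AE w in \<Omega>. \<forall>i<l. \<forall>k'<N. (\<Sum>k<N. bracket (f i) (e k) w * fiber_D w r k k') = bracket (\<rho> r (f i)) (e k') w"
    if r: "r \<in> R" for r
  proof (intro AE_all_lessThan)
    fix i k' assume i: "i < l" and k': "k' < N"
    have rc: "r \<in> carrier T" by (rule R_carrier[OF r])
    have L: "\<rho> (inv r) (e k') \<in> L2 M" using rc eL[OF k'] by (auto intro: rep_L2)
    \<comment> \<open>Moving \<open>r\<close> to the second argument makes the sum the Parseval
      expansion of \<open>f i\<close> itself.\<close>
    have "AE w in \<Omega>. \<forall>k<N. fiber_D w r k k' = bracket (e k) (\<rho> (inv r) (e k')) w"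
      unfolding fiber_D_def by (intro AE_all_lessThan bracket_rep_left eL k' rc)
    with parseval[OF fi(2)[OF i] L] bracket_rep_left[OF fi(3)[OF i] eL[OF k'] rc]
    show "AE w in \<Omega>. (\<Sum>k<N. bracket (f i) (e k) w * fiber_D w r k k') = bracket (\<rho> r (f i)) (e k') w"
      by eventually_elim simp
  qed
  \<comment> \<open>Invariance of \<open>V\<close> enters here: \<open>\<rho> r (f i)\<close> lies
    in \<open>V\<close> and so expands in the family \<open>f\<close>.\<close>
  have 5: "AE w in \<Omega>. \<forall>i<l. \<forall>k<N. (\<Sum>i'<l. (\<Sum>k'<N. bracket (\<rho> r (f i)) (e k') w * bracket (e k') (f i') w) * bracket (f i') (e k) w)
      = bracket (\<rho> r (f i)) (e k) w" if r: "r \<in> R" for r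
  proof (intro AE_all_lessThan)
    fix i k assume i: "i < l" and k: "k < N"
    have "AE w in \<Omega>. \<forall>i'<l. bracket (\<rho> r (f i)) (f i') w = (\<Sum>k'<N. bracket (\<rho> r (f i)) (e k') w * bracket (e k') (f i') w)"
      by (intro AE_all_lessThan parseval rf r i fi)
    with partial_orthonormal_parseval[OF f V\<Gamma> fV rf(1)[OF r i] eL[OF k]]
    show "AE w in \<Omega>. (\<Sum>i'<l. (\<Sum>k'<N. bracket (\<rho> r (f i)) (e k') w * bracket (e k') (f i') w) * bracket (f i') (e k) w)
      = bracket (\<rho> r (f i)) (e k) w"
      by eventually_elim simp
  qed
  have 45: "AE w in \<Omega>. \<forall>r\<in>R. (\<forall>i<l. \<forall>k'<N. (\<Sum>k<N. bracket (f i) (e k) w * fiber_D w r k k') = bracket (\<rho> r (f i)) (e k') w) \<and>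
     (\<forall>i<l. \<forall>k<N. (\<Sum>i'<l. (\<Sum>k'<N. bracket (\<rho> r (f i)) (e k') w * bracket (e k') (f i') w) * bracket (f i') (e k) w)
      = bracket (\<rho> r (f i)) (e k) w)"
    using 4 5 by (intro AE_finite_allI[OF R(1)] AE_conjI)
  have 6: "AE w in \<Omega>. \<forall>j\<in>{1..m}. \<forall>i<l. (\<Sum>k<N. fiber_A \<psi> w j k * bracket (e k) (f i) w) = bracket (\<psi> j) (f i) w"
  proof (intro AE_finite_allI AE_all_lessThan)
    fix j i assume "j \<in> {1..m}" "i < l"
    from parseval[OF \<psi>[OF this(1)] fi(3)[OF this(2)]]
    show "AE w in \<Omega>. (\<Sum>k<N. fiber_A \<psi> w j k * bracket (e k) (f i) w) = bracket (\<psi> j) (f i) w"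
      unfolding fiber_A_def by eventually_elim simp
  qed simp
  from 1 2 3 45 6 show ?thesis
  proof eventually_elim
    case (elim w)
    \<comment> \<open>Entries outside the \<open>l\<close> by \<open>N\<close> block are set to 0,
      which keeps the frame in the unit box.\<close>
    define b where "b p = (if fst p < l \<and> snd p < N then bracket (f (fst p)) (e (snd p)) w else 0)" for p
    have b: "b (i, k) = bracket (f i) (e k) w" "cnj (b (i, k)) = bracket (e k) (f i) w" if "i < l" "k < N" for i k
      using that by (simp_all add: b_def bracket_cnj)
    have "cmod (b p) \<le> 1" for p using elim(1) by (simp add: b_def)
    moreover have gr: "gram N b i i' = bracket (f i) (f i') w" if "i < l" "i' < l" for i i'
      using elim(2) that by (simp add: gram_def b bracket_cnj)
    moreover have row: "act_row N (fiber_D w r) b i k' = bracket (\<rho> r (f i)) (e k') w" if "r \<in> R" "i < l" "k' < N" for r i k'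
      using elim(4) that by (simp add: act_row_def b)
    moreover have "projected_row N l (fiber_D w r) b i k = bracket (\<rho> r (f i)) (e k) w" if "r \<in> R" "i < l" "k < N" for r i k
      using elim(4) that by (simp add: projected_row_def b row bracket_cnj)
    moreover have "b (i, k) * (1 - fiber_E w k) = 0" if "i < l" "k < N" for i k
      using elim(3) that by (simp add: b right_diff_distrib)
    moreover have "gram N b i i' * (if i = i' then gram N b i i - 1 else 1) = 0" if "i < l" "i' < l" for i i'
      using elim(2) that by (auto simp: gr split: if_splits)
    moreover have "energy N l m (fiber_A \<psi> w) b = (\<Sum>j=1..m. \<Sum>i<l. (cmod (bracket (\<psi> j) (f i) w))\<^sup>2)"
      unfolding energy_def using elim(5) by (intro sum.cong refl) (simp add: b bracket_cnj)
    ultimately have "(\<forall>p. cmod (b p) \<le> 1) \<and> feasible N l R (fiber_E w) (fiber_D w) b \<and>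
      energy N l m (fiber_A \<psi> w) b = (\<Sum>j=1..m. \<Sum>i<l. (cmod (bracket (\<psi> j) (f i) w))\<^sup>2)"
      unfolding feasible_def by simp
    then show ?case by blast
  qed
qed

text \<open>The converse passage: the bounded measurable entries act as multipliers, and
  \<open>\<phi> i\<close> is the sum of the multiples \<open>s w (i, k)\<close> of
  \<open>e k\<close>. Feasibility then becomes orthonormality and invariance.\<close>

lemma frame_space:
  fixes s :: "'w \<Rightarrow> nat \<times> nat \<Rightarrow> complex"
  assumes sm: "\<And>i k. i < l \<Longrightarrow> k < N \<Longrightarrow> (\<lambda>w. s w (i, k)) \<in> borel_measurable \<Omega>"
    and s1: "\<And>w p. w \<in> space \<Omega> \<Longrightarrow> cmod (s w p) \<le> 1"
    and feas: "\<And>w. w \<in> space \<Omega> \<Longrightarrow> feasible N l R (fiber_E w) (fiber_D w) (s w)"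
    and fact: "\<And>d. d \<in> \<Delta> \<Longrightarrow> \<exists>c\<in>\<Gamma>. \<exists>r\<in>R. d = c \<otimes> r"
  obtains \<phi> where "partial_orthonormal l \<phi>" "inv_space \<Delta> (gen_space (\<phi> ` {..<l}))"
    "\<forall>g\<in>L2 M. \<forall>i<l. AE w in \<Omega>. bracket g (\<phi> i) w = (\<Sum>k<N. bracket g (e k) w * cnj (s w (i, k)))"
proof -
  have "\<exists>h. is_multiple (\<lambda>w. s w (i, k)) (e k) h" if ik: "i < l" "k < N" for i k
  proof (rule ex_multiple[OF eL[OF ik(2)] sm[OF ik]])
    have be: "integrable \<Omega> (\<lambda>w. Re (bracket (e k) (e k) w))"
      using bracket_integrable[OF eL[OF ik(2)] eL[OF ik(2)]] by simp
    show "integrable \<Omega> (\<lambda>w. (cmod (s w (i, k)))\<^sup>2 * Re (bracket (e k) (e k) w))"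
    proof (rule Bochner_Integration.integrable_bound[OF be])
      show "(\<lambda>w. (cmod (s w (i, k)))\<^sup>2 * Re (bracket (e k) (e k) w)) \<in> borel_measurable \<Omega>"
        using sm[OF ik] be by measurable
      show "AE w in \<Omega>. norm ((cmod (s w (i, k)))\<^sup>2 * Re (bracket (e k) (e k) w)) \<le> norm (Re (bracket (e k) (e k) w))"
        using s1 bracket_self(2)[of "e k"]
        by (intro AE_I2) (auto simp: abs_mult power_le_one intro!: mult_left_le_one_le)
    qed
  qed
  then obtain h where h: "\<And>i k. i < l \<Longrightarrow> k < N \<Longrightarrow> is_multiple (\<lambda>w. s w (i, k)) (e k) (h i k)" by metis
  have hL: "h i k \<in> L2 M" if "i < l" "k < N" for i k using h[OF that] by (simp add: is_multiple_def)
  define \<phi> where "\<phi> i = (\<Sum>k<N. h i k)" for i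
  have \<phi>L: "\<phi> i \<in> L2 M" if "i < l" for i unfolding \<phi>_def by (rule L2_sum) (use hL that in auto)
  have eS: "e k \<in> S" if "k < N" for k using sp that by (simp add: spans_def)
  have \<phi>S: "\<phi> i \<in> S" if "i < l" for i
    unfolding \<phi>_def
    by (rule cfun_subspace_ops(5)[OF inv_spaceD(4)[OF S]]) (use is_multiple_in_space[OF S_\<Gamma> eS h] that in auto)
  have \<phi>g: "AE w in \<Omega>. bracket (\<phi> i) g w = (\<Sum>k<N. s w (i, k) * bracket (e k) g w)" if i: "i < l" and g: "g \<in> L2 M" for i g
  proof -
    have "AE w in \<Omega>. bracket (\<phi> i) g w = (\<Sum>k<N. bracket (h i k) g w)"
      unfolding \<phi>_def using hL i g by (intro bracket_sum_left) auto
    moreover have "AE w in \<Omega>. \<forall>k<N. bracket (h i k) g w = s w (i, k) * bracket (e k) g w"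
      using h[OF i] g by (intro AE_all_lessThan) (simp add: is_multiple_def)
    ultimately show ?thesis by eventually_elim simp
  qed
  have g\<phi>: "AE w in \<Omega>. bracket g (\<phi> i) w = (\<Sum>k<N. bracket g (e k) w * cnj (s w (i, k)))" if i: "i < l" and g: "g \<in> L2 M" for i g
    using \<phi>g[OF that]
  proof eventually_elim
    case (elim w)
    have "bracket g (\<phi> i) w = cnj (bracket (\<phi> i) g w)" by (simp add: bracket_cnj)
    then show ?case by (simp add: elim bracket_cnj mult.commute)
  qed
  have feasAE: "AE w in \<Omega>. feasible N l R (fiber_E w) (fiber_D w) (s w)" using feas by (intro AE_I2)
  have \<phi>e: "AE w in \<Omega>. bracket (\<phi> i) (e k) w = s w (i, k)" if i: "i < l" and k: "k < N" for i k
  proof -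
    have "AE w in \<Omega>. \<forall>k'<N. k' \<noteq> k \<longrightarrow> bracket (e k') (e k) w = 0"
    proof (rule AE_all_lessThan)
      fix k' assume "k' < N"
      then show "AE w in \<Omega>. k' \<noteq> k \<longrightarrow> bracket (e k') (e k) w = 0"
        using partial_orthonormalD(2)[OF e _ k, of k'] by (cases "k' = k") auto
    qed
    with \<phi>g[OF i eL[OF k]] feasAE show ?thesis
    proof eventually_elim
      case (elim w)
      have "(\<Sum>k'<N. s w (i, k') * bracket (e k') (e k) w) = (\<Sum>k'<N. if k' = k then s w (i, k) * fiber_E w k else 0)"
        using elim(3) by (intro sum.cong refl) (auto simp: fiber_E_def)
      also have "\<dots> = s w (i, k) * fiber_E w k" using k by simp
      also have "\<dots> = s w (i, k)"
      proof -
        \<comment> \<open>The support condition makes the entries of \<open>s\<close> the true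
          coordinates, even where \<open>e k\<close> vanishes.\<close>
        have "s w (i, k) * (1 - fiber_E w k) = 0" using elim(2) i k unfolding feasible_def by blast
        then show ?thesis by (simp add: right_diff_distrib)
      qed
      finally show ?case using elim(1) by simp
    qed
  qed
  have \<phi>\<phi>: "AE w in \<Omega>. bracket (\<phi> i) (\<phi> i') w = gram N (s w) i i'" if i: "i < l" "i' < l" for i i'
  proof -
    have "AE w in \<Omega>. \<forall>k<N. bracket (\<phi> i) (e k) w = s w (i, k)" by (intro AE_all_lessThan \<phi>e i)
    with g\<phi>[OF i(2) \<phi>L[OF i(1)]] show ?thesis
      by eventually_elim (simp add: gram_def)
  qed
  have partial_orthonormal\<phi>: "partial_orthonormal l \<phi>"
    unfolding partial_orthonormal_def
  proof (intro conjI allI impI \<phi>L)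
    fix i assume i: "i < l"
    show "AE w in \<Omega>. bracket (\<phi> i) (\<phi> i) w = 0 \<or> bracket (\<phi> i) (\<phi> i) w = 1"
      using \<phi>\<phi>[OF i i] feasAE
    proof eventually_elim
      case (elim w)
      have "gram N (s w) i i * (if i = i then gram N (s w) i i - 1 else 1) = 0"
        using elim(2) i unfolding feasible_def by blast
      then show ?case using elim(1) by simp
    qed
    fix i' assume i': "i' < l" "i \<noteq> i'"
    show "AE w in \<Omega>. bracket (\<phi> i) (\<phi> i') w = 0"
      using \<phi>\<phi>[OF i i'(1)] feasAE
    proof eventually_elim
      case (elim w)
      have "gram N (s w) i i' * (if i = i' then gram N (s w) i i - 1 else 1) = 0"
        using elim(2) i i' unfolding feasible_def by blast
      then show ?case using elim(1) i' by simp
    qed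
  qed
  let ?W = "gen_space (\<phi> ` {..<l})"
  have AL: "\<phi> ` {..<l} \<subseteq> L2 M" using \<phi>L by auto
  note W\<Gamma> = gen_space_\<Gamma>_invariant[OF AL]
  have WS: "?W \<subseteq> S"
    using inv_spaceD(3)[OF S_\<Gamma>] \<phi>S by (intro gen_space_subset[OF AL inv_spaceD(1)[OF S]]) auto
  have "inv_space \<Delta> ?W"
  proof (rule inv_space_of_reps[OF AL])
    show "\<Delta> \<subseteq> carrier T" "R \<subseteq> carrier T" using \<Delta>_carrier R_carrier by auto
    show "\<exists>c\<in>\<Gamma>. \<exists>r\<in>R. d = c \<otimes> r" if "d \<in> \<Delta>" for d by (rule fact[OF that])
    fix r f assume r: "r \<in> R" and "f \<in> \<phi> ` {..<l}"
    then obtain i where i: "i < l" "f = \<phi> i" by auto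
    have rc: "r \<in> carrier T" by (rule R_carrier[OF r])
    have F: "\<rho> r (\<phi> i) \<in> S" "\<rho> r (\<phi> i) \<in> L2 M"
      using inv_spaceD(3)[OF S _ \<phi>S[OF i(1)]] r R rep_L2[OF rc \<phi>L[OF i(1)]] by auto
    \<comment> \<open>Invariance means that \<open>\<rho> r (\<phi> i)\<close> agrees with its
      projection \<open>p\<close> onto \<open>?W\<close>; the two are compared through their
      brackets with the \<open>e k\<close>.\<close>
    obtain p where p: "p \<in> ?W" "\<forall>h\<in>?W. l2_inner M (\<rho> r (\<phi> i) - p) h = 0"
      "\<forall>g\<in>L2 M. AE w in \<Omega>. bracket p g w = (\<Sum>i'<l. bracket (\<rho> r (\<phi> i)) (\<phi> i') w * bracket (\<phi> i') g w)"
      by (rule partial_orthonormal_projection[OF partial_orthonormal\<phi> W\<Gamma> partial_orthonormal_spans_gen_space[OF partial_orthonormal\<phi>] F(2)])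
    have pS: "p \<in> S" "p \<in> L2 M" using p(1) WS inv_spaceD(2)[OF S] by auto
    have rowAE: "AE w in \<Omega>. \<forall>k<N. bracket (\<rho> r (\<phi> i)) (e k) w = act_row N (fiber_D w r) (s w) i k"
    proof (rule AE_all_lessThan)
      fix k assume k: "k < N"
      have L: "\<rho> (inv r) (e k) \<in> L2 M" using rc eL[OF k] by (auto intro: rep_L2)
      have "AE w in \<Omega>. \<forall>k'<N. fiber_D w r k' k = bracket (e k') (\<rho> (inv r) (e k)) w"
        unfolding fiber_D_def by (intro AE_all_lessThan bracket_rep_left eL k rc)
      with bracket_rep_left[OF \<phi>L[OF i(1)] eL[OF k] rc] \<phi>g[OF i(1) L]
      show "AE w in \<Omega>. bracket (\<rho> r (\<phi> i)) (e k) w = act_row N (fiber_D w r) (s w) i k"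
        by eventually_elim (simp add: act_row_def)
    qed
    have "AE w in \<Omega>. bracket (\<rho> r (\<phi> i) - p) (e k) w = 0" if k: "k < N" for k
    proof -
      have a: "AE w in \<Omega>. \<forall>i'<l. bracket (\<phi> i') (e k) w = s w (i', k)"
        by (intro AE_all_lessThan \<phi>e k)
      have b: "AE w in \<Omega>. \<forall>i'<l. bracket (\<rho> r (\<phi> i)) (\<phi> i') w = (\<Sum>k'<N. bracket (\<rho> r (\<phi> i)) (e k') w * cnj (s w (i', k')))"
        by (intro AE_all_lessThan g\<phi> F)
      from a b rowAE bracket_diff_left[OF F(2) pS(2) eL[OF k]] p(3)[rule_format, OF eL[OF k]] feasAE
      show ?thesis
      proof eventually_elim
        case (elim w)
        have "bracket p (e k) w = projected_row N l (fiber_D w r) (s w) i k"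
          using elim(1,2,3,5) by (simp add: projected_row_def)
        moreover have "act_row N (fiber_D w r) (s w) i k - projected_row N l (fiber_D w r) (s w) i k = 0"
          using elim(6) r i(1) k unfolding feasible_def by blast
        ultimately show ?case using elim(3,4) k by simp
      qed
    qed
    \<comment> \<open>The difference is orthogonal to \<open>S\<close> and itself belongs to
      \<open>S\<close>, so it is null.\<close>
    then have "l2_inner M (\<rho> r (\<phi> i) - p) h = 0" if "h \<in> S" for h
      using sp L2_diff[OF F(2) pS(2)] that by (simp add: spans_def)
    moreover have "\<rho> r (\<phi> i) - p \<in> S" using cfun_subspace_ops(3)[OF inv_spaceD(4)[OF S] F(1) pS(1)] .
    ultimately have "AE x in M. \<rho> r (\<phi> i) x = p x" using null_imp_AE_eq[OF F(2) pS(2)] by blast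
    then show "\<rho> r f \<in> ?W"
      unfolding i(2) by (rule l2_closed_subspace_AE[OF inv_spaceD(1)[OF W\<Gamma>] p(1) F(2)])
  qed
  then show ?thesis using that[OF partial_orthonormal\<phi>] g\<phi> by blast
qed

end


subsection \<open>The optimal space\<close>

text \<open>Summing the fibrewise error formula over \<open>j\<close>. The last part admits any
  elements of \<open>V\<close> in place of projections, because the main comparison uses the
  projections of points of the competitor.\<close>

lemma approximation_error_bounds:
  assumes f: "partial_orthonormal l f" and V: "inv_space \<Gamma> V" and fV: "spans l f V" and \<psi>: "\<And>j. j \<in> {1..m} \<Longrightarrow> \<psi> j \<in> L2 M"
  defines "Q \<equiv> \<lambda>w. \<Sum>j=1..m. \<Sum>i<l. (cmod (bracket (\<psi> j) (f i) w))\<^sup>2"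
  shows "integrable \<Omega> Q"
    and "(\<Sum>j=1..m. (l2_norm M (\<psi> j - orth_proj V (\<psi> j)))\<^sup>2) = (\<Sum>j=1..m. (l2_norm M (\<psi> j))\<^sup>2) - (LINT w|\<Omega>. Q w)"
    and "(\<And>j. j \<in> {1..m} \<Longrightarrow> g j \<in> V) \<Longrightarrow>
      (\<Sum>j=1..m. (l2_norm M (\<psi> j))\<^sup>2) - (LINT w|\<Omega>. Q w) \<le> (\<Sum>j=1..m. (l2_norm M (\<psi> j - g j))\<^sup>2)"
proof -
  note Vc = inv_spaceD(1)[OF V]
  have *: "integrable \<Omega> (\<lambda>w. \<Sum>i<l. (cmod (bracket (\<psi> j) (f i) w))\<^sup>2) \<and>
    (l2_norm M (\<psi> j - orth_proj V (\<psi> j)))\<^sup>2 = (l2_norm M (\<psi> j))\<^sup>2 - (LINT w|\<Omega>. (\<Sum>i<l. (cmod (bracket (\<psi> j) (f i) w))\<^sup>2))"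
    if j: "j \<in> {1..m}" for j
  proof -
    \<comment> \<open>\<open>l2_proj\<close> is chosen abstractly; uniqueness identifies it almost
      everywhere with the explicit projection \<open>p\<close>.\<close>
    obtain p where p: "p \<in> V" "\<forall>h\<in>V. l2_inner M (\<psi> j - p) h = 0"
      "\<forall>g\<in>L2 M. AE w in \<Omega>. bracket p g w = (\<Sum>i<l. bracket (\<psi> j) (f i) w * bracket (f i) g w)"
      "(l2_norm M (\<psi> j - p))\<^sup>2 = (l2_norm M (\<psi> j))\<^sup>2 - (LINT w|\<Omega>. (\<Sum>i<l. (cmod (bracket (\<psi> j) (f i) w))\<^sup>2))"
      "integrable \<Omega> (\<lambda>w. \<Sum>i<l. (cmod (bracket (\<psi> j) (f i) w))\<^sup>2)"
      by (rule partial_orthonormal_projection[OF f V fV \<psi>[OF j]])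
    note q = orth_proj[OF Vc \<psi>[OF j]]
    have pL: "p \<in> L2 M" using p(1) inv_spaceD(2)[OF V] by blast
    have "(l2_norm M (\<psi> j - orth_proj V (\<psi> j)))\<^sup>2 = (l2_norm M (\<psi> j - p))\<^sup>2 + (l2_norm M (p - orth_proj V (\<psi> j)))\<^sup>2"
      using p by (intro l2_ortho_norm_le[OF Vc \<psi>[OF j] p(1) _ q(1)]) auto
    also have "l2_norm M (p - orth_proj V (\<psi> j)) = 0"
      using projection_unique[OF Vc \<psi>[OF j] p(1) q(1) _ q(3)] p(2) l2_norm_diff_eq_0[OF pL q(2)] by blast
    finally have "(l2_norm M (\<psi> j - orth_proj V (\<psi> j)))\<^sup>2 = (l2_norm M (\<psi> j - p))\<^sup>2"
      by (simp only: power_zero_numeral add_0_right)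
    then show ?thesis unfolding p(4) using p(5) by (rule conjI[rotated])
  qed
  then show "integrable \<Omega> Q" unfolding Q_def by (intro Bochner_Integration.integrable_sum[of "{1..m}"]) blast
  have Qi: "(LINT w|\<Omega>. Q w) = (\<Sum>j=1..m. LINT w|\<Omega>. (\<Sum>i<l. (cmod (bracket (\<psi> j) (f i) w))\<^sup>2))"
    unfolding Q_def using * by (intro Bochner_Integration.integral_sum[of "{1..m}"]) blast
  show eq: "(\<Sum>j=1..m. (l2_norm M (\<psi> j - orth_proj V (\<psi> j)))\<^sup>2) = (\<Sum>j=1..m. (l2_norm M (\<psi> j))\<^sup>2) - (LINT w|\<Omega>. Q w)"
    unfolding Qi sum_subtractf[symmetric] using * by (intro sum.cong) auto
  assume g: "\<And>j. j \<in> {1..m} \<Longrightarrow> g j \<in> V"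
  show "(\<Sum>j=1..m. (l2_norm M (\<psi> j))\<^sup>2) - (LINT w|\<Omega>. Q w) \<le> (\<Sum>j=1..m. (l2_norm M (\<psi> j - g j))\<^sup>2)"
    unfolding eq[symmetric]
  proof (rule sum_mono)
    fix j assume j: "j \<in> {1..m}"
    have "(l2_norm M (\<psi> j - g j))\<^sup>2 = (l2_norm M (\<psi> j - orth_proj V (\<psi> j)))\<^sup>2 + (l2_norm M (orth_proj V (\<psi> j) - g j))\<^sup>2"
      using orth_proj[OF Vc \<psi>[OF j]] by (intro l2_ortho_norm_le[OF Vc \<psi>[OF j] _ _ g[OF j]]) auto
    then show "(l2_norm M (\<psi> j - orth_proj V (\<psi> j)))\<^sup>2 \<le> (l2_norm M (\<psi> j - g j))\<^sup>2" by simp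
  qed
qed

text \<open>Enumerate \<open>B\<close>, orthonormalise in the fibres, and pad with zeros up to
  \<open>l\<close>.\<close>

lemma ex_spanning_family_card:
  assumes B: "finite B" "card B \<le> l" "B \<subseteq> L2 M"
  obtains f where "partial_orthonormal l f" "spans l f (gen_space B)"
proof -
  obtain v where v: "B = v ` {i. i < card B}"
    using finite_imp_nat_seg_image_inj_on[OF B(1)] by (metis card_Collect_less_nat card_image)
  then have vB: "v ` {..<card B} = B" by (simp add: lessThan_def)
  have "v k \<in> L2 M" if "k < card B" for k using vB B(3) that by blast
  then obtain e where e: "partial_orthonormal (card B) e" "spans (card B) e (gen_space (v ` {..<card B}))"
    using ex_spanning_family by blast
  have "0 \<in> gen_space B" using cfun_subspace_ops(1)[OF inv_spaceD(4)[OF gen_space_\<Gamma>_invariant[OF B(3)]]] .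
  then show ?thesis
    using that[OF partial_orthonormal_pad[OF e(1) B(2)]] spans_pad[OF e(2) B(2)] vB by simp
qed

lemma optimal_invariant_space:
  fixes m :: nat
  assumes \<Delta>: "subgroup \<Delta> T" "\<Gamma> \<subseteq> \<Delta>" and R: "finite R" "R \<subseteq> \<Delta>"
    and fact: "\<And>d. d \<in> \<Delta> \<Longrightarrow> \<exists>c\<in>\<Gamma>. \<exists>r\<in>R. d = c \<otimes> r"
    and \<psi>: "\<And>j. j \<in> {1..m} \<Longrightarrow> \<psi> j \<in> L2 M"
  shows "\<exists>Wstar \<in> class_C_extra T M \<sigma> J \<Gamma> \<Delta> l. \<forall>W \<in> class_C_extra T M \<sigma> J \<Gamma> \<Delta> l.
    (\<Sum>j=1..m. (l2_norm M (\<psi> j - l2_proj M Wstar (\<psi> j)))\<^sup>2)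
      \<le> (\<Sum>j=1..m. (l2_norm M (\<psi> j - l2_proj M W (\<psi> j)))\<^sup>2)"
proof -
  have \<Delta>c: "d \<in> carrier T" if "d \<in> \<Delta>" for d using \<Delta> that by (auto simp: subgroup_def)
  have Rc: "r \<in> carrier T" if "r \<in> R" for r using \<Delta>c R that by blast
  \<comment> \<open>Finitely many functions whose \<open>\<Gamma>\<close>-translates already give
    all \<open>\<Delta>\<close>-translates of the data, up to null functions.\<close>
  define A where "A = (\<lambda>(r, j). \<rho> r (\<psi> j)) ` (R \<times> {1..m})"
  have "finite A" unfolding A_def using R(1) by blast
  moreover have "A \<subseteq> L2 M"
    unfolding A_def by clarify (rule rep_L2[OF Rc \<psi>])
  ultimately have A: "finite A" "A \<subseteq> L2 M" by auto
  define S where "S = gen_space A"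
  have \<psi>S': "\<rho> d (\<psi> j) \<in> S" if d: "d \<in> \<Delta>" and j: "j \<in> {1..m}" for d j
  proof -
    obtain c r where cr: "c \<in> \<Gamma>" "r \<in> R" "d = c \<otimes> r" using fact[OF d] by blast
    have "\<rho> r (\<psi> j) \<in> A" using cr j by (auto simp: A_def)
    then have "\<rho> c (\<rho> r (\<psi> j)) \<in> S" unfolding S_def by (rule gen_space_rep[OF A(2) cr(1)])
    moreover have "AE x in M. \<rho> d (\<psi> j) x = \<rho> c (\<rho> r (\<psi> j)) x"
      using rep_mult_AE[OF \<Gamma>_carrier[OF cr(1)] Rc[OF cr(2)], of "\<psi> j"]
      by eventually_elim (simp add: cr(3))
    ultimately show ?thesis
      unfolding S_def
      by (intro l2_closed_subspace_AE[OF gen_space_closed[OF A(2)] _ rep_L2[OF \<Delta>c[OF d] \<psi>[OF j]]])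
  qed
  \<comment> \<open>The identity may be missing from \<open>R\<close>, so the data are recovered by
    taking \<open>\<one>\<close> as the element of \<open>\<Delta>\<close>.\<close>
  have \<psi>S: "\<psi> j \<in> S" if j: "j \<in> {1..m}" for j
    using l2_closed_subspace_AE[OF gen_space_closed[OF A(2)], folded S_def, OF \<psi>S'[OF _ j] \<psi>[OF j], of \<one>]
      rep_one_AE[of "\<psi> j"] \<Delta> by (auto simp: subgroup_def eq_commute)
  have S: "inv_space \<Delta> S"
    unfolding S_def
  proof (rule gen_space_invariant[OF A(2)])
    show "\<Delta> \<subseteq> carrier T" using \<Delta>c by blast
    fix d a assume d: "d \<in> \<Delta>" and "a \<in> A"
    then obtain r j where rj: "r \<in> R" "j \<in> {1..m}" "a = \<rho> r (\<psi> j)" by (auto simp: A_def)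
    have dr: "d \<otimes> r \<in> \<Delta>" using d rj R \<Delta> by (auto simp: subgroup_def)
    have "AE x in M. \<rho> d a x = \<rho> (d \<otimes> r) (\<psi> j) x"
      unfolding rj(3) by (rule rep_mult_AE[OF \<Delta>c[OF d] Rc[OF rj(1)]])
    then show "\<rho> d a \<in> gen_space A"
      by (rule l2_closed_subspace_AE[OF gen_space_closed[OF A(2)] \<psi>S'[OF dr rj(2), unfolded S_def]
            rep_L2[OF \<Delta>c[OF d]], rotated]) (use \<open>a \<in> A\<close> A in auto)
  qed
  note S\<Gamma> = gen_space_\<Gamma>_invariant[OF A(2), folded S_def]
  note Sc = inv_spaceD(1)[OF S]
  define N where "N = card A"
  obtain e where e: "partial_orthonormal N e" "spans N e S"
    unfolding S_def N_def by (rule ex_spanning_family_card[OF A(1) order.refl A(2)])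
  note ctx = \<Delta> R S e
  note eL = partial_orthonormalD(1)[OF e(1)]
  obtain s where sm: "\<forall>i<l. \<forall>k<N. (\<lambda>w. s w (i, k)) \<in> borel_measurable \<Omega>"
    and s: "\<forall>w\<in>space \<Omega>. (\<forall>p. cmod (s w p) \<le> 1) \<and> feasible N l R (fiber_E e w) (fiber_D e w) (s w) \<and>
      (\<forall>b. (\<forall>p. cmod (b p) \<le> 1) \<longrightarrow> feasible N l R (fiber_E e w) (fiber_D e w) b \<longrightarrow>
        energy N l m (fiber_A e \<psi> w) b \<le> energy N l m (fiber_A e \<psi> w) (s w))"
  proof (rule measurable_optimal_frame[where N=N and R=R and E="fiber_E e" and D="fiber_D e" and A="fiber_A e \<psi>" and m=m and l=l and \<Omega>=\<Omega>])
    show "finite R" by (rule R(1))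
    show "(\<lambda>w. fiber_E e w k) \<in> borel_measurable \<Omega>" if "k < N" for k
      unfolding fiber_E_def[OF ctx] using bracket_integrable[OF eL[OF that] eL[OF that]] by simp
    show "(\<lambda>w. fiber_D e w r k k') \<in> borel_measurable \<Omega>" if "r \<in> R" "k < N" "k' < N" for r k k'
      unfolding fiber_D_def[OF ctx] using bracket_integrable[OF rep_L2[OF Rc[OF that(1)] eL[OF that(2)]] eL[OF that(3)]] by simp
    show "(\<lambda>w. fiber_A e \<psi> w j k) \<in> borel_measurable \<Omega>" if "j \<in> {1..m}" "k < N" for j k
      unfolding fiber_A_def[OF ctx] using bracket_integrable[OF \<psi>[OF that(1)] eL[OF that(2)]] by simp
  qed
  obtain \<phi> where \<phi>: "partial_orthonormal l \<phi>" "inv_space \<Delta> (gen_space (\<phi> ` {..<l}))"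
    "\<forall>g\<in>L2 M. \<forall>i<l. AE w in \<Omega>. bracket g (\<phi> i) w = (\<Sum>k<N. bracket g (e k) w * cnj (s w (i, k)))"
    by (rule frame_space[OF ctx, of l s]) (use sm s fact in auto)
  define Ws where "Ws = gen_space (\<phi> ` {..<l})"
  have \<phi>L: "\<phi> ` {..<l} \<subseteq> L2 M" using partial_orthonormalD(1)[OF \<phi>(1)] by auto
  have "card (\<phi> ` {..<l}) \<le> l" using card_image_le[of "{..<l}" \<phi>] by simp
  then have WsC: "Ws \<in> class_C_extra T M \<sigma> J \<Gamma> \<Delta> l"
    unfolding class_C_extra_iff using \<phi>(2) \<phi>L by (auto simp: Ws_def)
  note Ws\<Gamma> = gen_space_\<Gamma>_invariant[OF \<phi>L, folded Ws_def]
  let ?Q = "\<lambda>f w. \<Sum>j=1..m. \<Sum>i<l. (cmod (bracket (\<psi> j) (f i) w))\<^sup>2"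
  note sp\<phi> = partial_orthonormal_spans_gen_space[OF \<phi>(1), folded Ws_def]
  have Wserr: "integrable \<Omega> (?Q \<phi>)"
    "(\<Sum>j=1..m. (l2_norm M (\<psi> j - orth_proj Ws (\<psi> j)))\<^sup>2) = (\<Sum>j=1..m. (l2_norm M (\<psi> j))\<^sup>2) - (LINT w|\<Omega>. ?Q \<phi> w)"
    by (rule approximation_error_bounds(1)[OF \<phi>(1) Ws\<Gamma> sp\<phi>], rule \<psi>, assumption)
      (rule approximation_error_bounds(2)[OF \<phi>(1) Ws\<Gamma> sp\<phi>], rule \<psi>, assumption)
  have Qs: "AE w in \<Omega>. ?Q \<phi> w = energy N l m (fiber_A e \<psi> w) (s w)"
  proof -
    have "AE w in \<Omega>. \<forall>j\<in>{1..m}. \<forall>i<l. bracket (\<psi> j) (\<phi> i) w = (\<Sum>k<N. bracket (\<psi> j) (e k) w * cnj (s w (i, k)))"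
      using \<phi>(3) \<psi> by (intro AE_finite_allI AE_all_lessThan) auto
    then show ?thesis
      by eventually_elim (simp add: energy_def fiber_A_def[OF ctx])
  qed
  show ?thesis
  proof (rule bexI[OF _ WsC], rule ballI)
    fix W assume "W \<in> class_C_extra T M \<sigma> J \<Gamma> \<Delta> l"
    then obtain B where B: "finite B" "card B \<le> l" "B \<subseteq> L2 M" "W = gen_space B" "inv_space \<Delta> W"
      unfolding class_C_extra_iff by blast
    note Wc = inv_spaceD(1)[OF B(5)]
    \<comment> \<open>The competitor is replaced by the space generated by its projected generators,
      which lies in \<open>S\<close> and can be compared fibre by fibre.\<close>
    define B' where "B' = orth_proj S ` B"
    have B': "finite B'" "card B' \<le> l" "B' \<subseteq> L2 M"
      using B card_image_le[of B "orth_proj S"] orth_proj(2)[OF Sc] by (auto simp: B'_def)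
    note proj = projected_gen_space[OF B(3) \<Delta> S B(5)[unfolded B(4)], folded B'_def]
    note V\<Gamma> = gen_space_\<Gamma>_invariant[OF B'(3)]
    obtain f where f: "partial_orthonormal l f" "spans l f (gen_space B')" by (rule ex_spanning_family_card[OF B'])
    have Verr: "integrable \<Omega> (?Q f)"
      "(\<And>j. j \<in> {1..m} \<Longrightarrow> g j \<in> gen_space B') \<Longrightarrow>
        (\<Sum>j=1..m. (l2_norm M (\<psi> j))\<^sup>2) - (LINT w|\<Omega>. ?Q f w) \<le> (\<Sum>j=1..m. (l2_norm M (\<psi> j - g j))\<^sup>2)" for g
      by (rule approximation_error_bounds(1)[OF f(1) V\<Gamma> f(2)], rule \<psi>, assumption)
        (rule approximation_error_bounds(3)[OF f(1) V\<Gamma> f(2)], rule \<psi>)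
    have cand: "AE w in \<Omega>. \<exists>b. (\<forall>p. cmod (b p) \<le> 1) \<and> feasible N l R (fiber_E e w) (fiber_D e w) b \<and>
        energy N l m (fiber_A e \<psi> w) b = ?Q f w"
      by (rule candidate_frame[OF ctx f(1) proj(3) f(2) proj(2)]) (rule \<psi>S)
    have le: "AE w in \<Omega>. ?Q f w \<le> ?Q \<phi> w"
      using cand Qs AE_space
    proof eventually_elim
      case (elim w)
      then obtain b where b: "\<forall>p. cmod (b p) \<le> 1" "feasible N l R (fiber_E e w) (fiber_D e w) b"
        "energy N l m (fiber_A e \<psi> w) b = ?Q f w" by blast
      have "energy N l m (fiber_A e \<psi> w) b \<le> energy N l m (fiber_A e \<psi> w) (s w)"
        using s elim(3) b(1,2) by blast
      then show ?case using b(3) elim(2) by simp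
    qed
    have "(\<Sum>j=1..m. (l2_norm M (\<psi> j - orth_proj Ws (\<psi> j)))\<^sup>2) = (\<Sum>j=1..m. (l2_norm M (\<psi> j))\<^sup>2) - (LINT w|\<Omega>. ?Q \<phi> w)"
      by (rule Wserr(2))
    also have "\<dots> \<le> (\<Sum>j=1..m. (l2_norm M (\<psi> j))\<^sup>2) - (LINT w|\<Omega>. ?Q f w)"
      using integral_mono_AE[OF Verr(1) Wserr(1) le] by simp
    \<comment> \<open>\<open>orth_proj S (orth_proj W (\<psi> j))\<close> is one element of the
      projected competitor, and the best error there is at most the error of this element.\<close>
    also have "\<dots> \<le> (\<Sum>j=1..m. (l2_norm M (\<psi> j - orth_proj S (orth_proj W (\<psi> j))))\<^sup>2)"
      using proj(1) orth_proj(1)[OF Wc \<psi>] B(4) by (intro Verr(2)) auto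
    also have "\<dots> \<le> (\<Sum>j=1..m. (l2_norm M (\<psi> j - orth_proj W (\<psi> j)))\<^sup>2)"
    proof (rule sum_mono)
      fix j assume j: "j \<in> {1..m}"
      let ?p = "orth_proj W (\<psi> j)"
      have pL: "?p \<in> L2 M" by (rule orth_proj(2)[OF Wc \<psi>[OF j]])
      \<comment> \<open>Pythagoras with \<open>\<psi> j\<close> in \<open>S\<close>: projecting an
        approximant to \<open>S\<close> cannot move it away from \<open>\<psi> j\<close>.\<close>
      have "(l2_norm M (?p - \<psi> j))\<^sup>2 = (l2_norm M (?p - orth_proj S ?p))\<^sup>2 + (l2_norm M (orth_proj S ?p - \<psi> j))\<^sup>2"
        using orth_proj[OF Sc pL] by (intro l2_ortho_norm_le[OF Sc pL _ _ \<psi>S[OF j]]) auto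
      then show "(l2_norm M (\<psi> j - orth_proj S ?p))\<^sup>2 \<le> (l2_norm M (\<psi> j - ?p))\<^sup>2"
        by (simp add: l2_norm_minus_commute[of M "\<psi> j"])
    qed
    finally show "(\<Sum>j=1..m. (l2_norm M (\<psi> j - l2_proj M Ws (\<psi> j)))\<^sup>2)
      \<le> (\<Sum>j=1..m. (l2_norm M (\<psi> j - l2_proj M W (\<psi> j)))\<^sup>2)" .
  qed
qed

end

section \<open>Tiles for subgroups, coset representatives and assembly of the theorem\<close>

context quasi_invariant_action
begin

text \<open>The union of the translates of a tile for the whole group by representatives of the
  cosets of \<open>G\<close> is a tile for \<open>G\<close>, since every element factors uniquely as
  an element of \<open>G\<close> times a representative.\<close>

lemma ex_subgroup_tile:
  assumes G: "subgroup G T" and cT: "countable (carrier T)" and tile: "tiling_property T M \<sigma>"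
  obtains C where "C \<in> sets M" "AE x in M. \<exists>!a. a \<in> G \<and> x \<in> \<sigma> a ` C"
proof -
  obtain C0 where C0: "C0 \<in> sets M"
    "emeasure M (space M - (\<Union>g\<in>carrier T. \<sigma> g ` C0)) = 0"
    "\<And>g h. g \<in> carrier T \<Longrightarrow> h \<in> carrier T \<Longrightarrow> g \<noteq> h \<Longrightarrow> emeasure M (\<sigma> g ` C0 \<inter> \<sigma> h ` C0) = 0"
    using tile by (auto simp: tiling_property_def)
  have Gc: "g \<in> carrier T" if "g \<in> G" for g using G that by (auto simp: subgroup_def)
  \<comment> \<open>The choice depends on \<open>t\<close> only through its coset, so equal cosets
    receive literally the same representative.\<close>
  define rp where "rp t = (SOME r. r \<in> G #> t)" for t
  have rp: "rp t \<in> G #> t" if "t \<in> carrier T" for t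
    unfolding rp_def by (rule someI[of _ t]) (rule rcos_self[OF that G])
  define Q where "Q = rp ` carrier T"
  have Qc: "q \<in> carrier T" if "q \<in> Q" for q
    using that rp r_coset_subset_G[OF subgroup.subset[OF G]] by (auto simp: Q_def)
  have uniq: "a = b \<and> q = q'" if q: "q \<in> Q" "q' \<in> Q" and a: "a \<in> G" "b \<in> G" and eq: "a \<otimes> q = b \<otimes> q'" for a b q q'
  proof -
    obtain t t' where t: "t \<in> carrier T" "t' \<in> carrier T" "q = rp t" "q' = rp t'" using q by (auto simp: Q_def)
    have "G #> q = G #> t" "G #> q' = G #> t'"
      using repr_independence[OF rp[OF t(1)] t(1) G] repr_independence[OF rp[OF t(2)] t(2) G] t by auto
    moreover have "a \<otimes> q \<in> G #> q" "b \<otimes> q' \<in> G #> q'" using a by (auto simp: r_coset_def)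
    moreover have "G #> (a \<otimes> q) = G #> q" "G #> (b \<otimes> q') = G #> q'"
      using repr_independence[OF \<open>a \<otimes> q \<in> G #> q\<close> Qc[OF q(1)] G]
        repr_independence[OF \<open>b \<otimes> q' \<in> G #> q'\<close> Qc[OF q(2)] G] by auto
    ultimately have "G #> t = G #> t'" using eq by simp
    then have "q = q'" unfolding t(3,4) rp_def by simp
    then have "a \<otimes> q = b \<otimes> q" using eq by simp
    then have "a = b" using Gc[OF a(1)] Gc[OF a(2)] Qc[OF q(1)] by simp
    with \<open>q = q'\<close> show ?thesis by simp
  qed
  have decomp: "\<exists>a\<in>G. \<exists>q\<in>Q. t = a \<otimes> q" if t: "t \<in> carrier T" for t
  proof -
    obtain h where h: "h \<in> G" "rp t = h \<otimes> t" using rp[OF t] by (auto simp: r_coset_def)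
    have "t = inv h \<otimes> rp t" using h Gc[OF h(1)] t by (simp flip: m_assoc)
    moreover have "inv h \<in> G" using G h by (auto simp: subgroup_def)
    ultimately show ?thesis using t by (auto simp: Q_def)
  qed
  define C where "C = (\<Union>q\<in>Q. \<sigma> q ` C0)"
  have cQ: "countable Q" unfolding Q_def using cT by simp
  have Cs: "C \<in> sets M"
    unfolding C_def using cQ Qc C0(1) by (intro sets.countable_UN'') (auto intro: \<sigma>_image_sets)
  have im: "\<sigma> a ` C = (\<Union>q\<in>Q. \<sigma> (a \<otimes> q) ` C0)" if a: "a \<in> G" for a
  proof -
    have "\<sigma> a ` \<sigma> q ` C0 = \<sigma> (a \<otimes> q) ` C0" if "q \<in> Q" for q
      unfolding image_image using Gc[OF a] Qc[OF that] sets.sets_into_space[OF C0(1)]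
      by (intro image_cong) (auto simp: \<sigma>_comp)
    then show ?thesis unfolding C_def image_UN by auto
  qed
  have ts: "\<sigma> g ` C0 \<in> sets M" if "g \<in> carrier T" for g using that C0(1) by (rule \<sigma>_image_sets)
  have cov: "AE x in M. \<exists>g\<in>carrier T. x \<in> \<sigma> g ` C0"
  proof (rule AE_I[OF _ C0(2)])
    show "space M - (\<Union>g\<in>carrier T. \<sigma> g ` C0) \<in> sets M"
      using cT ts by (intro sets.Diff sets.top sets.countable_UN'') auto
  qed auto
  \<comment> \<open>Countability of the group gathers the pairwise null overlaps into one null
    set.\<close>
  have dis: "AE x in M. \<forall>g\<in>carrier T. \<forall>h\<in>carrier T. g \<noteq> h \<longrightarrow> \<not> (x \<in> \<sigma> g ` C0 \<and> x \<in> \<sigma> h ` C0)"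
  proof (intro AE_ball_countable[OF cT, THEN iffD2] ballI)
    fix g h assume gh: "g \<in> carrier T" "h \<in> carrier T"
    show "AE x in M. g \<noteq> h \<longrightarrow> \<not> (x \<in> \<sigma> g ` C0 \<and> x \<in> \<sigma> h ` C0)"
    proof (cases "g = h")
      case False
      have "AE x in M. x \<notin> \<sigma> g ` C0 \<inter> \<sigma> h ` C0"
        using C0(3)[OF gh False] ts gh by (intro AE_not_in) (auto simp: null_sets_def)
      then show ?thesis by eventually_elim simp
    qed simp
  qed
  from cov dis have "AE x in M. \<exists>!a. a \<in> G \<and> x \<in> \<sigma> a ` C"
  proof eventually_elim
    case (elim x)
    obtain t where t: "t \<in> carrier T" "x \<in> \<sigma> t ` C0" using elim(1) by blast
    obtain a q where a: "a \<in> G" "q \<in> Q" "t = a \<otimes> q" using decomp[OF t(1)] by blast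
    show ?case
    proof (rule ex1I[of _ a])
      show "a \<in> G \<and> x \<in> \<sigma> a ` C" using a t im by auto
      fix b assume b: "b \<in> G \<and> x \<in> \<sigma> b ` C"
      then obtain q' where q': "q' \<in> Q" "x \<in> \<sigma> (b \<otimes> q') ` C0" using im by blast
      have "b \<otimes> q' \<in> carrier T" using b q' Gc Qc by simp
      then have "b \<otimes> q' = a \<otimes> q" using elim(2) t q' a(3) by blast
      then show "b = a" using uniq[OF q'(1) a(2) _ a(1)] b by blast
    qed
  qed
  with Cs show ?thesis by (rule that)
qed

end

text \<open>The cosets of \<open>G'\<close> that meet \<open>H\<close> are among the finitely many
  cosets in the whole group, and a representative can be taken inside \<open>H\<close>.\<close>

lemma (in comm_group) finite_coset_representatives:
  assumes G: "subgroup G' G" and H: "subgroup H G" "G' \<subseteq> H" and fin: "finite (carrier (G Mod G'))"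
  obtains R where "finite R" "R \<subseteq> H" "\<And>d. d \<in> H \<Longrightarrow> \<exists>c\<in>G'. \<exists>r\<in>R. d = c \<otimes> r"
proof -
  define rp where "rp K = (SOME r. r \<in> H \<and> r \<in> K)" for K
  let ?K = "(\<lambda>d. G' #> d) ` H"
  have Hc: "d \<in> carrier G" if "d \<in> H" for d using H that by (auto simp: subgroup_def)
  have rp: "rp (G' #> d) \<in> H \<and> rp (G' #> d) \<in> G' #> d" if "d \<in> H" for d
    unfolding rp_def by (rule someI[of _ d]) (use that rcos_self[OF Hc[OF that] G] in simp)
  have "?K \<subseteq> carrier (G Mod G')" using Hc by (auto simp: FactGroup_def RCOSETS_def)
  then have "finite (rp ` ?K)" using fin finite_subset by blast
  moreover have "rp ` ?K \<subseteq> H" using rp by auto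
  moreover have "\<exists>c\<in>G'. \<exists>r\<in>rp ` ?K. d = c \<otimes> r" if d: "d \<in> H" for d
  proof -
    obtain h where h: "h \<in> G'" "rp (G' #> d) = h \<otimes> d" using rp[OF d] by (auto simp: r_coset_def)
    have hc: "h \<in> carrier G" using G h by (auto simp: subgroup_def)
    have "d = inv h \<otimes> rp (G' #> d)" using h hc Hc[OF d] by (simp flip: m_assoc)
    moreover have "inv h \<in> G'" using G h by (auto simp: subgroup_def)
    ultimately show ?thesis using d by blast
  qed
  ultimately show ?thesis by (rule that)
qed

theorem theorem4p4:
  fixes T :: "'g monoid" and \<Gamma> \<Delta> :: "'g set"
    and M :: "'x measure"
    and \<sigma> :: "'g \<Rightarrow> 'x \<Rightarrow> 'x" and J :: "'g \<Rightarrow> 'x \<Rightarrow> real"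
    and l m :: nat and \<psi> :: "nat \<Rightarrow> 'x \<Rightarrow> complex"
  assumes "comm_group T" and "countable (carrier T)"
    and "subgroup \<Gamma> T" and "subgroup \<Delta> T" and "\<Gamma> \<subseteq> \<Delta>"
    and "finite (carrier (T Mod \<Gamma>))"
    and "sigma_finite_measure M"
    and "measurable_action T M \<sigma>"
    and "is_jacobian T M \<sigma> J"
    and "tiling_property T M \<sigma>"
    and "\<And>j. j \<in> {1..m} \<Longrightarrow> \<psi> j \<in> L2 M"
  shows "\<exists>Wstar \<in> class_C_extra T M \<sigma> J \<Gamma> \<Delta> l. \<forall>W \<in> class_C_extra T M \<sigma> J \<Gamma> \<Delta> l.
           (\<Sum>j=1..m. (l2_norm M (\<psi> j - l2_proj M Wstar (\<psi> j)))\<^sup>2)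
             \<le> (\<Sum>j=1..m. (l2_norm M (\<psi> j - l2_proj M W (\<psi> j)))\<^sup>2)"
proof -
  interpret comm_group T by fact
  interpret mu: sigma_finite_measure M by fact
  interpret quasi_invariant_action T M \<sigma> J
    by (unfold_locales) (use assms in auto)
  have \<Gamma>c: "\<Gamma> \<subseteq> carrier T" using assms(3) subgroup.subset by blast
  have c\<Gamma>: "countable \<Gamma>" using \<Gamma>c assms(2) countable_subset by blast
  obtain C where C: "C \<in> sets M" "AE x in M. \<exists>!a. a \<in> \<Gamma> \<and> x \<in> \<sigma> a ` C"
    using ex_subgroup_tile[OF assms(3,2,10)] by blast
  obtain R where R: "finite R" "R \<subseteq> \<Delta>" "\<And>d. d \<in> \<Delta> \<Longrightarrow> \<exists>c\<in>\<Gamma>. \<exists>r\<in>R. d = c \<otimes>\<^bsub>T\<^esub> r"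
    using finite_coset_representatives[OF assms(3-6)] by blast
  \<comment> \<open>The random characters are those of \<open>\<Gamma>\<close>, which therefore has
    to be presented as a group in its own right.\<close>
  have "comm_group (T\<lparr>carrier := \<Gamma>\<rparr>)"
    by (rule group.group_comm_groupI[OF subgroup.subgroup_is_group[OF assms(3) is_group]])
      (use \<Gamma>c m_comm in auto)
  then interpret G: countable_comm_group "T\<lparr>carrier := \<Gamma>\<rparr>"
    using c\<Gamma> by (simp add: countable_comm_group_def countable_comm_group_axioms_def)
  obtain \<Omega> :: "(nat \<Rightarrow> real) measure" and \<xi>
    where \<Omega>: "prob_space \<Omega>"
      "\<And>a. a \<in> \<Gamma> \<Longrightarrow> \<xi> a \<in> borel_measurable \<Omega>"
      "\<And>a b w. a \<in> \<Gamma> \<Longrightarrow> b \<in> \<Gamma> \<Longrightarrow> \<xi> (a \<otimes>\<^bsub>T\<^esub> b) w = \<xi> a w * \<xi> b w"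
      "\<And>a w. cmod (\<xi> a w) = 1"
      "\<And>a. a \<in> \<Gamma> \<Longrightarrow> a \<noteq> \<one>\<^bsub>T\<^esub> \<Longrightarrow> (LINT w|\<Omega>. \<xi> a w) = 0"
      "sets \<Omega> = sigma_sets (space \<Omega>)
        ({{w \<in> space \<Omega>. c < Re (\<xi> a w)} | a c. a \<in> \<Gamma>} \<union> {{w \<in> space \<Omega>. c < Im (\<xi> a w)} | a c. a \<in> \<Gamma>})"
    using G.ex_random_character by auto
  interpret prob: prob_space \<Omega> by fact
  interpret subgroup \<Gamma> T by fact
  interpret tiled_action T M \<sigma> J \<Omega> \<Gamma> \<xi> C
    by unfold_locales (fact assms(3) \<Omega> c\<Gamma> C)+
  show ?thesis
    by (rule optimal_invariant_space[OF assms(4,5) R assms(11)])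
qed

end
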